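(* Let $d\ge 1$. (1) (Liouville theorem) Let $u\in\mathcal Z'(\mathbb R^d)$. Then $u$ is harmonic with respect to the logarithmic Laplacian, i.e. $\log(-\Delta)u=0$ in $\mathcal Z'(\mathbb R^d)$, if and only if $\hat u\in\mathcal{SL}(S^{d-1})$. (2) (Classification of fundamental solutions) Let $E\in\mathcal Z'(\mathbb R^d)$. Then $E$ is a fundamental solution of the logarithmic Laplacian, i.e. $\log(-\Delta)E=\delta_0$ in $\mathcal Z'(\mathbb R^d)$, if and only if $\hat E=\hat E_{\log}+v$ for some $v\in\mathcal{SL}(S^{d-1})$. Here $\hat u$ and $\hat E$ denote the Fourier transforms of the normalized tempered representatives of $u$ and $E$ described in the context; the right-hand side of each equivalence includes the assertion that such a representative exists.
   Context: Fourier transform: $\mathcal F(f)(\xi)=\hat f(\xi)=\int_{\mathbb R^d}e^{-ix\cdot\xi}f(x)\,dx$ on the Schwartz space $\mathcal S(\mathbb R^d)$, extended to tempered distributions $\mathcal S'(\mathbb R^d)$ by duality. $\mathcal D(\mathbb R^d)$ is the space of smooth compactly supported (complex-valued) functions and $\mathcal D'(\mathbb R^d)$ the space of distributions. $S^{d-1}$ is the unit sphere of $\mathbb R^d$ ($S^0=\{-1,1\}$). Lizorkin space: $\mathcal Z(\mathbb R^d)=\{\varphi\in\mathcal S(\mathbb R^d):\int_{\mathbb R^d}x^\alpha\varphi(x)\,dx=0\text{ for all }\alpha\in\mathbb N_0^d\}$, with the topology induced by $\mathcal S(\mathbb R^d)$; equivalently $\varphi\in\mathcal S(\mathbb R^d)$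 with $\partial^\alpha\hat\varphi(0)=0$ for all $\alpha$. $\mathcal Z'(\mathbb R^d)$ is the space of continuous linear functionals on $\mathcal Z(\mathbb R^d)$. It is identified with $\mathcal S'(\mathbb R^d)/\mathcal P(\mathbb R^d)$, where $\mathcal P(\mathbb R^d)$ is the space of polynomials: each element of $\mathcal Z'(\mathbb R^d)$ is the restriction to $\mathcal Z(\mathbb R^d)$ of some tempered distribution (a representative), unique up to adding a polynomial. Logarithmic Laplacian: for $\varphi\in\mathcal Z(\mathbb R^d)$, $\log(-\Delta)\varphi\in\mathcal Z(\mathbb R^d)$ is the function with $\mathcal F(\log(-\Delta)\varphi)(\xi)=2\log(|\xi|)\hat\varphi(\xi)$ for $\xi\neq 0$. For $u\in\mathcal Z'(\mathbb R^d)$, $\log(-\Delta)u\in\mathcal Z'(\mathbb R^d)$ is defined by $\langle\log(-\Delta)u,\varphi\rangle=\langle u,\log(-\Delta)\varphi\rangle$ for all $\varphi\in\mathcal Z(\mathbb R^d)$. Thus $\log(-\Delta)E=\delta_0$ in $\mathcal Z'(\mathbb R^d)$ means $\langle E,\log(-\Delta)\varphi\rangle=\varphi(0)$ for all $\varphi\in\mathcal Z(\mathbb R^d)$, and $\log(-\Delta)u=0$ in $\mathcal Z'(\mathbb R^d)$ means $\langle u,\log(-\Delta)\varphi\rangle=0$ for all $\varphi\in\mathcal Z(\mathbb R^d)$. Normalized representative (convention): an element of $\mathcal Z'(\mathbb R^d)$ is identified with its representative $u\in\mathcal S'(\mathbb R^d)$ such that $\hat u$ coincides with a locally integrable function in some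 sufficiently small neighbourhood of $0$. Such a representative is unique if it exists, because the Fourier transform of a polynomial is supported at $\{0\}$. Distributions on the sphere: fix a smooth radial function $\Lambda:\mathbb R^d\to\mathbb R$ with support contained in the open ball of radius $2$ centred at $0$, with $0\notin\operatorname{supp}\Lambda$, and with $\Lambda=1$ on $S^{d-1}$. For $\tau:S^{d-1}\to\mathbb C$ put $(\operatorname{Ext}\tau)(\xi)=\tau(\xi/|\xi|)\Lambda(\xi)$ (and $0$ at $\xi=0$). $\mathcal D(S^{d-1})$ is the space of $\tau$ with $\operatorname{Ext}\tau\in\mathcal D(\mathbb R^d)$, with the topology generated by the seminorms $\tilde p_m(\tau)=\sup_{|\xi|<2,\,|\alpha|\le m}|\partial^\alpha(\operatorname{Ext}\tau)(\xi)|$, $m\in\mathbb N_0$. $\mathcal D'(S^{d-1})$ is the space of continuous linear functionals on $\mathcal D(S^{d-1})$. Single layer distributions: $\mathcal{SL}(S^{d-1})$ is the set of $T\in\mathcal D'(\mathbb R^d)$ for which there exists $\tilde T\in\mathcal D'(S^{d-1})$ with $\langle T,\varphi\rangle=\langle\tilde T,\varphi|_{S^{d-1}}\rangle$ for all $\varphi\in\mathcal D(\mathbb R^d)$. (Such $T$ has compact support, hence is tempered.) The distribution $\hat E_{\log}\in\mathcal S'(\mathbb R^d)$ is defined, for $\varphi\in\mathcal S(\mathbb R^d)$, by $$\langle\hat E_{\log},\varphi\rangle=\frac12\int_{||\xi|-1|<1}\frac{\varphi(\xi)-\varphi\left(\frac{\xi}{|\xi|}\right)}{\log|\xi|}\,d\xi+\frac12\int_{|\xi|>2}\frac{\varphi(\xi)}{\log|\xi|}\,d\xi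 .$$ *)

theory Defs
  imports "HOL-Analysis.Analysis"
begin

text \<open>The space R^d, d >= 1, is an arbitrary type of class \<^class>\<open>euclidean_space\<close>.
  Distributions are complex-valued maps on all functions of the relevant type; only their values
  on the respective test space matter, and equality of two of them means equality there.\<close>

definition pderiv_dir :: "'a::euclidean_space \<Rightarrow> ('a \<Rightarrow> 'b::real_normed_vector) \<Rightarrow> 'a \<Rightarrow> 'b"
  where "pderiv_dir b f x = frechet_derivative f (at x) b"

text \<open>Iterated partial derivatives are indexed by words over \<^const>\<open>Basis\<close> instead of multi-indices:
  a word \<open>bs\<close> stands for the multi-index counting the occurrences of each basis vector,
  whose order is \<open>length bs\<close>. For smooth functions the order of the letters is irrelevant.\<close>

primrec pderivs :: "'a::euclidean_space list \<Rightarrow> ('a \<Rightarrow> 'b::real_normed_vector) \<Rightarrow> 'a \<Rightarrow> 'b"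
  where
    "pderivs [] f = f"
  | "pderivs (b # bs) f = pderiv_dir b (pderivs bs f)"

definition words :: "nat \<Rightarrow> 'a::euclidean_space list set"
  where "words m = {bs. set bs \<subseteq> Basis \<and> length bs \<le> m}"

definition smooth :: "('a::euclidean_space \<Rightarrow> 'b::real_normed_vector) \<Rightarrow> bool"
  where "smooth f \<longleftrightarrow> (\<forall>bs\<in>lists Basis. pderivs bs f differentiable_on UNIV)"

definition supp :: "('a::topological_space \<Rightarrow> 'b::zero) \<Rightarrow> 'a set"
  where "supp f = closure {x. f x \<noteq> 0}"

definition seminorm_topology ::
    "('a \<Rightarrow> complex) set \<Rightarrow> (nat \<Rightarrow> ('a \<Rightarrow> complex) \<Rightarrow> real) \<Rightarrow> ('a \<Rightarrow> complex) topology"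
  where "seminorm_topology V p =
    topology_generated_by {{g \<in> V. p m (\<lambda>x. g x - f x) < e} |f m e. f \<in> V \<and> 0 < e}"

definition continuous_dual ::
    "('a \<Rightarrow> complex) topology \<Rightarrow> (('a \<Rightarrow> complex) \<Rightarrow> complex) set"
  where "continuous_dual X =
    {T. (\<forall>f\<in>topspace X. \<forall>g\<in>topspace X. \<forall>a b.
            T (\<lambda>x. a * f x + b * g x) = a * T f + b * T g)
        \<and> continuous_map X euclidean T}"

definition schwartz :: "('a::euclidean_space \<Rightarrow> complex) set"
  where "schwartz = {\<phi>. smooth \<phi> \<and>
    (\<forall>bs\<in>lists Basis. \<forall>k. bounded (range (\<lambda>x. (1 + norm x) ^ k *\<^sub>R pderivs bs \<phi> x)))}"

definition schwartz_seminorm :: "nat \<Rightarrow> ('a::euclidean_space \<Rightarrow> complex) \<Rightarrow> real"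
  where "schwartz_seminorm m \<phi> =
    (SUP (bs, x)\<in>words m \<times> UNIV. (1 + norm x) ^ m * norm (pderivs bs \<phi> x))"

definition schwartz_topology :: "('a::euclidean_space \<Rightarrow> complex) topology"
  where "schwartz_topology = seminorm_topology schwartz schwartz_seminorm"

definition tempered_distributions :: "(('a::euclidean_space \<Rightarrow> complex) \<Rightarrow> complex) set"
  where "tempered_distributions = continuous_dual schwartz_topology"

definition fourier :: "('a::euclidean_space \<Rightarrow> complex) \<Rightarrow> 'a \<Rightarrow> complex"
  where "fourier f \<xi> = (LINT x|lborel. exp (- \<i> * of_real (x \<bullet> \<xi>)) * f x)"

definition fourier_dist ::
    "(('a::euclidean_space \<Rightarrow> complex) \<Rightarrow> complex) \<Rightarrow> ('a \<Rightarrow> complex) \<Rightarrow> complex"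
  where "fourier_dist T \<phi> = T (fourier \<phi>)"

definition test_functions :: "('a::euclidean_space \<Rightarrow> complex) set"
  where "test_functions = {\<phi>. smooth \<phi> \<and> compact (supp \<phi>)}"

definition sup_seminorm :: "nat \<Rightarrow> ('a::euclidean_space \<Rightarrow> complex) \<Rightarrow> real"
  where "sup_seminorm m \<phi> = (SUP (bs, x)\<in>words m \<times> UNIV. norm (pderivs bs \<phi> x))"

definition test_topology_on :: "'a::euclidean_space set \<Rightarrow> ('a \<Rightarrow> complex) topology"
  where "test_topology_on K = seminorm_topology {\<phi> \<in> test_functions. supp \<phi> \<subseteq> K} sup_seminorm"

text \<open>The space of test functions carries the inductive limit topology of the spaces of test
  functions supported in a fixed compact set. A linear functional is continuous for it iff all
  its restrictions to those spaces are. Any two test functions lie in a common one, so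
  linearity on each of them is linearity on the whole space.\<close>

definition distributions :: "(('a::euclidean_space \<Rightarrow> complex) \<Rightarrow> complex) set"
  where "distributions = {T. \<forall>K. compact K \<longrightarrow> T \<in> continuous_dual (test_topology_on K)}"

definition lizorkin :: "('a::euclidean_space \<Rightarrow> complex) set"
  where "lizorkin = {\<phi> \<in> schwartz.
    \<forall>\<alpha> :: 'a \<Rightarrow> nat. (LINT x|lborel. of_real (\<Prod>b\<in>Basis. (x \<bullet> b) ^ \<alpha> b) * \<phi> x) = 0}"

definition lizorkin_dual :: "(('a::euclidean_space \<Rightarrow> complex) \<Rightarrow> complex) set"
  where "lizorkin_dual = continuous_dual (subtopology schwartz_topology lizorkin)"

definition log_laplacian :: "('a::euclidean_space \<Rightarrow> complex) \<Rightarrow> 'a \<Rightarrow> complex"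
  where "log_laplacian \<phi> = (THE \<psi>. \<psi> \<in> lizorkin \<and>
    (\<forall>\<xi>. \<xi> \<noteq> 0 \<longrightarrow> fourier \<psi> \<xi> = of_real (2 * ln (norm \<xi>)) * fourier \<phi> \<xi>))"

definition log_laplacian_dist ::
    "(('a::euclidean_space \<Rightarrow> complex) \<Rightarrow> complex) \<Rightarrow> ('a \<Rightarrow> complex) \<Rightarrow> complex"
  where "log_laplacian_dist u \<phi> = u (log_laplacian \<phi>)"

definition log_harmonic :: "(('a::euclidean_space \<Rightarrow> complex) \<Rightarrow> complex) \<Rightarrow> bool"
  where "log_harmonic u \<longleftrightarrow> (\<forall>\<phi>\<in>lizorkin. log_laplacian_dist u \<phi> = 0)"

definition log_fundamental_solution :: "(('a::euclidean_space \<Rightarrow> complex) \<Rightarrow> complex) \<Rightarrow> bool"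
  where "log_fundamental_solution E \<longleftrightarrow> (\<forall>\<phi>\<in>lizorkin. log_laplacian_dist E \<phi> = \<phi> 0)"

definition locally_integrable_on :: "'a::euclidean_space set \<Rightarrow> ('a \<Rightarrow> complex) \<Rightarrow> bool"
  where "locally_integrable_on V g \<longleftrightarrow>
    (\<forall>K. compact K \<and> K \<subseteq> V \<longrightarrow> set_integrable lborel K g)"

definition normalized_representative ::
    "(('a::euclidean_space \<Rightarrow> complex) \<Rightarrow> complex) \<Rightarrow> (('a \<Rightarrow> complex) \<Rightarrow> complex) \<Rightarrow> bool"
  where "normalized_representative u U \<longleftrightarrow>
    U \<in> tempered_distributions \<and> (\<forall>\<phi>\<in>lizorkin. U \<phi> = u \<phi>) \<and>
    (\<exists>V g. open V \<and> 0 \<in> V \<and> locally_integrable_on V g \<and>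
       (\<forall>\<phi>\<in>test_functions. supp \<phi> \<subseteq> V \<longrightarrow>
          fourier_dist U \<phi> = (LINT \<xi>:V|lborel. g \<xi> * \<phi> \<xi>)))"

definition sphere_cutoff :: "('a::euclidean_space \<Rightarrow> real) \<Rightarrow> bool"
  where "sphere_cutoff \<Lambda> \<longleftrightarrow>
    smooth \<Lambda> \<and> (\<forall>x y. norm x = norm y \<longrightarrow> \<Lambda> x = \<Lambda> y) \<and>
    supp \<Lambda> \<subseteq> ball 0 2 \<and> 0 \<notin> supp \<Lambda> \<and> (\<forall>x\<in>sphere 0 1. \<Lambda> x = 1)"

definition sphere_ext :: "('a::euclidean_space \<Rightarrow> real) \<Rightarrow> ('a \<Rightarrow> complex) \<Rightarrow> 'a \<Rightarrow> complex"
  where "sphere_ext \<Lambda> \<tau> \<xi> = (if \<xi> = 0 then 0 else \<tau> (\<xi> /\<^sub>R norm \<xi>) * of_real (\<Lambda> \<xi>))"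

text \<open>A function on the sphere is represented by its extension by zero to the whole space, so that
  distinct functions have distinct representatives.\<close>

definition sphere_restrict :: "('a::euclidean_space \<Rightarrow> complex) \<Rightarrow> 'a \<Rightarrow> complex"
  where "sphere_restrict \<phi> x = (if x \<in> sphere 0 1 then \<phi> x else 0)"

definition sphere_test_functions ::
    "('a::euclidean_space \<Rightarrow> real) \<Rightarrow> ('a \<Rightarrow> complex) set"
  where "sphere_test_functions \<Lambda> =
    {\<tau>. (\<forall>x. x \<notin> sphere 0 1 \<longrightarrow> \<tau> x = 0) \<and> sphere_ext \<Lambda> \<tau> \<in> test_functions}"

definition sphere_seminorm ::
    "('a::euclidean_space \<Rightarrow> real) \<Rightarrow> nat \<Rightarrow> ('a \<Rightarrow> complex) \<Rightarrow> real"
  where "sphere_seminorm \<Lambda> m \<tau> =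
    (SUP (bs, \<xi>)\<in>words m \<times> ball 0 2. norm (pderivs bs (sphere_ext \<Lambda> \<tau>) \<xi>))"

definition sphere_distributions ::
    "('a::euclidean_space \<Rightarrow> real) \<Rightarrow> (('a \<Rightarrow> complex) \<Rightarrow> complex) set"
  where "sphere_distributions \<Lambda> =
    continuous_dual (seminorm_topology (sphere_test_functions \<Lambda>) (sphere_seminorm \<Lambda>))"

definition single_layer ::
    "('a::euclidean_space \<Rightarrow> real) \<Rightarrow> (('a \<Rightarrow> complex) \<Rightarrow> complex) set"
  where "single_layer \<Lambda> = {T \<in> distributions.
    \<exists>S\<in>sphere_distributions \<Lambda>. \<forall>\<phi>\<in>test_functions. T \<phi> = S (sphere_restrict \<phi>)}"

definition E_log_hat :: "('a::euclidean_space \<Rightarrow> complex) \<Rightarrow> complex"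
  where "E_log_hat \<phi> =
    1/2 * (LINT \<xi>:{\<xi>. \<bar>norm \<xi> - 1\<bar> < 1}|lborel. (\<phi> \<xi> - \<phi> (\<xi> /\<^sub>R norm \<xi>)) / of_real (ln (norm \<xi>)))
  + 1/2 * (LINT \<xi>:{\<xi>. norm \<xi> > 2}|lborel. \<phi> \<xi> / of_real (ln (norm \<xi>)))"

lemma pderivs_zero [simp]: "pderivs bs (\<lambda>x. 0) = (\<lambda>x. 0)"
  by (induction bs) (auto simp: pderiv_dir_def)

lemma Nil_in_words [simp]: "[] \<in> words m"
  by (simp add: words_def)

lemma SUP_zero_words:
  assumes "B \<noteq> {}" shows "(SUP x\<in>words m \<times> B. (0::real)) = 0"
proof -
  have "words m \<times> B \<noteq> {}" using assms Nil_in_words by blast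
  then show ?thesis by (rule cSUP_const)
qed

lemma topspace_seminorm_topology:
  assumes "\<And>m. p m (\<lambda>x. 0) = 0"
  shows "topspace (seminorm_topology V p) = V"
proof -
  have "f \<in> topspace (seminorm_topology V p)" if "f \<in> V" for f
  proof -
    have "f \<in> {g \<in> V. p 0 (\<lambda>x. g x - f x) < 1}"
      using that assms[of 0] by simp
    moreover have "{g \<in> V. p 0 (\<lambda>x. g x - f x) < 1}
        \<in> {{g \<in> V. p m (\<lambda>x. g x - f x) < e} |f m e. f \<in> V \<and> 0 < e}"
      using that zero_less_one by blast
    ultimately show ?thesis
      unfolding seminorm_topology_def topology_generated_by_topspace by (rule UnionI[rotated])
  qed
  moreover have "topspace (seminorm_topology V p) \<subseteq> V"
    unfolding seminorm_topology_def topology_generated_by_topspace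
    by (rule Union_least) auto
  ultimately show ?thesis by blast
qed

lemma topspace_schwartz_topology: "topspace schwartz_topology = schwartz"
  unfolding schwartz_topology_def
  by (intro topspace_seminorm_topology) (simp add: schwartz_seminorm_def SUP_zero_words case_prod_beta)

lemma topspace_test_topology_on:
  "topspace (test_topology_on K) = {\<phi> \<in> test_functions. supp \<phi> \<subseteq> K}"
  unfolding test_topology_on_def
  by (intro topspace_seminorm_topology) (simp add: sup_seminorm_def SUP_zero_words)

lemma topspace_lizorkin: "topspace (subtopology schwartz_topology lizorkin) = lizorkin"
  by (auto simp: topspace_schwartz_topology lizorkin_def)

lemma topspace_sphere_topology:
  "topspace (seminorm_topology (sphere_test_functions \<Lambda>) (sphere_seminorm \<Lambda>))
    = sphere_test_functions \<Lambda>"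
proof (rule topspace_seminorm_topology)
  have "sphere_ext \<Lambda> (\<lambda>x. 0) = (\<lambda>x. 0)" by (auto simp: sphere_ext_def)
  then show "sphere_seminorm \<Lambda> m (\<lambda>x. 0) = 0" for m
    by (simp add: sphere_seminorm_def SUP_zero_words)
qed

end

theory Submission
  imports Defs
begin

text \<open>
  On the frequency side the Lizorkin space becomes the space of Schwartz functions that vanish to
  infinite order at the origin (\<open>flat_schwartz\<close>), and the logarithmic Laplacian becomes
  multiplication by \<open>2 ln |\<xi>|\<close> (\<open>log_multiply\<close>, \<open>log_laplacian_fourier\<close>). So \<open>u\<close> is harmonic iff its
  Fourier transform annihilates all products \<open>2 ln |\<xi>| h\<close> with flat \<open>h\<close>.

  The logarithm vanishes to first order exactly on the unit sphere, and its singularity at the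
  origin is harmless for flat functions. Therefore these products are precisely the flat functions
  that vanish on the sphere (\<open>log_division\<close>). The transform of a harmonic \<open>u\<close> thus depends only on
  the restriction of a function to the sphere, which makes it a single layer: the functional on the
  sphere is obtained by extending a function with the cutoff \<open>\<Lambda>\<close> and applying \<open>u\<close>
  (\<open>harmonic_representative\<close>). Multiplication with \<open>\<Lambda>\<close> also extends the transform from flat to all
  Schwartz functions, by zero near the origin, so the normalized representative is explicit.
  Conversely, a single layer annihilates test functions vanishing on the sphere, and by truncation
  also Schwartz functions vanishing there (\<open>single_layer_vanishes\<close>).

  For fundamental solutions, \<open>E_log_hat\<close> sends \<open>2 ln |\<xi>| h\<close> to the integral of \<open>h\<close>
  (\<open>E_log_hat_log_multiply\<close>), which is the value at the origin of the Fourier transform of \<open>h\<close>. So its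
  inverse transform is one fundamental solution, and all others differ from it by harmonic elements.

  The analysis behind this rests on one device. Smoothness and all estimates of derivatives are
  proved by exhibiting a class of families of functions that is closed under partial
  differentiation and whose members satisfy the bound (\<open>pderivs_in_closed_class\<close>,
  \<open>smooth_family_coinduct\<close>). Continuity of the Fourier transform (\<open>fourier_family\<close>), its inversion up to a
  constant (\<open>fourier_fourier\<close>, \<open>fourier_constant_nonzero\<close>), the description of flat functions by decay in
  \<open>|x| + 1/|x|\<close> (\<open>flat_rapid\<close>, \<open>flat_schwartzI_rapid\<close>) and the division theorem are obtained in this way
  or from it.
\<close>

section \<open>Classes of smooth families closed under differentiation\<close>

text \<open>The total derivative is written through its coordinates, so that differentiating a family of
  functions gives one family for each direction. Working with families makes one argument serve
  twice: for a constant family it gives smoothness and decay of a single function, and for the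
  family of all Schwartz functions, each indexed by itself, a bound that depends on the index
  through its seminorms is the continuity of an operator.\<close>

definition gradient_on ::
    "'i set \<Rightarrow> 'a::euclidean_space set \<Rightarrow> ('i \<Rightarrow> 'a \<Rightarrow> 'b::real_normed_vector) \<Rightarrow>
     ('a \<Rightarrow> 'i \<Rightarrow> 'a \<Rightarrow> 'b) \<Rightarrow> bool"
  where "gradient_on I S F F' \<longleftrightarrow>
    (\<forall>i\<in>I. \<forall>x\<in>S. (F i has_derivative (\<lambda>v. \<Sum>b\<in>Basis. (v \<bullet> b) *\<^sub>R F' b i x)) (at x))"

lemma gradient_onI:
  assumes "\<And>i x. i \<in> I \<Longrightarrow> x \<in> S \<Longrightarrow>
    (F i has_derivative (\<lambda>v. \<Sum>b\<in>Basis. (v \<bullet> b) *\<^sub>R F' b i x)) (at x)"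
  shows "gradient_on I S F F'"
  using assms by (auto simp: gradient_on_def)

lemma gradient_onD:
  assumes "gradient_on I S F F'" "i \<in> I" "x \<in> S"
  shows "(F i has_derivative (\<lambda>v. \<Sum>b\<in>Basis. (v \<bullet> b) *\<^sub>R F' b i x)) (at x)"
  using assms by (auto simp: gradient_on_def)

lemma has_derivative_pderiv_dir:
  fixes f :: "'a::euclidean_space \<Rightarrow> 'b::real_normed_vector"
  assumes "f differentiable (at x)"
  shows "(f has_derivative (\<lambda>v. \<Sum>b\<in>Basis. (v \<bullet> b) *\<^sub>R pderiv_dir b f x)) (at x)"
proof -
  let ?D = "frechet_derivative f (at x)"
  have d: "(f has_derivative ?D) (at x)"
    using assms frechet_derivative_works by blast
  then interpret bounded_linear ?D by (rule has_derivative_bounded_linear)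
  have "?D v = (\<Sum>b\<in>Basis. (v \<bullet> b) *\<^sub>R ?D b)" for v
  proof -
    have "?D v = ?D (\<Sum>b\<in>Basis. (v \<bullet> b) *\<^sub>R b)" by (simp add: euclidean_representation)
    also have "\<dots> = (\<Sum>b\<in>Basis. (v \<bullet> b) *\<^sub>R ?D b)" by (simp add: sum scaleR)
    finally show ?thesis .
  qed
  then have "?D = (\<lambda>v. \<Sum>b\<in>Basis. (v \<bullet> b) *\<^sub>R pderiv_dir b f x)"
    unfolding pderiv_dir_def by (rule ext)
  with d show ?thesis by metis
qed

lemma sum_inner_Basis_scaleR:
  fixes f :: "'a::euclidean_space \<Rightarrow> 'b::real_vector"
  assumes b: "b \<in> Basis"
  shows "(\<Sum>c\<in>Basis. (b \<bullet> c) *\<^sub>R f c) = f b"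
proof -
  have "(\<Sum>c\<in>Basis. (b \<bullet> c) *\<^sub>R f c) = (\<Sum>c\<in>Basis. if c = b then f b else 0)"
    using b by (intro sum.cong) (auto simp: inner_Basis)
  also have "\<dots> = f b" using b by simp
  finally show ?thesis .
qed

lemma pderiv_dir_eqI:
  assumes "(f has_derivative (\<lambda>v. \<Sum>b\<in>Basis. (v \<bullet> b) *\<^sub>R f' b)) (at x)" "b \<in> Basis"
  shows "pderiv_dir b f x = f' b"
  unfolding pderiv_dir_def frechet_derivative_at[OF assms(1), symmetric]
  using assms(2) by (rule sum_inner_Basis_scaleR)

lemma pderivs_append: "pderivs (bs @ cs) f = pderivs bs (pderivs cs f)"
  by (induction bs) auto

text \<open>A coinduction principle: if every member of a class has its partial derivatives in the class,
  then all iterated derivatives stay in it, and whatever holds for the members holds for them.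
  No iterated derivative is ever computed.\<close>

lemma pderivs_in_closed_class:
  assumes S: "open S"
    and step: "\<And>F. F \<in> \<C> \<Longrightarrow> \<exists>F'. (\<forall>b\<in>Basis. F' b \<in> \<C>) \<and> gradient_on I S F F'"
    and F: "F \<in> \<C>" and bs: "bs \<in> lists Basis"
  obtains G where "G \<in> \<C>" "\<And>i x. i \<in> I \<Longrightarrow> x \<in> S \<Longrightarrow> pderivs bs (F i) x = G i x"
    "\<And>i x. i \<in> I \<Longrightarrow> x \<in> S \<Longrightarrow> pderivs bs (F i) differentiable (at x)"
proof -
  have diff: "pderivs bs (F i) differentiable (at x)"
    if G: "G \<in> \<C>" "\<And>i x. i \<in> I \<Longrightarrow> x \<in> S \<Longrightarrow> pderivs bs (F i) x = G i x"
      and ix: "i \<in> I" "x \<in> S" for G bs i x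
  proof -
    obtain G' where "gradient_on I S G G'" using step[OF G(1)] by blast
    from has_derivative_transform_within_open[OF gradient_onD[OF this ix] S ix(2)] G(2) ix(1)
    show ?thesis unfolding differentiable_def by metis
  qed
  have "\<exists>G\<in>\<C>. \<forall>i\<in>I. \<forall>x\<in>S. pderivs bs (F i) x = G i x"
    using bs
  proof (induction bs)
    case Nil
    then show ?case using F by auto
  next
    case (Cons b bs)
    then obtain G where G: "G \<in> \<C>" "\<And>i x. i \<in> I \<Longrightarrow> x \<in> S \<Longrightarrow> pderivs bs (F i) x = G i x"
      by auto
    obtain G' where G': "\<And>b. b \<in> Basis \<Longrightarrow> G' b \<in> \<C>" "gradient_on I S G G'"
      using step[OF G(1)] by blast
    have "pderivs (b # bs) (F i) x = G' b i x" if ix: "i \<in> I" "x \<in> S" for i x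
    proof -
      have "(pderivs bs (F i) has_derivative (\<lambda>v. \<Sum>b\<in>Basis. (v \<bullet> b) *\<^sub>R G' b i x)) (at x)"
        by (rule has_derivative_transform_within_open[OF gradient_onD[OF G'(2) ix] S])
          (use G ix in auto)
      then show ?thesis using pderiv_dir_eqI Cons.hyps by fastforce
    qed
    then show ?case using G'(1) Cons.hyps by auto
  qed
  then obtain G where "G \<in> \<C>" "\<And>i x. i \<in> I \<Longrightarrow> x \<in> S \<Longrightarrow> pderivs bs (F i) x = G i x" by blast
  with diff that show ?thesis by blast
qed

text \<open>The set \<open>B\<close> is a bound that is to hold for all iterated derivatives: growth, decay, or none.\<close>

definition smooth_family ::
    "'i set \<Rightarrow> 'a::euclidean_space set \<Rightarrow> ('i \<Rightarrow> 'a \<Rightarrow> complex) set \<Rightarrow> ('i \<Rightarrow> 'a \<Rightarrow> complex) set"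
  where "smooth_family I S B = {F. \<forall>bs\<in>lists Basis.
    (\<forall>i\<in>I. \<forall>x\<in>S. pderivs bs (F i) differentiable (at x)) \<and> (\<lambda>i. pderivs bs (F i)) \<in> B}"

text \<open>The derivatives of a family are controlled on \<open>S\<close> only; a bound must not see other points.\<close>

definition cong_closed ::
    "'i set \<Rightarrow> 'a set \<Rightarrow> ('i \<Rightarrow> 'a \<Rightarrow> complex) set \<Rightarrow> bool"
  where "cong_closed I S B \<longleftrightarrow> (\<forall>F\<in>B. \<forall>G. (\<forall>i\<in>I. \<forall>x\<in>S. G i x = F i x) \<longrightarrow> G \<in> B)"

lemma cong_closedD:
  assumes "cong_closed I S B" "F \<in> B" "\<And>i x. i \<in> I \<Longrightarrow> x \<in> S \<Longrightarrow> G i x = F i x"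
  shows "G \<in> B"
  using assms unfolding cong_closed_def by blast

definition add_closed :: "('i \<Rightarrow> 'a \<Rightarrow> complex) set \<Rightarrow> bool"
  where "add_closed B \<longleftrightarrow> (\<forall>F\<in>B. \<forall>G\<in>B. (\<lambda>i x. F i x + G i x) \<in> B)"

definition mult_into ::
    "('i \<Rightarrow> 'a \<Rightarrow> complex) set \<Rightarrow> ('i \<Rightarrow> 'a \<Rightarrow> complex) set \<Rightarrow> ('i \<Rightarrow> 'a \<Rightarrow> complex) set \<Rightarrow> bool"
  where "mult_into A B C \<longleftrightarrow> (\<forall>F\<in>A. \<forall>G\<in>B. (\<lambda>i x. F i x * G i x) \<in> C)"

lemma smooth_family_coinduct:
  fixes F :: "'i \<Rightarrow> 'a::euclidean_space \<Rightarrow> complex"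
  assumes S: "open S" and B: "cong_closed I S B" and sub: "\<And>F. F \<in> \<C> \<Longrightarrow> F \<in> B"
    and step: "\<And>F. F \<in> \<C> \<Longrightarrow> \<exists>F'. (\<forall>b\<in>Basis. F' b \<in> \<C>) \<and> gradient_on I S F F'"
    and F: "F \<in> \<C>"
  shows "F \<in> smooth_family I S B"
  unfolding smooth_family_def
proof (intro CollectI ballI conjI)
  fix bs :: "'a list" assume bs: "bs \<in> lists Basis"
  obtain G where G: "G \<in> \<C>" "\<And>i x. i \<in> I \<Longrightarrow> x \<in> S \<Longrightarrow> pderivs bs (F i) x = G i x"
    "\<And>i x. i \<in> I \<Longrightarrow> x \<in> S \<Longrightarrow> pderivs bs (F i) differentiable (at x)"
    using pderivs_in_closed_class[of S \<C> I, OF S step F bs] by metis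
  show "(\<lambda>i. pderivs bs (F i)) \<in> B"
    by (rule cong_closedD[OF B sub[OF G(1)]]) (rule G(2))
  show "pderivs bs (F i) differentiable (at x)" if "i \<in> I" "x \<in> S" for i x
    using G(3) that .
qed

lemma smooth_familyD:
  assumes "F \<in> smooth_family I S B" "bs \<in> lists Basis"
  shows "(\<lambda>i. pderivs bs (F i)) \<in> B"
    and "i \<in> I \<Longrightarrow> x \<in> S \<Longrightarrow> pderivs bs (F i) differentiable (at x)"
  using assms by (auto simp: smooth_family_def)

lemma smooth_family_base: "F \<in> smooth_family I S B \<Longrightarrow> F \<in> B"
  using smooth_familyD(1)[of F I S B "[]"] by simp

lemma smooth_family_pderiv_dir:
  fixes F :: "'i \<Rightarrow> 'a::euclidean_space \<Rightarrow> complex"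
  assumes "F \<in> smooth_family I S B" "b \<in> Basis"
  shows "(\<lambda>i. pderiv_dir b (F i)) \<in> smooth_family I S B"
  unfolding smooth_family_def
proof (intro CollectI ballI conjI)
  fix bs :: "'a list" assume "bs \<in> lists Basis"
  then have *: "bs @ [b] \<in> lists Basis" using assms(2) by auto
  show "(\<lambda>i. pderivs bs (pderiv_dir b (F i))) \<in> B"
    using smooth_familyD(1)[OF assms(1) *] by (simp add: pderivs_append)
  fix i x assume "i \<in> I" "x \<in> S"
  then show "pderivs bs (pderiv_dir b (F i)) differentiable (at x)"
    using smooth_familyD(2)[OF assms(1) *] by (simp add: pderivs_append)
qed

lemma smooth_family_gradient:
  assumes "F \<in> smooth_family I S B"
  shows "gradient_on I S F (\<lambda>b i. pderiv_dir b (F i))"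
  using smooth_familyD(2)[OF assms, of "[]"]
  by (auto intro!: gradient_onI has_derivative_pderiv_dir)

lemma smooth_family_mono:
  assumes "F \<in> smooth_family I S B" "J \<subseteq> I" "T \<subseteq> S" "B \<subseteq> B'"
  shows "F \<in> smooth_family J T B'"
  using assms unfolding smooth_family_def by blast

lemma gradient_on_add:
  assumes "gradient_on I S F F'" "gradient_on I S G G'"
  shows "gradient_on I S (\<lambda>i x. F i x + G i x) (\<lambda>b i x. F' b i x + G' b i x)"
proof (rule gradient_onI)
  fix i x assume "i \<in> I" "x \<in> S"
  from has_derivative_add[OF gradient_onD[OF assms(1) this] gradient_onD[OF assms(2) this]]
  show "((\<lambda>x. F i x + G i x) has_derivative
      (\<lambda>v. \<Sum>b\<in>Basis. (v \<bullet> b) *\<^sub>R (F' b i x + G' b i x))) (at x)"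
    by (simp add: scaleR_add_right sum.distrib)
qed

lemma gradient_on_mult:
  fixes F :: "'i \<Rightarrow> 'a::euclidean_space \<Rightarrow> complex"
  assumes "gradient_on I S F F'" "gradient_on I S G G'"
  shows "gradient_on I S (\<lambda>i x. F i x * G i x) (\<lambda>b i x. F' b i x * G i x + F i x * G' b i x)"
proof (rule gradient_onI)
  fix i x assume "i \<in> I" "x \<in> S"
  from has_derivative_mult[OF gradient_onD[OF assms(1) this] gradient_onD[OF assms(2) this]]
  show "((\<lambda>x. F i x * G i x) has_derivative
      (\<lambda>v. \<Sum>b\<in>Basis. (v \<bullet> b) *\<^sub>R (F' b i x * G i x + F i x * G' b i x))) (at x)"
    by (simp add: scaleR_add_right sum.distrib sum_distrib_left sum_distrib_right add.commute)
qed

lemma gradient_on_cong: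
  assumes "open S" "gradient_on I S F F'"
    "\<And>i x. i \<in> I \<Longrightarrow> x \<in> S \<Longrightarrow> G i x = F i x"
  shows "gradient_on I S G F'"
proof (rule gradient_onI)
  fix i x assume ix: "i \<in> I" "x \<in> S"
  show "(G i has_derivative (\<lambda>v. \<Sum>b\<in>Basis. (v \<bullet> b) *\<^sub>R F' b i x)) (at x)"
    by (rule has_derivative_transform_within_open[OF gradient_onD[OF assms(2) ix] assms(1)])
      (use assms(3) ix in auto)
qed

lemma smooth_family_cong:
  fixes F :: "'i \<Rightarrow> 'a::euclidean_space \<Rightarrow> complex"
  assumes "open S" "cong_closed I S B" "F \<in> smooth_family I S B"
    "\<And>i x. i \<in> I \<Longrightarrow> x \<in> S \<Longrightarrow> G i x = F i x"
  shows "G \<in> smooth_family I S B"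
proof (rule smooth_family_coinduct[of S I B
      "{G. \<exists>F\<in>smooth_family I S B. \<forall>i\<in>I. \<forall>x\<in>S. G i x = F i x}"])
  show "G \<in> {G. \<exists>F\<in>smooth_family I S B. \<forall>i\<in>I. \<forall>x\<in>S. G i x = F i x}"
    using assms by auto
  fix G assume "G \<in> {G. \<exists>F\<in>smooth_family I S B. \<forall>i\<in>I. \<forall>x\<in>S. G i x = F i x}"
  then obtain F where F: "F \<in> smooth_family I S B" "\<And>i x. i \<in> I \<Longrightarrow> x \<in> S \<Longrightarrow> G i x = F i x"
    by auto
  show "G \<in> B" by (rule cong_closedD[OF assms(2) smooth_family_base[OF F(1)] F(2)])
  show "\<exists>F'. (\<forall>b\<in>Basis. F' b \<in> {G. \<exists>F\<in>smooth_family I S B. \<forall>i\<in>I. \<forall>x\<in>S. G i x = F i x})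
      \<and> gradient_on I S G F'"
  proof (intro exI[of _ "\<lambda>b i. pderiv_dir b (F i)"] conjI ballI)
    show "gradient_on I S G (\<lambda>b i. pderiv_dir b (F i))"
      by (rule gradient_on_cong[OF assms(1) smooth_family_gradient[OF F(1)] F(2)])
    fix b :: 'a assume "b \<in> Basis"
    from smooth_family_pderiv_dir[OF F(1) this]
    show "(\<lambda>i. pderiv_dir b (F i)) \<in> {G. \<exists>F\<in>smooth_family I S B. \<forall>i\<in>I. \<forall>x\<in>S. G i x = F i x}"
      by auto
  qed
qed (use assms in auto)

lemma smooth_family_add:
  fixes F :: "'i \<Rightarrow> 'a::euclidean_space \<Rightarrow> complex"
  assumes "open S" "cong_closed I S B" "add_closed B"
    "F \<in> smooth_family I S B" "G \<in> smooth_family I S B"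
  shows "(\<lambda>i x. F i x + G i x) \<in> smooth_family I S B"
proof (rule smooth_family_coinduct[of S I B
      "{(\<lambda>i x. F i x + G i x) |F G. F \<in> smooth_family I S B \<and> G \<in> smooth_family I S B}"])
  fix H assume "H \<in> {(\<lambda>i x. F i x + G i x) |F G. F \<in> smooth_family I S B \<and> G \<in> smooth_family I S B}"
  then obtain F G where H: "H = (\<lambda>i x. F i x + G i x)"
    "F \<in> smooth_family I S B" "G \<in> smooth_family I S B" by auto
  then show "H \<in> B" using assms(3) smooth_family_base unfolding add_closed_def by blast
  show "\<exists>F'. (\<forall>b\<in>Basis. F' b \<in> {(\<lambda>i x. F i x + G i x) |F G. F \<in> smooth_family I S B \<and> G \<in> smooth_family I S B}) \<and> gradient_on I S H F'"
  proof (intro exI[of _ "\<lambda>b i x. pderiv_dir b (F i) x + pderiv_dir b (G i) x"] conjI ballI)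
    show "gradient_on I S H (\<lambda>b i x. pderiv_dir b (F i) x + pderiv_dir b (G i) x)"
      unfolding H(1) by (intro gradient_on_add smooth_family_gradient[of _ I S B] H(2,3))
    fix b :: 'a assume b: "b \<in> Basis"
    show "(\<lambda>i x. pderiv_dir b (F i) x + pderiv_dir b (G i) x)
        \<in> {(\<lambda>i x. F i x + G i x) |F G. F \<in> smooth_family I S B \<and> G \<in> smooth_family I S B}"
      using smooth_family_pderiv_dir[OF H(2) b] smooth_family_pderiv_dir[OF H(3) b]
      by (intro CollectI exI[of _ "\<lambda>i. pderiv_dir b (F i)"] exI[of _ "\<lambda>i. pderiv_dir b (G i)"]) simp
  qed
qed (use assms in auto)

text \<open>By the Leibniz rule the finite sums of products are a class closed under differentiation.\<close>

inductive_set product_sums ::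
    "('i \<Rightarrow> 'a \<Rightarrow> complex) set \<Rightarrow> ('i \<Rightarrow> 'a \<Rightarrow> complex) set \<Rightarrow> ('i \<Rightarrow> 'a \<Rightarrow> complex) set"
  for A B where
    product: "F \<in> A \<Longrightarrow> G \<in> B \<Longrightarrow> (\<lambda>i x. F i x * G i x) \<in> product_sums A B"
  | sum: "F \<in> product_sums A B \<Longrightarrow> G \<in> product_sums A B \<Longrightarrow>
      (\<lambda>i x. F i x + G i x) \<in> product_sums A B"

lemma smooth_family_mult:
  assumes S: "open S" and C: "cong_closed I S C" "add_closed C" "mult_into A B C"
    and F: "F \<in> smooth_family I S A" and G: "G \<in> smooth_family I S B"
  shows "(\<lambda>i x. F i x * G i x) \<in> smooth_family I S C"
proof (rule smooth_family_coinduct[of S I C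
      "product_sums (smooth_family I S A) (smooth_family I S B)", OF S C(1)])
  let ?P = "product_sums (smooth_family I S A) (smooth_family I S B)"
  show "(\<lambda>i x. F i x * G i x) \<in> ?P" using F G by (rule product)
  fix H assume H: "H \<in> ?P"
  then show "H \<in> C"
    by induction (use C(2,3) smooth_family_base in \<open>unfold add_closed_def mult_into_def, blast+\<close>)
  from H show "\<exists>F'. (\<forall>b\<in>Basis. F' b \<in> ?P) \<and> gradient_on I S H F'"
  proof induction
    case (product F G)
    then show ?case
      using gradient_on_mult[OF smooth_family_gradient[OF product(1)] smooth_family_gradient[OF product(2)]]
        smooth_family_pderiv_dir[OF product(1)] smooth_family_pderiv_dir[OF product(2)]
      by (intro exI[of _ "\<lambda>b i x. pderiv_dir b (F i) x * G i x + F i x * pderiv_dir b (G i) x"] conjI ballI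
          product_sums.sum product_sums.product) auto
  next
    case (sum F G)
    then obtain F' G' where "\<forall>b\<in>Basis. F' b \<in> ?P" "gradient_on I S F F'"
      "\<forall>b\<in>Basis. G' b \<in> ?P" "gradient_on I S G G'" by blast
    then show ?case
      by (intro exI[of _ "\<lambda>b i x. F' b i x + G' b i x"] conjI ballI gradient_on_add
          product_sums.sum) auto
  qed
qed

text \<open>By the Leibniz rule an algebra of families is closed under differentiation as soon as it
  contains the derivatives of its generators.\<close>

inductive_set generated_algebra :: "('i \<Rightarrow> 'a \<Rightarrow> complex) set \<Rightarrow> ('i \<Rightarrow> 'a \<Rightarrow> complex) set"
  for \<G> where
    generator: "F \<in> \<G> \<Longrightarrow> F \<in> generated_algebra \<G>"
  | sum: "F \<in> generated_algebra \<G> \<Longrightarrow> G \<in> generated_algebra \<G> \<Longrightarrow>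
      (\<lambda>i x. F i x + G i x) \<in> generated_algebra \<G>"
  | product: "F \<in> generated_algebra \<G> \<Longrightarrow> G \<in> generated_algebra \<G> \<Longrightarrow>
      (\<lambda>i x. F i x * G i x) \<in> generated_algebra \<G>"

lemma generated_algebra_gradient:
  assumes "\<And>F. F \<in> \<G> \<Longrightarrow> \<exists>F'. (\<forall>b\<in>Basis. F' b \<in> generated_algebra \<G>) \<and> gradient_on I S F F'"
    and "F \<in> generated_algebra \<G>"
  shows "\<exists>F'. (\<forall>b\<in>Basis. F' b \<in> generated_algebra \<G>) \<and> gradient_on I S F F'"
  using assms(2)
proof induction
  case (generator F)
  then show ?case by (rule assms(1))
next
  case (sum F G)
  then obtain F' G' where "\<forall>b\<in>Basis. F' b \<in> generated_algebra \<G>" "gradient_on I S F F'"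
      "\<forall>b\<in>Basis. G' b \<in> generated_algebra \<G>" "gradient_on I S G G'" by blast
  then show ?case
    by (intro exI[of _ "\<lambda>b i x. F' b i x + G' b i x"] conjI ballI gradient_on_add
        generated_algebra.sum) auto
next
  case (product F G)
  then obtain F' G' where "\<forall>b\<in>Basis. F' b \<in> generated_algebra \<G>" "gradient_on I S F F'"
      "\<forall>b\<in>Basis. G' b \<in> generated_algebra \<G>" "gradient_on I S G G'" by blast
  with product show ?case
    by (intro exI[of _ "\<lambda>b i x. F' b i x * G i x + F i x * G' b i x"] conjI ballI gradient_on_mult
        generated_algebra.sum generated_algebra.product) auto
qed

lemma generated_algebra_smooth_family:
  assumes S: "open S" and B: "cong_closed I S B" "add_closed B" "mult_into B B B" and sub: "\<G> \<subseteq> B"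
    and step: "\<And>F. F \<in> \<G> \<Longrightarrow>
      \<exists>F'. (\<forall>b\<in>Basis. F' b \<in> generated_algebra \<G>) \<and> gradient_on I S F F'"
    and F: "F \<in> generated_algebra \<G>"
  shows "F \<in> smooth_family I S B"
proof (rule smooth_family_coinduct[of S I B "generated_algebra \<G>", OF S B(1) _ _ F])
  fix F assume F: "F \<in> generated_algebra \<G>"
  then show "F \<in> B"
    by induction (use sub B(2,3) in \<open>unfold add_closed_def mult_into_def, blast+\<close>)
  show "\<exists>F'. (\<forall>b\<in>Basis. F' b \<in> generated_algebra \<G>) \<and> gradient_on I S F F'"
    using step F by (rule generated_algebra_gradient)
qed

section \<open>Growth and decay\<close>

definition moderate :: "'i set \<Rightarrow> 'a set \<Rightarrow> ('a \<Rightarrow> real) \<Rightarrow> ('i \<Rightarrow> 'a \<Rightarrow> complex) set"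
  where "moderate I S w = {F. \<exists>k C. \<forall>i\<in>I. \<forall>x\<in>S. norm (F i x) \<le> C * w x ^ k}"

text \<open>The functions \<open>q k\<close> measure the size of the index. They are constant 1 for a single function;
  for Schwartz functions indexed by themselves they are the Schwartz seminorms, and the bound
  is then an estimate between seminorms.\<close>

definition rapid ::
    "'i set \<Rightarrow> 'a set \<Rightarrow> ('a \<Rightarrow> real) \<Rightarrow> (nat \<Rightarrow> 'i \<Rightarrow> real) \<Rightarrow> ('i \<Rightarrow> 'a \<Rightarrow> complex) set"
  where "rapid I S w q =
    {F. \<forall>N. \<exists>k C. \<forall>i\<in>I. \<forall>x\<in>S. w x ^ N * norm (F i x) \<le> C * q k i}"

definition weight_on :: "'a set \<Rightarrow> ('a \<Rightarrow> real) \<Rightarrow> bool"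
  where "weight_on S w \<longleftrightarrow> (\<forall>x\<in>S. 1 \<le> w x)"

definition graded_on :: "'i set \<Rightarrow> (nat \<Rightarrow> 'i \<Rightarrow> real) \<Rightarrow> bool"
  where "graded_on I q \<longleftrightarrow> (\<forall>i\<in>I. \<forall>k. 0 \<le> q k i \<and> q k i \<le> q (Suc k) i)"

lemma graded_onD:
  assumes "graded_on I q" "i \<in> I"
  shows "0 \<le> q k i" and "k \<le> l \<Longrightarrow> q k i \<le> q l i"
proof -
  show "0 \<le> q k i" using assms by (auto simp: graded_on_def)
  show "k \<le> l \<Longrightarrow> q k i \<le> q l i"
    by (rule lift_Suc_mono_le[of "\<lambda>k. q k i"]) (use assms in \<open>auto simp: graded_on_def\<close>)
qed

lemma graded_on_const_one [simp]: "graded_on I (\<lambda>_ _. 1)"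
  by (auto simp: graded_on_def)

lemma moderateE:
  assumes "F \<in> moderate I S w" "weight_on S w"
  obtains k C where "C \<ge> 0" "\<And>i x. i \<in> I \<Longrightarrow> x \<in> S \<Longrightarrow> norm (F i x) \<le> C * w x ^ k"
proof -
  obtain k C where kC: "\<And>i x. i \<in> I \<Longrightarrow> x \<in> S \<Longrightarrow> norm (F i x) \<le> C * w x ^ k"
    using assms by (auto simp: moderate_def)
  have "norm (F i x) \<le> max C 0 * w x ^ k" if "i \<in> I" "x \<in> S" for i x
  proof -
    have "0 \<le> w x ^ k" using assms(2) that by (force simp: weight_on_def)
    then have "C * w x ^ k \<le> max C 0 * w x ^ k" by (intro mult_right_mono) auto
    with kC[OF that] show ?thesis by linarith
  qed
  then show ?thesis using that[of "max C 0" k] by auto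
qed

lemma rapidE:
  assumes "F \<in> rapid I S w q" "graded_on I q"
  obtains k C where "C \<ge> 0" "\<And>i x. i \<in> I \<Longrightarrow> x \<in> S \<Longrightarrow> w x ^ N * norm (F i x) \<le> C * q k i"
proof -
  obtain k C where kC: "\<And>i x. i \<in> I \<Longrightarrow> x \<in> S \<Longrightarrow> w x ^ N * norm (F i x) \<le> C * q k i"
    using assms by (auto simp: rapid_def) (metis)
  have "w x ^ N * norm (F i x) \<le> max C 0 * q k i" if "i \<in> I" "x \<in> S" for i x
  proof -
    have "C * q k i \<le> max C 0 * q k i"
      using graded_onD(1)[OF assms(2) that(1)] by (intro mult_right_mono) auto
    with kC[OF that] show ?thesis by linarith
  qed
  then show ?thesis using that[of "max C 0" k] by auto
qed

lemma moderateI: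
  assumes "\<And>i x. i \<in> I \<Longrightarrow> x \<in> S \<Longrightarrow> norm (F i x) \<le> C * w x ^ k"
  shows "F \<in> moderate I S w"
  using assms unfolding moderate_def by blast

lemma rapidI:
  assumes "\<And>N. \<exists>k C. \<forall>i\<in>I. \<forall>x\<in>S. w x ^ N * norm (F i x) \<le> C * q k i"
  shows "F \<in> rapid I S w q"
  using assms unfolding rapid_def by blast

lemma cong_closed_moderate: "cong_closed I S (moderate I S w)"
  unfolding cong_closed_def moderate_def by simp

lemma cong_closed_rapid: "cong_closed I S (rapid I S w q)"
  unfolding cong_closed_def rapid_def by simp

lemma mult_into_moderate:
  assumes w: "weight_on S w"
  shows "mult_into (moderate I S w) (moderate I S w) (moderate I S w)"
  unfolding mult_into_def
proof (intro ballI)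
  fix F G assume F: "F \<in> moderate I S w" and G: "G \<in> moderate I S w"
  obtain k C where C: "C \<ge> 0" "\<And>i x. i \<in> I \<Longrightarrow> x \<in> S \<Longrightarrow> norm (F i x) \<le> C * w x ^ k"
    using moderateE[OF F w] by metis
  obtain l D where D: "D \<ge> 0" "\<And>i x. i \<in> I \<Longrightarrow> x \<in> S \<Longrightarrow> norm (G i x) \<le> D * w x ^ l"
    using moderateE[OF G w] by metis
  have "norm (F i x * G i x) \<le> (C * D) * w x ^ (k + l)" if "i \<in> I" "x \<in> S" for i x
  proof -
    have "norm (F i x) * norm (G i x) \<le> (C * w x ^ k) * (D * w x ^ l)"
      using C(2)[OF that] D(2)[OF that] by (intro mult_mono) (auto intro: order_trans[OF norm_ge_zero])
    then show ?thesis by (simp add: norm_mult power_add algebra_simps)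
  qed
  then show "(\<lambda>i x. F i x * G i x) \<in> moderate I S w" by (rule moderateI)
qed

lemma add_closed_moderate:
  assumes w: "weight_on S w"
  shows "add_closed (moderate I S w)"
  unfolding add_closed_def
proof (intro ballI)
  fix F G assume F: "F \<in> moderate I S w" and G: "G \<in> moderate I S w"
  obtain k C where C: "C \<ge> 0" "\<And>i x. i \<in> I \<Longrightarrow> x \<in> S \<Longrightarrow> norm (F i x) \<le> C * w x ^ k"
    using moderateE[OF F w] by metis
  obtain l D where D: "D \<ge> 0" "\<And>i x. i \<in> I \<Longrightarrow> x \<in> S \<Longrightarrow> norm (G i x) \<le> D * w x ^ l"
    using moderateE[OF G w] by metis
  have "norm (F i x + G i x) \<le> (C + D) * w x ^ (max k l)" if "i \<in> I" "x \<in> S" for i x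
  proof -
    have "1 \<le> w x" using w that by (auto simp: weight_on_def)
    then have "C * w x ^ k \<le> C * w x ^ max k l" "D * w x ^ l \<le> D * w x ^ max k l"
      using C(1) D(1) by (auto intro!: mult_left_mono power_increasing)
    with C(2)[OF that] D(2)[OF that] norm_triangle_ineq[of "F i x" "G i x"]
    show ?thesis by (simp add: algebra_simps)
  qed
  then show "(\<lambda>i x. F i x + G i x) \<in> moderate I S w" by (rule moderateI)
qed

lemma add_closed_rapid:
  assumes w: "weight_on S w" and q: "graded_on I q"
  shows "add_closed (rapid I S w q)"
  unfolding add_closed_def
proof (intro ballI rapidI)
  fix F G N assume F: "F \<in> rapid I S w q" and G: "G \<in> rapid I S w q"
  obtain k C where C: "C \<ge> 0" "\<And>i x. i \<in> I \<Longrightarrow> x \<in> S \<Longrightarrow> w x ^ N * norm (F i x) \<le> C * q k i"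
    using rapidE[OF F q] by metis
  obtain l D where D: "D \<ge> 0" "\<And>i x. i \<in> I \<Longrightarrow> x \<in> S \<Longrightarrow> w x ^ N * norm (G i x) \<le> D * q l i"
    using rapidE[OF G q] by metis
  have "w x ^ N * norm (F i x + G i x) \<le> (C + D) * q (max k l) i" if "i \<in> I" "x \<in> S" for i x
  proof -
    have "1 \<le> w x" using w that by (auto simp: weight_on_def)
    then have "w x ^ N * norm (F i x + G i x) \<le> w x ^ N * norm (F i x) + w x ^ N * norm (G i x)"
      unfolding distrib_left[symmetric] by (intro mult_left_mono norm_triangle_ineq) auto
    moreover have "C * q k i \<le> C * q (max k l) i" "D * q l i \<le> D * q (max k l) i"
      using C(1) D(1) graded_onD(2)[OF q that(1)] by (auto intro!: mult_left_mono)
    ultimately show ?thesis using C(2)[OF that] D(2)[OF that] by (simp add: algebra_simps)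
  qed
  then show "\<exists>k C. \<forall>i\<in>I. \<forall>x\<in>S. w x ^ N * norm (F i x + G i x) \<le> C * q k i" by blast
qed

lemma mult_into_rapid:
  assumes w: "weight_on S w" and q: "graded_on I q"
  shows "mult_into (moderate I S w) (rapid I S w q) (rapid I S w q)"
  unfolding mult_into_def
proof (intro ballI rapidI)
  fix F G N assume F: "F \<in> moderate I S w" and G: "G \<in> rapid I S w q"
  obtain k C where C: "C \<ge> 0" "\<And>i x. i \<in> I \<Longrightarrow> x \<in> S \<Longrightarrow> norm (F i x) \<le> C * w x ^ k"
    using moderateE[OF F w] by metis
  obtain l D where D: "D \<ge> 0"
    "\<And>i x. i \<in> I \<Longrightarrow> x \<in> S \<Longrightarrow> w x ^ (N + k) * norm (G i x) \<le> D * q l i"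
    using rapidE[OF G q] by metis
  have "w x ^ N * norm (F i x * G i x) \<le> (C * D) * q l i" if "i \<in> I" "x \<in> S" for i x
  proof -
    have "1 \<le> w x" using w that by (auto simp: weight_on_def)
    then have "w x ^ N * norm (F i x * G i x) \<le> w x ^ N * ((C * w x ^ k) * norm (G i x))"
      unfolding norm_mult using C(2)[OF that] by (intro mult_left_mono mult_right_mono) auto
    also have "\<dots> = C * (w x ^ (N + k) * norm (G i x))" by (simp add: power_add)
    also have "\<dots> \<le> C * (D * q l i)" by (intro mult_left_mono D(2) that C(1))
    finally show ?thesis by simp
  qed
  then show "\<exists>k C. \<forall>i\<in>I. \<forall>x\<in>S. w x ^ N * norm (F i x * G i x) \<le> C * q k i" by blast
qed

lemma weight_on_norm [simp]: "weight_on S (\<lambda>x. 1 + norm (x::'a::real_normed_vector))"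
  by (auto simp: weight_on_def)

abbreviation schwartz_family ::
    "'i set \<Rightarrow> (nat \<Rightarrow> 'i \<Rightarrow> real) \<Rightarrow> ('i \<Rightarrow> 'a::euclidean_space \<Rightarrow> complex) set"
  where "schwartz_family I q \<equiv> smooth_family I UNIV (rapid I UNIV (\<lambda>x. 1 + norm x) q)"

abbreviation multiplier_family :: "'i set \<Rightarrow> ('i \<Rightarrow> 'a::euclidean_space \<Rightarrow> complex) set"
  where "multiplier_family I \<equiv> smooth_family I UNIV (moderate I UNIV (\<lambda>x. 1 + norm x))"

lemma schwartz_family_mult:
  assumes "graded_on I q" "M \<in> multiplier_family I" "F \<in> schwartz_family I q"
  shows "(\<lambda>i x. M i x * F i x) \<in> schwartz_family I q"
  by (rule smooth_family_mult[OF _ cong_closed_rapid add_closed_rapid mult_into_rapid])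
    (use assms in auto)

lemma schwartz_family_add:
  assumes "graded_on I q" "F \<in> schwartz_family I q" "G \<in> schwartz_family I q"
  shows "(\<lambda>i x. F i x + G i x) \<in> schwartz_family I q"
  by (rule smooth_family_add[OF _ cong_closed_rapid add_closed_rapid]) (use assms in auto)

text \<open>The second, zero family is there because the class has to contain the derivatives.\<close>

lemma const_smooth_family:
  fixes c :: "'i \<Rightarrow> complex"
  assumes S: "open (S :: 'a::euclidean_space set)" and c: "\<And>i. i \<in> I \<Longrightarrow> norm (c i) \<le> C"
  shows "(\<lambda>i x. c i) \<in> smooth_family I S (moderate I S w)"
proof (rule smooth_family_coinduct[where \<C> = "{\<lambda>i x. c i, \<lambda>i x. 0}", OF S cong_closed_moderate])
  fix F :: "'i \<Rightarrow> 'a \<Rightarrow> complex" assume F: "F \<in> {\<lambda>i x. c i, \<lambda>i (x::'a). 0}"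
  then show "F \<in> moderate I S w"
    using c by (intro moderateI[where C = "max C 0" and k = 0]) (auto simp: le_max_iff_disj)
  show "\<exists>F'. (\<forall>b\<in>Basis. F' b \<in> {\<lambda>i x. c i, \<lambda>i x. 0}) \<and> gradient_on I S F F'"
    using F by (intro exI[of _ "\<lambda>b i x. 0"]) (auto intro!: gradient_onI)
qed auto

lemmas const_multiplier = const_smooth_family[OF open_UNIV]

lemma coordinate_has_derivative:
  fixes c :: "'a::euclidean_space"
  shows "((\<lambda>x. complex_of_real (x \<bullet> c)) has_derivative
    (\<lambda>v. \<Sum>b\<in>Basis. (v \<bullet> b) *\<^sub>R complex_of_real (b \<bullet> c))) (at x)"
proof -
  have "((\<lambda>x. complex_of_real (x \<bullet> c)) has_derivative (\<lambda>v. of_real (v \<bullet> c))) (at x)"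
    by (auto intro!: derivative_eq_intros)
  moreover have "(\<lambda>v. complex_of_real (v \<bullet> c)) = (\<lambda>v. \<Sum>b\<in>Basis. (v \<bullet> b) *\<^sub>R complex_of_real (b \<bullet> c))"
  proof
    fix v
    show "complex_of_real (v \<bullet> c) = (\<Sum>b\<in>Basis. (v \<bullet> b) *\<^sub>R complex_of_real (b \<bullet> c))"
      by (subst euclidean_representation[of v, symmetric], subst inner_sum_left)
        (simp add: scaleR_conv_of_real)
  qed
  ultimately show ?thesis by (rule has_derivative_eq_rhs)
qed

lemma coordinate_multiplier:
  fixes b :: "'a::euclidean_space"
  assumes "b \<in> Basis"
  shows "(\<lambda>i x. of_real (x \<bullet> b)) \<in> multiplier_family (I :: 'i set)"
proof (rule smooth_family_coinduct[where
      \<C> = "insert (\<lambda>i x. of_real (x \<bullet> b)) (range (\<lambda>c i x. of_real c))", OF _ cong_closed_moderate])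
  fix F :: "'i \<Rightarrow> 'a \<Rightarrow> complex" assume F: "F \<in> insert (\<lambda>i x. of_real (x \<bullet> b)) (range (\<lambda>c i x. of_real c))"
  show "F \<in> moderate I UNIV (\<lambda>x. 1 + norm x)"
    using F
  proof
    assume "F = (\<lambda>i x. of_real (x \<bullet> b))"
    then show ?thesis using assms Basis_le_norm[OF assms]
      by (intro moderateI[where C = 1 and k = 1]) (auto intro: add_increasing)
  next
    assume "F \<in> range (\<lambda>c i x. of_real c)"
    then obtain c where "F = (\<lambda>i x. of_real c)" by auto
    then show ?thesis by (intro moderateI[where C = "\<bar>c\<bar>" and k = 0]) auto
  qed
  show "\<exists>F'. (\<forall>c\<in>Basis. F' c \<in> insert (\<lambda>i x. of_real (x \<bullet> b)) (range (\<lambda>c i x. of_real c)))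
      \<and> gradient_on I UNIV F F'"
    using F
  proof
    assume F: "F = (\<lambda>i x. of_real (x \<bullet> b))"
    then show ?thesis
      by (intro exI[of _ "\<lambda>c i x. of_real (c \<bullet> b)"])
        (auto intro!: gradient_onI coordinate_has_derivative)
  next
    assume "F \<in> range (\<lambda>c i x. of_real c)"
    moreover have "(\<lambda>i x. complex_of_real 0) \<in> range (\<lambda>c i x. of_real c)" by (rule rangeI)
    ultimately show ?thesis
      by (intro exI[of _ "\<lambda>b i x. of_real 0"]) (auto intro!: gradient_onI)
  qed
qed auto

lemma schwartz_family_scale:
  assumes "graded_on I q" "F \<in> schwartz_family I q" "\<And>i. i \<in> I \<Longrightarrow> norm (c i) \<le> C"
  shows "(\<lambda>i x. c i * F i x) \<in> schwartz_family I q"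
  by (rule schwartz_family_mult[OF assms(1) const_multiplier assms(2)]) (rule assms(3))

lemma schwartz_iff: "f \<in> schwartz \<longleftrightarrow> (\<lambda>_. f) \<in> schwartz_family {()} (\<lambda>_ _. 1)"
proof -
  have "bounded (range (\<lambda>x. (1 + norm x) ^ k *\<^sub>R pderivs bs f x)) \<longleftrightarrow>
      (\<exists>C. \<forall>x. (1 + norm x) ^ k * norm (pderivs bs f x) \<le> C)" for bs k
    by (auto simp: bounded_iff power_abs abs_of_nonneg)
  then show ?thesis
    unfolding schwartz_def smooth_def smooth_family_def rapid_def
    by (simp add: differentiable_on_def) blast
qed

lemma schwartz_family_member:
  assumes "F \<in> schwartz_family I q" "i \<in> I"
  shows "F i \<in> schwartz"
proof -
  have "\<exists>C. \<forall>x. (1 + norm x) ^ N * norm (pderivs bs (F i) x) \<le> C" if "bs \<in> lists Basis" for bs N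
  proof -
    have "(\<lambda>i. pderivs bs (F i)) \<in> rapid I UNIV (\<lambda>x. 1 + norm x) q"
      using smooth_familyD(1)[OF assms(1) that] .
    then obtain k C where "\<forall>i\<in>I. \<forall>x. (1 + norm x) ^ N * norm (pderivs bs (F i) x) \<le> C * q k i"
      unfolding rapid_def by blast
    then show ?thesis using assms(2) by blast
  qed
  then show ?thesis
    using smooth_familyD(2)[OF assms(1)] assms(2)
    unfolding schwartz_iff smooth_family_def rapid_def by auto
qed

lemma schwartz_seminorm_upper:
  assumes "f \<in> schwartz" "bs \<in> words m"
  shows "(1 + norm x) ^ m * norm (pderivs bs f x) \<le> schwartz_seminorm m f"
proof -
  have fin: "finite (words m :: 'a list set)"
    using finite_lists_length_le[OF finite_Basis, of m] by (simp add: words_def)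
  have "\<exists>C. \<forall>x. (1 + norm x) ^ m * norm (pderivs bs f x) \<le> C" if "bs \<in> words m" for bs
  proof -
    have "bs \<in> lists Basis" using that by (auto simp: words_def)
    then have "(\<lambda>_. pderivs bs f) \<in> rapid {()} UNIV (\<lambda>x. 1 + norm x) (\<lambda>_ _. 1)"
      using assms(1) smooth_familyD(1) unfolding schwartz_iff by blast
    then show ?thesis by (auto simp: rapid_def)
  qed
  then obtain C where C: "\<And>bs x. bs \<in> words m \<Longrightarrow> (1 + norm x) ^ m * norm (pderivs bs f x) \<le> C bs"
    by metis
  have "bdd_above ((\<lambda>(bs, x). (1 + norm x) ^ m * norm (pderivs bs f x)) ` (words m \<times> UNIV))"
  proof (rule bdd_aboveI2[where M = "\<Sum>bs\<in>words m. \<bar>C bs\<bar>"])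
    fix z :: "'a list \<times> 'a" assume "z \<in> words m \<times> UNIV"
    then obtain bs x where z: "z = (bs, x)" "bs \<in> words m" by auto
    have "(1 + norm x) ^ m * norm (pderivs bs f x) \<le> \<bar>C bs\<bar>" using C[OF z(2)] by (smt (verit))
    also have "\<dots> \<le> (\<Sum>bs\<in>words m. \<bar>C bs\<bar>)" using fin z(2) by (intro member_le_sum) auto
    finally show "(case z of (bs, x) \<Rightarrow> (1 + norm x) ^ m * norm (pderivs bs f x)) \<le> (\<Sum>bs\<in>words m. \<bar>C bs\<bar>)"
      using z by simp
  qed
  from cSUP_upper[OF _ this, of "(bs, x)"] assms(2) show ?thesis
    unfolding schwartz_seminorm_def by simp
qed

lemma words_nonempty [simp]: "words m \<noteq> {}"
  using Nil_in_words by blast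

lemma schwartz_seminorm_least:
  assumes "\<And>bs x. bs \<in> words m \<Longrightarrow> (1 + norm x) ^ m * norm (pderivs bs f x) \<le> C"
  shows "schwartz_seminorm m f \<le> C"
  unfolding schwartz_seminorm_def
  by (rule cSUP_least) (use assms Nil_in_words in auto)

text \<open>Only finitely many words enter one seminorm, so the constants for the single words combine.\<close>

lemma schwartz_family_seminorm:
  fixes F :: "'i \<Rightarrow> 'a::euclidean_space \<Rightarrow> complex"
  assumes q: "graded_on I q" and F: "F \<in> schwartz_family I q"
  obtains k C where "C \<ge> 0" "\<And>i. i \<in> I \<Longrightarrow> schwartz_seminorm m (F i) \<le> C * q k i"
proof -
  have fin: "finite (words m :: 'a list set)"
    using finite_lists_length_le[OF finite_Basis, of m] by (simp add: words_def)
  have "\<exists>k C. C \<ge> 0 \<and> (\<forall>i\<in>I. \<forall>x. (1 + norm x) ^ m * norm (pderivs bs (F i) x) \<le> C * q k i)"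
    if "bs \<in> words m" for bs
  proof -
    have "bs \<in> lists Basis" using that by (auto simp: words_def)
    from rapidE[OF smooth_familyD(1)[OF F this] q] show ?thesis by (metis UNIV_I)
  qed
  then obtain k C where kC: "\<And>bs. bs \<in> words m \<Longrightarrow> C bs \<ge> 0"
    "\<And>bs i x. bs \<in> words m \<Longrightarrow> i \<in> I \<Longrightarrow> (1 + norm x) ^ m * norm (pderivs bs (F i) x) \<le> C bs * q (k bs) i"
    by metis
  let ?K = "Max (k ` words m)" and ?C = "\<Sum>bs\<in>words m. C bs"
  have "schwartz_seminorm m (F i) \<le> ?C * q ?K i" if i: "i \<in> I" for i
  proof (rule schwartz_seminorm_least)
    fix bs :: "'a list" and x :: 'a assume bs: "bs \<in> words m"
    have "(1 + norm x) ^ m * norm (pderivs bs (F i) x) \<le> C bs * q (k bs) i" by (rule kC(2)[OF bs i])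
    also have "\<dots> \<le> ?C * q ?K i"
      using fin bs kC(1) graded_onD[OF q i]
      by (intro mult_mono member_le_sum sum_nonneg) auto
    finally show "(1 + norm x) ^ m * norm (pderivs bs (F i) x) \<le> ?C * q ?K i" .
  qed
  with kC(1) show ?thesis by (intro that[of ?C ?K] sum_nonneg) auto
qed

lemma words_Suc: "words m \<subseteq> words (Suc m)"
  by (auto simp: words_def)

lemma graded_schwartz_seminorm: "graded_on schwartz schwartz_seminorm"
  unfolding graded_on_def
proof (intro ballI allI conjI)
  fix f :: "'a \<Rightarrow> complex" and k assume f: "f \<in> schwartz"
  have "0 \<le> (1 + norm (0::'a)) ^ k * norm (pderivs [] f 0)" by simp
  also have "\<dots> \<le> schwartz_seminorm k f" by (rule schwartz_seminorm_upper[OF f]) auto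
  finally show "0 \<le> schwartz_seminorm k f" .
  show "schwartz_seminorm k f \<le> schwartz_seminorm (Suc k) f"
  proof (rule schwartz_seminorm_least)
    fix bs x assume "bs \<in> (words k :: 'a list set)"
    then have bs: "bs \<in> words (Suc k)" using words_Suc by auto
    have "(1 + norm x) ^ k * norm (pderivs bs f x) \<le> (1 + norm x) ^ Suc k * norm (pderivs bs f x)"
      by (intro mult_right_mono power_increasing) auto
    also have "\<dots> \<le> schwartz_seminorm (Suc k) f" by (rule schwartz_seminorm_upper[OF f bs])
    finally show "(1 + norm x) ^ k * norm (pderivs bs f x) \<le> schwartz_seminorm (Suc k) f" .
  qed
qed

text \<open>The universal family: an operator is continuous on the Schwartz space if applying it to this
  family gives a Schwartz family again.\<close>

lemma schwartz_identity_family: "(\<lambda>f. f) \<in> schwartz_family schwartz schwartz_seminorm"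
  unfolding smooth_family_def
proof (intro CollectI ballI conjI rapidI)
  fix bs :: "'a list" assume bs: "bs \<in> lists Basis"
  show "pderivs bs f differentiable at x" if "f \<in> schwartz" for f x
    using that bs by (auto simp: schwartz_def smooth_def differentiable_on_def)
  fix N
  let ?m = "max N (length bs)"
  have "(1 + norm x) ^ N * norm (pderivs bs f x) \<le> 1 * schwartz_seminorm ?m f"
    if f: "f \<in> schwartz" for f x
  proof -
    have "(1 + norm x) ^ N * norm (pderivs bs f x) \<le> (1 + norm x) ^ ?m * norm (pderivs bs f x)"
      by (intro mult_right_mono power_increasing) auto
    also have "\<dots> \<le> schwartz_seminorm ?m f"
      using bs by (intro schwartz_seminorm_upper[OF f]) (auto simp: words_def)
    finally show ?thesis by simp
  qed
  then show "\<exists>k C. \<forall>f\<in>schwartz. \<forall>x\<in>UNIV. (1 + norm x) ^ N * norm (pderivs bs f x) \<le> C * schwartz_seminorm k f"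
    by blast
qed

lemma schwartz_constant_family:
  assumes f: "f \<in> schwartz"
  shows "(\<lambda>_. f) \<in> schwartz_family I (\<lambda>_ _. 1)"
proof -
  from f have *: "(\<lambda>_. f) \<in> schwartz_family {()} (\<lambda>_ _. 1)" by (simp only: schwartz_iff)
  show ?thesis
    using smooth_familyD[OF *] unfolding smooth_family_def rapid_def by auto
qed

lemma schwartz_linear:
  assumes "f \<in> schwartz" "g \<in> schwartz"
  shows "(\<lambda>x. a * f x + b * g x) \<in> schwartz"
proof -
  have "(\<lambda>_ x. a * f x + b * g x) \<in> schwartz_family {()} (\<lambda>_ _. 1)"
    by (intro schwartz_family_add schwartz_family_scale[where C = "norm a"]
        schwartz_family_scale[where C = "norm b"] schwartz_constant_family assms) auto
  then show ?thesis by (simp only: schwartz_iff)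
qed

lemma schwartz_mult:
  assumes "(\<lambda>_. m) \<in> multiplier_family {()}" "f \<in> schwartz"
  shows "(\<lambda>x. m x * f x) \<in> schwartz"
  using schwartz_family_mult[OF _ assms(1), of "\<lambda>_ _. 1" "\<lambda>_. f"] assms(2)
  by (simp add: schwartz_iff[symmetric])

section \<open>Integration of Schwartz functions\<close>

text \<open>On the shell \<open>k \<le> |x| < k + 1\<close> the weight is at most \<open>(k+1)^-(d+2)\<close>, and the shell lies in a ball
  whose volume is a multiple of \<open>(k+1)^d\<close>. What remains is the convergent sum of \<open>(k+1)^-2\<close>.\<close>

lemma integrable_weight_power:
  "integrable lborel (\<lambda>x::'a::euclidean_space. 1 / (1 + norm x) ^ (DIM('a) + 2))"
proof -
  let ?n = "DIM('a) + 2"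
  let ?f = "\<lambda>(k::nat) (x::'a). indicator (ball 0 (real (Suc k))) x * (1 / real (Suc k) ^ ?n)"
  have sq: "summable (\<lambda>k. 1 / real (Suc k) ^ 2)"
    using inverse_power_summable[of 2] summable_Suc_iff[of "\<lambda>k. inverse (real k ^ 2)"]
    by (simp add: inverse_eq_divide)
  have pw: "summable (\<lambda>k. norm (?f k x))" for x
  proof (rule summable_comparison_test'[OF sq, of 0])
    fix k
    have "1 / real (Suc k) ^ ?n \<le> 1 / real (Suc k) ^ 2"
      by (intro divide_left_mono power_increasing) auto
    then show "norm (norm (?f k x)) \<le> 1 / real (Suc k) ^ 2"
      by (auto simp: indicator_def)
  qed
  have "integrable lborel (\<lambda>x. \<Sum>k. ?f k x)"
  proof (rule integrable_suminf)
    show "integrable lborel (?f k)" for k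
      by (intro integrable_mult_left integrable_real_indicator) (use emeasure_bounded_finite[OF bounded_ball] in auto)
    show "AE x in lborel. summable (\<lambda>k. norm (?f k x))" using pw by simp
    have "(\<integral>x. norm (?f k x) \<partial>lborel) = unit_ball_vol (real DIM('a)) * (1 / real (Suc k) ^ 2)" for k
    proof -
      have "(\<integral>x. norm (?f k x) \<partial>lborel) = (\<integral>x. ?f k x \<partial>lborel)"
        by (intro Bochner_Integration.integral_cong) auto
      also have "\<dots> = measure lborel (ball (0::'a) (real (Suc k))) * (1 / real (Suc k) ^ ?n)"
        by simp
      also have "measure lborel (ball (0::'a) (real (Suc k))) = unit_ball_vol (real DIM('a)) * real (Suc k) ^ DIM('a)"
        using content_ball[of "real (Suc k)" "0::'a"] by simp
      finally show ?thesis by (simp add: power_add field_simps power2_eq_square del: of_nat_Suc)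
    qed
    then show "summable (\<lambda>k. \<integral>x. norm (?f k x) \<partial>lborel)"
      using summable_mult[OF sq, of "unit_ball_vol (real DIM('a))"] by simp
  qed
  then show ?thesis
  proof (rule Bochner_Integration.integrable_bound)
    show "AE x in lborel. norm (1 / (1 + norm (x::'a)) ^ ?n) \<le> norm (\<Sum>k. ?f k x)"
    proof (intro always_eventually allI)
      fix x :: 'a
      define k where "k = nat \<lfloor>norm x\<rfloor>"
      have k: "real k \<le> norm x" "norm x < real (Suc k)"
      proof -
        have "real k = of_int \<lfloor>norm x\<rfloor>" by (simp add: k_def)
        then show "real k \<le> norm x" "norm x < real (Suc k)" by linarith+
      qed
      have "1 / (1 + norm x) ^ ?n \<le> 1 / real (Suc k) ^ ?n"
        using k by (intro divide_left_mono power_mono mult_pos_pos zero_less_power) (auto simp: add_pos_nonneg)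
      also have "\<dots> = ?f k x" using k by (simp add: indicator_def)
      also have "\<dots> = (\<Sum>j\<in>{k}. ?f j x)" by simp
      also have "\<dots> \<le> (\<Sum>j. ?f j x)"
        using summable_norm_cancel[OF pw[of x]] by (intro sum_le_suminf) auto
      finally have "1 / (1 + norm x) ^ ?n \<le> (\<Sum>k. ?f k x)" .
      moreover have "0 \<le> 1 / (1 + norm x) ^ ?n" by simp
      ultimately show "norm (1 / (1 + norm x) ^ ?n) \<le> norm (\<Sum>k. ?f k x)"
        unfolding real_norm_def by linarith
    qed
  qed simp
qed

lemma schwartz_differentiable:
  assumes "f \<in> schwartz"
  shows "f differentiable (at x)"
proof -
  have "pderivs [] f differentiable_on UNIV"
    using assms lists.Nil unfolding schwartz_def smooth_def by blast
  then show ?thesis by (simp add: differentiable_on_def)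
qed

lemma schwartz_continuous: "f \<in> schwartz \<Longrightarrow> continuous_on S f"
  by (meson continuous_at_imp_continuous_on differentiable_imp_continuous_within schwartz_differentiable)

lemma schwartz_borel [measurable_dest]: "f \<in> schwartz \<Longrightarrow> f \<in> borel_measurable borel"
  using schwartz_continuous borel_measurable_continuous_onI by blast

lemma integrable_rapid_bound:
  fixes f :: "'a::euclidean_space \<Rightarrow> complex"
  assumes "f \<in> borel_measurable borel" "\<And>x. (1 + norm x) ^ (DIM('a) + 2) * norm (f x) \<le> C"
  shows "integrable lborel f"
    and "(\<integral>x. norm (f x) \<partial>lborel) \<le> C * (\<integral>x. 1 / (1 + norm (x::'a)) ^ (DIM('a) + 2) \<partial>lborel)"
proof -
  let ?w = "\<lambda>x::'a. 1 / (1 + norm (x::'a)) ^ (DIM('a) + 2)"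
  have le: "norm (f x) \<le> C * ?w x" for x
  proof -
    have "0 < (1 + norm x) ^ (DIM('a) + 2)" by (intro zero_less_power) (auto simp: add_pos_nonneg)
    with assms(2)[of x] show ?thesis by (simp add: field_simps)
  qed
  show int: "integrable lborel f"
    by (rule Bochner_Integration.integrable_bound[OF integrable_mult_right[OF integrable_weight_power, of C]])
      (use assms(1) in \<open>simp, intro always_eventually allI,
        unfold real_norm_def, intro order_trans[OF le abs_ge_self]\<close>)
  have "(\<integral>x. norm (f x) \<partial>lborel) \<le> (\<integral>x. C * ?w x \<partial>lborel)"
    by (rule integral_mono[OF integrable_norm[OF int] integrable_mult_right[OF integrable_weight_power] le])
  then show "(\<integral>x. norm (f x) \<partial>lborel) \<le> C * (\<integral>x. ?w x \<partial>lborel)"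
    by (simp only: integral_mult_right_zero)
qed

lemma schwartz_decay:
  assumes "f \<in> schwartz"
  obtains C where "C \<ge> 0" "\<And>x. (1 + norm x) ^ N * norm (f x) \<le> C"
proof -
  have "(\<lambda>_. f) \<in> rapid {()} UNIV (\<lambda>x. 1 + norm x) (\<lambda>_ _. 1)"
    using assms smooth_family_base unfolding schwartz_iff by blast
  from rapidE[OF this, of N] that show ?thesis by auto
qed

lemma schwartz_integrable: "f \<in> schwartz \<Longrightarrow> integrable lborel f"
  by (metis integrable_rapid_bound(1) schwartz_borel schwartz_decay)

lemma norm_sum_coordinates_le:
  fixes v :: "'a::euclidean_space" and c :: "'a \<Rightarrow> complex"
  assumes "\<And>b. b \<in> Basis \<Longrightarrow> norm (c b) \<le> B"
  shows "norm (\<Sum>b\<in>Basis. (v \<bullet> b) *\<^sub>R c b) \<le> (real DIM('a) * B) * norm v"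
proof -
  have "norm (\<Sum>b\<in>Basis. (v \<bullet> b) *\<^sub>R c b) \<le> (\<Sum>b\<in>(Basis::'a set). norm v * B)"
  proof (rule order_trans[OF norm_sum sum_mono])
    fix b :: 'a assume b: "b \<in> Basis"
    show "norm ((v \<bullet> b) *\<^sub>R c b) \<le> norm v * B"
      using Basis_le_norm[OF b, of v] assms[OF b] by (auto intro!: mult_mono)
  qed
  then show ?thesis by (simp add: algebra_simps)
qed

text \<open>The remainders of the difference quotients tend to zero pointwise and, by the mean value
  inequality, are dominated by \<open>2 d g\<close>; dominated convergence applies along every sequence.\<close>

lemma has_derivative_integral_dominated:
  fixes f :: "'a::euclidean_space \<Rightarrow> 't \<Rightarrow> complex"
  assumes e: "0 < e"
    and int: "\<And>x. x \<in> ball x0 e \<Longrightarrow> integrable M (f x)"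
    and der: "\<And>x t. x \<in> ball x0 e \<Longrightarrow> t \<in> space M \<Longrightarrow>
      ((\<lambda>x. f x t) has_derivative (\<lambda>v. \<Sum>b\<in>Basis. (v \<bullet> b) *\<^sub>R f' b x t)) (at x)"
    and meas: "\<And>b. b \<in> Basis \<Longrightarrow> f' b x0 \<in> borel_measurable M"
    and dom: "\<And>b x t. b \<in> Basis \<Longrightarrow> x \<in> ball x0 e \<Longrightarrow> t \<in> space M \<Longrightarrow> norm (f' b x t) \<le> g t"
    and g: "integrable M g"
  shows "((\<lambda>x. \<integral>t. f x t \<partial>M) has_derivative
      (\<lambda>v. \<Sum>b\<in>Basis. (v \<bullet> b) *\<^sub>R (\<integral>t. f' b x0 t \<partial>M))) (at x0)"
proof -
  let ?d = "real DIM('a)"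
  define D where "D v t = (\<Sum>b\<in>Basis. (v \<bullet> b) *\<^sub>R f' b x0 t)" for v t
  define R where "R y t = (1 / norm (y - x0)) *\<^sub>R (f y t - (f x0 t + D (y - x0) t))" for y t
  have x0: "x0 \<in> ball x0 e" using e by simp
  have int': "integrable M (f' b x0)" if "b \<in> Basis" for b
    by (rule Bochner_Integration.integrable_bound[OF g meas[OF that]])
      (use dom[OF that x0] in \<open>auto intro!: AE_I2 order_trans[OF _ abs_ge_self]\<close>)
  have intD: "integrable M (D v)" for v
    unfolding D_def using int' by auto
  have int_D: "(\<integral>t. D v t \<partial>M) = (\<Sum>b\<in>Basis. (v \<bullet> b) *\<^sub>R (\<integral>t. f' b x0 t \<partial>M))" for v
    unfolding D_def using int' by (subst Bochner_Integration.integral_sum) auto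
  have int_R: "(\<integral>t. R y t \<partial>M) = (1 / norm (y - x0)) *\<^sub>R ((\<integral>t. f y t \<partial>M) -
      ((\<integral>t. f x0 t \<partial>M) + (\<Sum>b\<in>Basis. ((y - x0) \<bullet> b) *\<^sub>R (\<integral>t. f' b x0 t \<partial>M))))"
    if "y \<in> ball x0 e" for y
    unfolding R_def using int[OF that] int[OF x0] intD[of "y - x0"] int_D[of "y - x0"] by simp
  have bound: "norm (R y t) \<le> 2 * (?d * g t)" if y: "y \<in> ball x0 e" and t: "t \<in> space M" for y t
  proof (cases "y = x0")
    case True
    have "0 \<le> g t" using dom[OF SOME_Basis x0 t] by (rule order_trans[OF norm_ge_zero])
    then show ?thesis using True by (simp add: R_def)
  next
    case False
    have "norm (f y t - f x0 t) \<le> (?d * g t) * norm (y - x0)"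
    proof (rule differentiable_bound[OF convex_ball _ _ y x0])
      fix x assume x: "x \<in> ball x0 e"
      show "((\<lambda>x. f x t) has_derivative (\<lambda>v. \<Sum>b\<in>Basis. (v \<bullet> b) *\<^sub>R f' b x t)) (at x within ball x0 e)"
        using der[OF x t] by (rule has_derivative_at_withinI)
      show "onorm (\<lambda>v. \<Sum>b\<in>Basis. (v \<bullet> b) *\<^sub>R f' b x t) \<le> ?d * g t"
        by (intro onorm_le norm_sum_coordinates_le dom x t)
    qed
    moreover have "norm (D (y - x0) t) \<le> (?d * g t) * norm (y - x0)"
      unfolding D_def by (intro norm_sum_coordinates_le dom x0 t)
    ultimately have "norm (f y t - (f x0 t + D (y - x0) t)) \<le> 2 * (?d * g t) * norm (y - x0)"
      using norm_triangle_ineq4[of "f y t - f x0 t" "D (y - x0) t"] by (simp add: algebra_simps)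
    moreover have "norm (R y t) = norm (f y t - (f x0 t + D (y - x0) t)) / norm (y - x0)"
      unfolding R_def norm_scaleR by simp
    ultimately show ?thesis using False by (simp add: pos_divide_le_eq)
  qed
  have lim: "((\<lambda>y. R y t) \<longlongrightarrow> 0) (at x0)" if t: "t \<in> space M" for t
    using der[OF x0 t] unfolding has_derivative_within R_def D_def by simp
  show ?thesis
    unfolding has_derivative_within
  proof
    show "bounded_linear (\<lambda>v. \<Sum>b\<in>Basis. (v \<bullet> b) *\<^sub>R (\<integral>t. f' b x0 t \<partial>M))"
      by (intro bounded_linear_sum bounded_linear_scaleR_const bounded_linear_inner_left)
    show "((\<lambda>y. (1 / norm (y - x0)) *\<^sub>R ((\<integral>t. f y t \<partial>M) -
      ((\<integral>t. f x0 t \<partial>M) + (\<Sum>b\<in>Basis. ((y - x0) \<bullet> b) *\<^sub>R (\<integral>t. f' b x0 t \<partial>M))))) \<longlongrightarrow> 0) (at x0)"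
      unfolding tendsto_at_iff_sequentially comp_def
    proof (intro allI impI)
      fix X :: "nat \<Rightarrow> 'a" assume X: "\<forall>i. X i \<in> UNIV - {x0}" "X \<longlonglongrightarrow> x0"
      have "eventually (\<lambda>n. X n \<in> ball x0 e) sequentially"
        using topological_tendstoD[OF X(2) open_ball, of x0 e] e by simp
      then obtain K where K: "\<And>n. n \<ge> K \<Longrightarrow> X n \<in> ball x0 e"
        by (auto simp: eventually_sequentially)
      have XK: "(\<lambda>n. X (n + K)) \<longlonglongrightarrow> x0" using X(2) by (rule LIMSEQ_ignore_initial_segment)
      have "(\<lambda>n. \<integral>t. R (X (n + K)) t \<partial>M) \<longlonglongrightarrow> (\<integral>t. 0 \<partial>M)"
      proof (rule integral_dominated_convergence[where w = "\<lambda>t. 2 * (?d * g t)"])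
        show "integrable M (\<lambda>t. 2 * (?d * g t))" using g by simp
        show "R (X (n + K)) \<in> borel_measurable M" for n
          unfolding R_def using int[OF K] int[OF x0] intD by simp
        show "AE t in M. norm (R (X (n + K)) t) \<le> 2 * (?d * g t)" for n
          using bound[OF K] by (intro AE_I2) simp
        show "AE t in M. (\<lambda>n. R (X (n + K)) t) \<longlonglongrightarrow> 0"
        proof (rule AE_I2)
          fix t assume "t \<in> space M"
          from lim[OF this] show "(\<lambda>n. R (X (n + K)) t) \<longlonglongrightarrow> 0"
            unfolding tendsto_at_iff_sequentially comp_def using X(1) XK by auto
        qed
      qed simp
      then have "(\<lambda>n. (1 / norm (X (n + K) - x0)) *\<^sub>R ((\<integral>t. f (X (n + K)) t \<partial>M) -
        ((\<integral>t. f x0 t \<partial>M) + (\<Sum>b\<in>Basis. ((X (n + K) - x0) \<bullet> b) *\<^sub>R (\<integral>t. f' b x0 t \<partial>M))))) \<longlonglongrightarrow> 0"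
        using int_R K by simp
      then show "(\<lambda>n. (1 / norm (X n - x0)) *\<^sub>R ((\<integral>t. f (X n) t \<partial>M) -
        ((\<integral>t. f x0 t \<partial>M) + (\<Sum>b\<in>Basis. ((X n - x0) \<bullet> b) *\<^sub>R (\<integral>t. f' b x0 t \<partial>M))))) \<longlonglongrightarrow> 0"
        by (rule LIMSEQ_offset)
    qed
  qed
qed

section \<open>The Fourier transform on the Schwartz space\<close>

lemma schwartz_pderiv_dir:
  assumes "f \<in> schwartz" "b \<in> Basis"
  shows "pderiv_dir b f \<in> schwartz"
  using smooth_family_pderiv_dir[of "\<lambda>_. f"] assms by (simp add: schwartz_iff)

lemma schwartz_pderivs:
  assumes "f \<in> schwartz" "bs \<in> lists Basis"
  shows "pderivs bs f \<in> schwartz"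
  using assms(2) by (induction bs) (auto intro: schwartz_pderiv_dir assms(1))

lemma exp_inner_has_derivative:
  fixes \<xi> :: "'a::euclidean_space"
  shows "((\<lambda>x. c * exp (- \<i> * of_real (x \<bullet> \<xi>))) has_derivative
    (\<lambda>v. \<Sum>b\<in>Basis. (v \<bullet> b) *\<^sub>R ((c * (- \<i> * of_real (\<xi> \<bullet> b))) * exp (- \<i> * of_real (x \<bullet> \<xi>))))) (at x)"
proof -
  have "((\<lambda>x. c * exp (- \<i> * of_real (x \<bullet> \<xi>))) has_derivative
      (\<lambda>v. c * (exp (- \<i> * of_real (x \<bullet> \<xi>)) * (- \<i> * of_real (v \<bullet> \<xi>))))) (at x)"
  proof (intro has_derivative_mult_right)
    have "((\<lambda>x. - \<i> * of_real (x \<bullet> \<xi>)) has_derivative (\<lambda>v. - \<i> * of_real (v \<bullet> \<xi>))) (at x)"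
      by (auto intro!: derivative_eq_intros)
    from has_derivative_compose[OF this DERIV_exp[unfolded has_field_derivative_def]]
    show "((\<lambda>x. exp (- \<i> * of_real (x \<bullet> \<xi>))) has_derivative
      (\<lambda>v. exp (- \<i> * of_real (x \<bullet> \<xi>)) * (- \<i> * of_real (v \<bullet> \<xi>)))) (at x)" .
  qed
  moreover have "(\<lambda>v. c * (exp (- \<i> * of_real (x \<bullet> \<xi>)) * (- \<i> * of_real (v \<bullet> \<xi>)))) =
      (\<lambda>v. \<Sum>b\<in>Basis. (v \<bullet> b) *\<^sub>R ((c * (- \<i> * of_real (\<xi> \<bullet> b))) * exp (- \<i> * of_real (x \<bullet> \<xi>))))"
  proof
    fix v :: 'a
    show "c * (exp (- \<i> * of_real (x \<bullet> \<xi>)) * (- \<i> * of_real (v \<bullet> \<xi>))) =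
      (\<Sum>b\<in>Basis. (v \<bullet> b) *\<^sub>R ((c * (- \<i> * of_real (\<xi> \<bullet> b))) * exp (- \<i> * of_real (x \<bullet> \<xi>))))"
      by (subst euclidean_inner[of v \<xi>])
        (simp add: sum_distrib_left sum_distrib_right scaleR_conv_of_real sum_negf algebra_simps)
  qed
  ultimately show ?thesis by (rule has_derivative_eq_rhs)
qed

lemma character_multiplier:
  fixes \<xi> :: "'a::euclidean_space"
  shows "(\<lambda>i x. exp (- \<i> * of_real (x \<bullet> \<xi>))) \<in> multiplier_family (I :: 'i set)"
proof (rule smooth_family_coinduct[where
      \<C> = "range (\<lambda>c i x. c * exp (- \<i> * of_real (x \<bullet> \<xi>)))", OF _ cong_closed_moderate])
  show "(\<lambda>i x. exp (- \<i> * of_real (x \<bullet> \<xi>))) \<in> range (\<lambda>c i x. c * exp (- \<i> * of_real (x \<bullet> \<xi>)))"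
    by (intro image_eqI[where x = 1]) auto
  fix F :: "'i \<Rightarrow> 'a \<Rightarrow> complex"
  assume "F \<in> range (\<lambda>c i x. c * exp (- \<i> * of_real (x \<bullet> \<xi>)))"
  then obtain c where F: "F = (\<lambda>i x. c * exp (- \<i> * of_real (x \<bullet> \<xi>)))" by auto
  show "F \<in> moderate I UNIV (\<lambda>x. 1 + norm x)"
    by (rule moderateI[where C = "norm c" and k = 0]) (simp add: F norm_mult)
  show "\<exists>F'. (\<forall>b\<in>Basis. F' b \<in> range (\<lambda>c i x. c * exp (- \<i> * of_real (x \<bullet> \<xi>))))
      \<and> gradient_on I UNIV F F'"
    unfolding F
    by (intro exI[of _ "\<lambda>b i x. (c * (- \<i> * of_real (\<xi> \<bullet> b))) * exp (- \<i> * of_real (x \<bullet> \<xi>))"] conjI ballI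
        gradient_onI exp_inner_has_derivative rangeI)
qed auto

lemma schwartz_weighted_integrable:
  fixes f :: "'a::euclidean_space \<Rightarrow> complex"
  assumes f: "f \<in> schwartz"
  shows "integrable lborel (\<lambda>x. norm x * norm (f x))"
proof -
  obtain C where C: "\<And>x. (1 + norm x) ^ (DIM('a) + 3) * norm (f x) \<le> C"
    using schwartz_decay[OF f] by metis
  have "integrable lborel (\<lambda>x. of_real (norm x) * f x)"
  proof (rule integrable_rapid_bound(1)[of _ C])
    show "(\<lambda>x. of_real (norm x) * f x) \<in> borel_measurable borel"
      using schwartz_borel[OF f] by measurable
    fix x :: 'a
    have "(1 + norm x) ^ (DIM('a) + 2) * norm (of_real (norm x) * f x)
        \<le> (1 + norm x) ^ (DIM('a) + 2) * ((1 + norm x) * norm (f x))"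
      unfolding norm_mult by (intro mult_left_mono mult_right_mono) auto
    also have "\<dots> = (1 + norm x) ^ (DIM('a) + 3) * norm (f x)" by (simp add: numeral_3_eq_3)
    finally show "(1 + norm x) ^ (DIM('a) + 2) * norm (of_real (norm x) * f x) \<le> C"
      using C[of x] by linarith
  qed
  from integrable_norm[OF this] show ?thesis by (simp add: norm_mult)
qed

lemma fourier_has_derivative:
  fixes f :: "'a::euclidean_space \<Rightarrow> complex"
  assumes f: "f \<in> schwartz"
  shows "(fourier f has_derivative
    (\<lambda>v. \<Sum>b\<in>Basis. (v \<bullet> b) *\<^sub>R fourier (\<lambda>x. (- \<i>) * (of_real (x \<bullet> b) * f x)) \<xi>)) (at \<xi>)"
  unfolding fourier_def
proof (rule has_derivative_integral_dominated[where e = 1 and g = "\<lambda>x. norm x * norm (f x)"])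
  note [measurable] = schwartz_borel[OF f]
  show "integrable lborel (\<lambda>x. norm x * norm (f x))" by (rule schwartz_weighted_integrable[OF f])
  show "integrable lborel (\<lambda>x. exp (- \<i> * of_real (x \<bullet> \<eta>)) * f x)" for \<eta>
    by (rule Bochner_Integration.integrable_bound[OF schwartz_integrable[OF f]])
      (auto simp: norm_mult)
  show "(\<lambda>x. exp (- \<i> * of_real (x \<bullet> \<xi>)) * ((- \<i>) * (of_real (x \<bullet> b) * f x))) \<in> borel_measurable lborel" for b
    by measurable
  fix \<eta> x :: 'a
  show "((\<lambda>\<xi>. exp (- \<i> * of_real (x \<bullet> \<xi>)) * f x) has_derivative
      (\<lambda>v. \<Sum>b\<in>Basis. (v \<bullet> b) *\<^sub>R (exp (- \<i> * of_real (x \<bullet> \<eta>)) * ((- \<i>) * (of_real (x \<bullet> b) * f x))))) (at \<eta>)"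
    using exp_inner_has_derivative[of "f x" x \<eta>] by (simp add: inner_commute algebra_simps)
  fix b :: 'a assume "b \<in> Basis"
  then show "norm (exp (- \<i> * of_real (x \<bullet> \<eta>)) * ((- \<i>) * (of_real (x \<bullet> b) * f x))) \<le> norm x * norm (f x)"
    using Basis_le_norm[of b x] by (auto simp: norm_mult intro: mult_right_mono)
qed auto

lemma integral_translate:
  fixes f :: "'a::euclidean_space \<Rightarrow> complex"
  assumes "f \<in> borel_measurable borel"
  shows "(\<integral>x. f (x + y) \<partial>lborel) = (\<integral>x. f x \<partial>lborel)"
    and "integrable lborel f \<Longrightarrow> integrable lborel (\<lambda>x. f (x + y))"
proof -
  have *: "distr lborel borel ((+) y) = (lborel :: 'a measure)" by (rule lborel_distr_plus)
  have "(\<integral>x. f x \<partial>lborel) = (\<integral>x. f x \<partial>distr lborel borel ((+) y))" by (simp add: *)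
  also have "\<dots> = (\<integral>x. f (y + x) \<partial>lborel)" using assms by (intro integral_distr) auto
  finally show "(\<integral>x. f (x + y) \<partial>lborel) = (\<integral>x. f x \<partial>lborel)" by (simp add: add.commute)
  assume "integrable lborel f"
  then have "integrable (distr lborel borel ((+) y)) f" by (simp add: *)
  then show "integrable lborel (\<lambda>x. f (x + y))"
    using assms by (subst (asm) integrable_distr_eq) (auto simp: add.commute)
qed

text \<open>The integral of \<open>f (x + y)\<close> does not depend on \<open>y\<close>; its derivative at \<open>y = 0\<close>, computed under the
  integral sign, is therefore zero.\<close>

lemma integral_pderiv_dir_schwartz:
  fixes f :: "'a::euclidean_space \<Rightarrow> complex"
  assumes f: "f \<in> schwartz" and b: "b \<in> Basis"
  shows "(\<integral>x. pderiv_dir b f x \<partial>lborel) = 0"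
proof -
  let ?n = "DIM('a) + 2"
  note f' = schwartz_pderiv_dir[OF f]
  have "\<exists>C\<ge>0. \<forall>x. (1 + norm x) ^ ?n * norm (pderiv_dir c f x) \<le> C" if "c \<in> Basis" for c
    using schwartz_decay[OF f'[OF that]] by metis
  then obtain C where C: "\<And>c. c \<in> Basis \<Longrightarrow> C c \<ge> 0"
    "\<And>c x. c \<in> Basis \<Longrightarrow> (1 + norm x) ^ ?n * norm (pderiv_dir c f x) \<le> C c"
    by metis
  define K where "K = (\<Sum>c\<in>Basis. C c)"
  have "((\<lambda>y. \<integral>x. f (x + y) \<partial>lborel) has_derivative
      (\<lambda>v. \<Sum>b\<in>Basis. (v \<bullet> b) *\<^sub>R (\<integral>x. pderiv_dir b f (x + 0) \<partial>lborel))) (at 0)"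
  proof (rule has_derivative_integral_dominated[where e = 1 and g = "\<lambda>x. (K * 2 ^ ?n) * (1 / (1 + norm x) ^ ?n)"])
    show "integrable lborel (\<lambda>x::'a. (K * 2 ^ ?n) * (1 / (1 + norm x) ^ ?n))"
      by (intro integrable_mult_right integrable_weight_power)
    show "integrable lborel (\<lambda>x. f (x + y))" for y
      by (rule integral_translate(2)[OF schwartz_borel[OF f] schwartz_integrable[OF f]])
    show "(\<lambda>x. pderiv_dir c f (x + 0)) \<in> borel_measurable lborel" if "c \<in> Basis" for c
      using schwartz_borel[OF f'[OF that]] by simp
    fix y x :: 'a
    show "((\<lambda>y. f (x + y)) has_derivative (\<lambda>v. \<Sum>b\<in>Basis. (v \<bullet> b) *\<^sub>R pderiv_dir b f (x + y))) (at y)"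
      by (rule has_derivative_compose[of "\<lambda>y. x + y" "\<lambda>v. v" y UNIV f, OF _ has_derivative_pderiv_dir])
        (auto intro!: derivative_eq_intros schwartz_differentiable f)
    fix c :: 'a assume y: "y \<in> ball 0 1" and c: "c \<in> Basis"
    \<comment> \<open>Translating by less than 1 costs a factor 2 in the weight.\<close>
    have "1 + norm x \<le> 2 * (1 + norm (x + y))"
      using norm_triangle_ineq4[of "x + y" y] y norm_ge_zero[of "x + y"]
      by (simp del: norm_ge_zero)
    then have "(1 + norm x) ^ ?n \<le> (2 * (1 + norm (x + y))) ^ ?n" by (intro power_mono) auto
    then have "(1 + norm x) ^ ?n * norm (pderiv_dir c f (x + y))
        \<le> (2 * (1 + norm (x + y))) ^ ?n * norm (pderiv_dir c f (x + y))"
      by (rule mult_right_mono) simp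
    also have "\<dots> = 2 ^ ?n * ((1 + norm (x + y)) ^ ?n * norm (pderiv_dir c f (x + y)))"
      by (simp only: power_mult_distrib mult.assoc)
    also have "\<dots> \<le> 2 ^ ?n * C c" by (intro mult_left_mono C c) auto
    also have "C c \<le> K" unfolding K_def using C(1) c by (intro member_le_sum) auto
    finally have "(1 + norm x) ^ ?n * norm (pderiv_dir c f (x + y)) \<le> 2 ^ ?n * K" by simp
    moreover have "0 < (1 + norm x) ^ ?n" by (intro zero_less_power) (auto simp: add_pos_nonneg)
    ultimately show "norm (pderiv_dir c f (x + y)) \<le> (K * 2 ^ ?n) * (1 / (1 + norm x) ^ ?n)"
      by (simp add: pos_le_divide_eq mult.commute del: power_Suc)
  qed auto
  then have "pderiv_dir b (\<lambda>y. \<integral>x. f (x + y) \<partial>lborel) 0 = (\<integral>x. pderiv_dir b f (x + 0) \<partial>lborel)"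
    using b by (rule pderiv_dir_eqI)
  then show ?thesis
    by (simp add: integral_translate(1)[OF schwartz_borel[OF f]] pderiv_dir_def)
qed

lemma fourier_integrable:
  assumes "f \<in> schwartz"
  shows "integrable lborel (\<lambda>x. exp (- \<i> * of_real (x \<bullet> \<xi>)) * f x)"
  by (intro schwartz_integrable schwartz_mult character_multiplier assms)

lemma fourier_pderiv_dir:
  fixes f :: "'a::euclidean_space \<Rightarrow> complex"
  assumes f: "f \<in> schwartz" and b: "b \<in> Basis"
  shows "fourier (pderiv_dir b f) \<xi> = \<i> * of_real (\<xi> \<bullet> b) * fourier f \<xi>"
proof -
  let ?e = "\<lambda>x. exp (- \<i> * of_real (x \<bullet> \<xi>))"
  have h: "(\<lambda>x. ?e x * f x) \<in> schwartz"
    by (intro schwartz_mult character_multiplier f)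
  have "gradient_on {()} UNIV (\<lambda>i x. (1 * ?e x) * f x)
      (\<lambda>b i x. ((1 * (- \<i> * of_real (\<xi> \<bullet> b))) * ?e x) * f x + (1 * ?e x) * pderiv_dir b f x)"
    by (intro gradient_on_mult gradient_onI exp_inner_has_derivative has_derivative_pderiv_dir
        schwartz_differentiable f)
  from pderiv_dir_eqI[OF gradient_onD[OF this, of "()"] b]
  have "pderiv_dir b (\<lambda>x. ?e x * f x) x =
      (- \<i> * of_real (\<xi> \<bullet> b)) * (?e x * f x) + ?e x * pderiv_dir b f x" for x
    by simp
  then have "0 = (\<integral>x. (- \<i> * of_real (\<xi> \<bullet> b)) * (?e x * f x) + ?e x * pderiv_dir b f x \<partial>lborel)"
    using integral_pderiv_dir_schwartz[OF h b] by simp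
  also have "\<dots> = (\<integral>x. (- \<i> * of_real (\<xi> \<bullet> b)) * (?e x * f x) \<partial>lborel) + (\<integral>x. ?e x * pderiv_dir b f x \<partial>lborel)"
    by (intro Bochner_Integration.integral_add integrable_mult_right fourier_integrable f
        schwartz_pderiv_dir b)
  also have "\<dots> = (- \<i> * of_real (\<xi> \<bullet> b)) * fourier f \<xi> + fourier (pderiv_dir b f) \<xi>"
    unfolding fourier_def by (subst integral_mult_right_zero) simp
  finally show ?thesis by (simp add: algebra_simps)
qed

lemma norm_fourier_le:
  assumes "f \<in> schwartz"
  shows "norm (fourier f \<xi>) \<le> (\<integral>x. norm (f x) \<partial>lborel)"
proof -
  have "norm (fourier f \<xi>) \<le> (\<integral>x. norm (exp (- \<i> * of_real (x \<bullet> \<xi>)) * f x) \<partial>lborel)"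
    unfolding fourier_def by (rule integral_norm_bound)
  then show ?thesis by (simp add: norm_mult)
qed

text \<open>One factor \<open>1 + |\<xi>|\<close> is at most \<open>1 + (\<Sum>b. |\<xi>\<^sub>b|)\<close>, and each \<open>\<xi>\<^sub>b\<close> can be moved onto the family as a
  derivative. This is an induction over the power for all families at once.\<close>

lemma fourier_rapid:
  fixes F :: "'i \<Rightarrow> 'a::euclidean_space \<Rightarrow> complex"
  assumes q: "graded_on I q" and F: "F \<in> schwartz_family I q"
  shows "(\<lambda>i. fourier (F i)) \<in> rapid I UNIV (\<lambda>x. 1 + norm x) q"
proof (rule rapidI)
  fix N
  show "\<exists>k C. \<forall>i\<in>I. \<forall>x\<in>UNIV. (1 + norm x) ^ N * norm (fourier (F i) x) \<le> C * q k i"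
    using F
  proof (induction N arbitrary: F)
    case 0
    let ?J = "\<integral>x. 1 / (1 + norm (x::'a)) ^ (DIM('a) + 2) \<partial>lborel"
    obtain k C where C: "\<And>i x. i \<in> I \<Longrightarrow> (1 + norm x) ^ (DIM('a) + 2) * norm (F i x) \<le> C * q k i"
      using rapidE[OF smooth_family_base[OF 0] q, of "DIM('a) + 2"] by (metis UNIV_I)
    have "norm (fourier (F i) x) \<le> (C * ?J) * q k i" if i: "i \<in> I" for i x
    proof -
      have f: "F i \<in> schwartz" by (rule schwartz_family_member[OF 0 i])
      have "norm (fourier (F i) x) \<le> (C * q k i) * ?J"
        using norm_fourier_le[OF f] integrable_rapid_bound(2)[OF schwartz_borel[OF f] C[OF i]]
        by (rule order_trans)
      then show ?thesis by (simp only: mult_ac)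
    qed
    then show ?case by auto
  next
    case (Suc N)
    have der: "(\<lambda>i. pderiv_dir b (F i)) \<in> schwartz_family I q" if "b \<in> Basis" for b
      by (rule smooth_family_pderiv_dir[OF Suc.prems that])
    have "\<exists>k C. C \<ge> 0 \<and> (\<forall>i\<in>I. \<forall>x. (1 + norm x) ^ N * norm (fourier (G i) x) \<le> C * q k i)"
      if G: "G \<in> schwartz_family I q" for G :: "'i \<Rightarrow> 'a \<Rightarrow> complex"
    proof -
      obtain k C where C: "\<forall>i\<in>I. \<forall>x\<in>UNIV. (1 + norm x) ^ N * norm (fourier (G i) x) \<le> C * q k i"
        using Suc.IH[OF G] by blast
      have "(1 + norm x) ^ N * norm (fourier (G i) x) \<le> \<bar>C\<bar> * q k i" if "i \<in> I" for i x
        using C that graded_onD(1)[OF q that, of k]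
        by (meson UNIV_I abs_ge_self mult_right_mono order_trans)
      then show ?thesis by (intro exI[of _ k] exI[of _ "\<bar>C\<bar>"]) auto
    qed
    note bd = this
    obtain k C where C: "C \<ge> 0" "\<And>i x. i \<in> I \<Longrightarrow> (1 + norm x) ^ N * norm (fourier (F i) x) \<le> C * q k i"
      using bd[OF Suc.prems] by blast
    obtain l D where D: "\<And>b. b \<in> Basis \<Longrightarrow> D b \<ge> 0"
      "\<And>b i x. b \<in> Basis \<Longrightarrow> i \<in> I \<Longrightarrow>
        (1 + norm x) ^ N * norm (fourier (pderiv_dir b (F i)) x) \<le> D b * q (l b) i"
      using bd[OF der] by metis
    define m where "m = max k (Max (l ` Basis))"
    have "(1 + norm x) ^ Suc N * norm (fourier (F i) x) \<le> (C + (\<Sum>b\<in>Basis. D b)) * q m i"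
      if i: "i \<in> I" for i and x :: 'a
    proof -
      let ?w = "(1 + norm x) ^ N"
      have "1 + norm x \<le> 1 + (\<Sum>b\<in>Basis. \<bar>x \<bullet> b\<bar>)" using norm_le_l1[of x] by simp
      then have "(1 + norm x) * (?w * norm (fourier (F i) x)) \<le> (1 + (\<Sum>b\<in>Basis. \<bar>x \<bullet> b\<bar>)) * (?w * norm (fourier (F i) x))"
        by (rule mult_right_mono) auto
      also have "\<dots> = ?w * norm (fourier (F i) x) + (\<Sum>b\<in>Basis. ?w * norm (fourier (pderiv_dir b (F i)) x))"
        by (simp add: distrib_right sum_distrib_right sum_distrib_left fourier_pderiv_dir[OF schwartz_family_member[OF Suc.prems i]]
            norm_mult algebra_simps cong: sum.cong)
      also have "\<dots> \<le> C * q k i + (\<Sum>b\<in>Basis. D b * q (l b) i)"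
        by (intro add_mono sum_mono C D i)
      also have "\<dots> \<le> C * q m i + (\<Sum>b\<in>Basis. D b * q m i)"
        using C(1) D(1) graded_onD(2)[OF q i]
        by (intro add_mono sum_mono mult_left_mono) (auto simp: m_def le_max_iff_disj)
      finally show ?thesis by (simp add: algebra_simps sum_distrib_left sum_distrib_right)
    qed
    then show ?case by blast
  qed
qed

text \<open>Derivatives of a transform are transforms of the family multiplied by coordinates, so the
  transforms of Schwartz families are a class closed under differentiation.\<close>

theorem fourier_family:
  fixes F :: "'i \<Rightarrow> 'a::euclidean_space \<Rightarrow> complex"
  assumes q: "graded_on I q" and F: "F \<in> schwartz_family I q"
  shows "(\<lambda>i. fourier (F i)) \<in> schwartz_family I q"
proof (rule smooth_family_coinduct[where \<C> = "{\<lambda>i. fourier (F i) |F. F \<in> schwartz_family I q}",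
      OF open_UNIV cong_closed_rapid])
  fix H :: "'i \<Rightarrow> 'a \<Rightarrow> complex"
  assume "H \<in> {\<lambda>i. fourier (F i) |F. F \<in> schwartz_family I q}"
  then obtain F where F: "F \<in> schwartz_family I q" and H: "H = (\<lambda>i. fourier (F i))" by blast
  show "H \<in> rapid I UNIV (\<lambda>x. 1 + norm x) q" unfolding H by (rule fourier_rapid[OF q F])
  show "\<exists>F'. (\<forall>b\<in>Basis. F' b \<in> {\<lambda>i. fourier (F i) |F. F \<in> schwartz_family I q}) \<and> gradient_on I UNIV H F'"
  proof (intro exI[of _ "\<lambda>b i. fourier (\<lambda>x. (- \<i>) * (of_real (x \<bullet> b) * F i x))"] conjI ballI)
    show "gradient_on I UNIV H (\<lambda>b i. fourier (\<lambda>x. (- \<i>) * (of_real (x \<bullet> b) * F i x)))"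
      unfolding H by (intro gradient_onI fourier_has_derivative schwartz_family_member[OF F])
    fix b :: 'a assume b: "b \<in> Basis"
    have "(\<lambda>i x. (- \<i>) * (of_real (x \<bullet> b) * F i x)) \<in> schwartz_family I q"
      by (rule schwartz_family_scale[where C = 1, OF q schwartz_family_mult[OF q coordinate_multiplier[OF b] F]]) simp
    then show "(\<lambda>i. fourier (\<lambda>x. (- \<i>) * (of_real (x \<bullet> b) * F i x))) \<in> {\<lambda>i. fourier (F i) |F. F \<in> schwartz_family I q}"
      by (intro CollectI exI[of _ "\<lambda>i x. (- \<i>) * (of_real (x \<bullet> b) * F i x)"] conjI refl)
  qed
next
  show "(\<lambda>i. fourier (F i)) \<in> {\<lambda>i. fourier (F i) |F. F \<in> schwartz_family I q}"
    by (intro CollectI exI[of _ F] conjI refl F)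
qed

lemma fourier_schwartz: "f \<in> schwartz \<Longrightarrow> fourier f \<in> schwartz"
  using fourier_family[of "{()}" "\<lambda>_ _. 1" "\<lambda>_. f"] by (simp add: schwartz_iff)

section \<open>Fourier inversion up to a constant\<close>

lemma fourier_multiplication_formula:
  fixes f g :: "'a::euclidean_space \<Rightarrow> complex"
  assumes f: "f \<in> schwartz" and g: "g \<in> schwartz"
  shows "(\<integral>\<xi>. fourier f \<xi> * g \<xi> \<partial>lborel) = (\<integral>x. f x * fourier g x \<partial>lborel)"
proof -
  note [measurable] = schwartz_borel[OF f] schwartz_borel[OF g]
  let ?k = "\<lambda>x \<xi>::'a. exp (- \<i> * of_real (x \<bullet> \<xi>)) * f x * g \<xi>"
  have "integrable (lborel \<Otimes>\<^sub>M lborel) (\<lambda>(x, \<xi>). ?k x \<xi>)"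
  proof (rule lborel_pair.Fubini_integrable)
    show "(\<lambda>(x, \<xi>). ?k x \<xi>) \<in> borel_measurable (lborel \<Otimes>\<^sub>M lborel)"
      by measurable
    have "integrable lborel (\<lambda>x. norm (f x) * (\<integral>\<xi>. norm (g \<xi>) \<partial>lborel))"
      by (intro integrable_mult_left integrable_norm schwartz_integrable f)
    then show "integrable lborel (\<lambda>x. \<integral>\<xi>. norm (case (x, \<xi>) of (x, \<xi>) \<Rightarrow> ?k x \<xi>) \<partial>lborel)"
      by (simp add: norm_mult)
    have "integrable lborel (?k x)" for x
    proof -
      have "integrable lborel (\<lambda>\<xi>. f x * (exp (- \<i> * of_real (\<xi> \<bullet> x)) * g \<xi>))"
        by (intro integrable_mult_right fourier_integrable g)
      then show ?thesis by (simp add: inner_commute mult_ac)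
    qed
    then show "AE x in lborel. integrable lborel (\<lambda>\<xi>. case (x, \<xi>) of (x, \<xi>) \<Rightarrow> ?k x \<xi>)"
      by simp
  qed
  from lborel_pair.Fubini_integral[OF this]
  have "(\<integral>\<xi>. (\<integral>x. ?k x \<xi> \<partial>lborel) \<partial>lborel) = (\<integral>x. (\<integral>\<xi>. ?k x \<xi> \<partial>lborel) \<partial>lborel)" .
  moreover have 1: "(\<integral>x. ?k x \<xi> \<partial>lborel) = fourier f \<xi> * g \<xi>" for \<xi>
    unfolding fourier_def by (rule integral_mult_left_zero)
  moreover have 2: "(\<integral>\<xi>. ?k x \<xi> \<partial>lborel) = f x * fourier g x" for x
    unfolding fourier_def integral_mult_right_zero[symmetric]
    by (intro Bochner_Integration.integral_cong) (auto simp: inner_commute mult_ac)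
  ultimately show ?thesis by (simp only: 1 2)
qed

lemma schwartz_family_decay:
  assumes "graded_on I q" "F \<in> schwartz_family I q"
  obtains k C where "C \<ge> 0" "\<And>i x. i \<in> I \<Longrightarrow> (1 + norm x) ^ N * norm (F i x) \<le> C * q k i"
proof (rule rapidE[OF smooth_family_base[OF assms(2)] assms(1), of N])
  fix k C
  assume "0 \<le> C" "\<And>i x. i \<in> I \<Longrightarrow> x \<in> UNIV \<Longrightarrow> (1 + norm x) ^ N * norm (F i x) \<le> C * q k i"
  then show thesis by (intro that[of C k]) auto
qed

lemma schwartz_family_affine:
  fixes F :: "'i \<Rightarrow> 'a::euclidean_space \<Rightarrow> complex"
  assumes q: "graded_on I q" and F: "F \<in> schwartz_family I q" and a: "a \<noteq> 0"
  shows "(\<lambda>i x. F i (a *\<^sub>R x + y)) \<in> schwartz_family I q"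
proof (rule smooth_family_coinduct[where \<C> = "{\<lambda>i x. G i (a *\<^sub>R x + y) |G. G \<in> schwartz_family I q}",
      OF open_UNIV cong_closed_rapid])
  let ?C = "{\<lambda>i x. G i (a *\<^sub>R x + y) |G. G \<in> schwartz_family I q}"
  show "(\<lambda>i x. F i (a *\<^sub>R x + y)) \<in> ?C"
    by (intro CollectI exI[of _ F] conjI refl F)
  fix H :: "'i \<Rightarrow> 'a \<Rightarrow> complex"
  assume "H \<in> ?C"
  then obtain G where G: "G \<in> schwartz_family I q" and H: "H = (\<lambda>i x. G i (a *\<^sub>R x + y))" by blast
  \<comment> \<open>The constant in the comparison of the weights at the two points.\<close>
  let ?K = "1 + (1 + norm y) / \<bar>a\<bar>"
  have K: "1 + norm x \<le> ?K * (1 + norm (a *\<^sub>R x + y))" for x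
  proof -
    have "\<bar>a\<bar> * norm x \<le> norm (a *\<^sub>R x + y) + norm y"
      using norm_triangle_ineq4[of "a *\<^sub>R x + y" y] by simp
    then have "norm x \<le> (norm (a *\<^sub>R x + y) + norm y) / \<bar>a\<bar>" using a by (simp add: field_simps)
    also have "\<dots> \<le> ((1 + norm y) * (1 + norm (a *\<^sub>R x + y))) / \<bar>a\<bar>"
      by (intro divide_right_mono) (auto simp: algebra_simps)
    finally have "1 + norm x \<le> 1 + norm (a *\<^sub>R x + y) + ((1 + norm y) * (1 + norm (a *\<^sub>R x + y))) / \<bar>a\<bar>"
      by (simp add: add_increasing)
    then show ?thesis by (simp add: algebra_simps add_divide_distrib)
  qed
  show "H \<in> rapid I UNIV (\<lambda>x. 1 + norm x) q"
  proof (rule rapidI)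
    fix N
    obtain k C where C: "C \<ge> 0"
      "\<And>i x. i \<in> I \<Longrightarrow> (1 + norm x) ^ N * norm (G i x) \<le> C * q k i"
      by (rule schwartz_family_decay[OF q G, of N]) blast
    have "(1 + norm x) ^ N * norm (H i x) \<le> (?K ^ N * C) * q k i" if i: "i \<in> I" for i x
    proof -
      have "(1 + norm x) ^ N * norm (H i x) \<le> (?K * (1 + norm (a *\<^sub>R x + y))) ^ N * norm (H i x)"
        by (intro mult_right_mono power_mono K) auto
      also have "\<dots> = ?K ^ N * ((1 + norm (a *\<^sub>R x + y)) ^ N * norm (G i (a *\<^sub>R x + y)))"
        by (simp only: power_mult_distrib H mult.assoc)
      also have "\<dots> \<le> ?K ^ N * (C * q k i)"
        by (intro mult_left_mono C i zero_le_power) (auto intro!: add_nonneg_nonneg)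
      finally show ?thesis by (simp only: mult.assoc)
    qed
    then show "\<exists>k C. \<forall>i\<in>I. \<forall>x\<in>UNIV. (1 + norm x) ^ N * norm (H i x) \<le> C * q k i" by blast
  qed
  show "\<exists>F'. (\<forall>b\<in>Basis. F' b \<in> ?C) \<and> gradient_on I UNIV H F'"
  proof (intro exI[of _ "\<lambda>b i x. of_real a * pderiv_dir b (G i) (a *\<^sub>R x + y)"] conjI ballI gradient_onI)
    fix b :: 'a assume b: "b \<in> Basis"
    have "(\<lambda>i x. of_real a * pderiv_dir b (G i) x) \<in> schwartz_family I q"
      by (rule schwartz_family_scale[where C = "\<bar>a\<bar>", OF q smooth_family_pderiv_dir[OF G b]]) simp
    then show "(\<lambda>i x. of_real a * pderiv_dir b (G i) (a *\<^sub>R x + y)) \<in> ?C"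
      by (intro CollectI exI[of _ "\<lambda>i x. of_real a * pderiv_dir b (G i) x"] conjI refl)
  next
    fix i x assume i: "i \<in> I"
    have 1: "((\<lambda>x. a *\<^sub>R x + y) has_derivative (\<lambda>v. a *\<^sub>R v)) (at x)"
      by (auto intro!: derivative_eq_intros)
    from has_derivative_compose[OF 1 has_derivative_pderiv_dir[OF
          schwartz_differentiable[OF schwartz_family_member[OF G i]]]]
    show "(H i has_derivative (\<lambda>v. \<Sum>b\<in>Basis. (v \<bullet> b) *\<^sub>R (of_real a * pderiv_dir b (G i) (a *\<^sub>R x + y)))) (at x)"
      unfolding H by (simp add: scaleR_conv_of_real mult_ac)
  qed
qed

lemma schwartz_affine:
  assumes "f \<in> schwartz" "a \<noteq> 0"
  shows "(\<lambda>x. f (a *\<^sub>R x + y)) \<in> schwartz"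
  using schwartz_family_affine[of "{()}" "\<lambda>_ _. 1" "\<lambda>_. f" a y] assms by (simp add: schwartz_iff)

lemma schwartz_reflect: "f \<in> schwartz \<Longrightarrow> (\<lambda>x. f (- x)) \<in> schwartz"
  using schwartz_affine[of f "-1" 0] by simp

lemma schwartz_cnj:
  fixes f :: "'a::euclidean_space \<Rightarrow> complex"
  assumes "f \<in> schwartz"
  shows "(\<lambda>x. cnj (f x)) \<in> schwartz"
proof -
  let ?S = "schwartz_family {()} (\<lambda>_ _. 1) :: (unit \<Rightarrow> 'a \<Rightarrow> complex) set"
  have "(\<lambda>_ x. cnj (f x)) \<in> ?S"
  proof (rule smooth_family_coinduct[where \<C> = "{\<lambda>i x. cnj (G i x) |G. G \<in> ?S}",
        OF open_UNIV cong_closed_rapid])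
    show "(\<lambda>_ x. cnj (f x)) \<in> {\<lambda>i x. cnj (G i x) |G. G \<in> ?S}"
      using assms by (intro CollectI exI[of _ "\<lambda>_. f"] conjI refl) (simp add: schwartz_iff)
    fix H :: "unit \<Rightarrow> 'a \<Rightarrow> complex"
    assume "H \<in> {\<lambda>i x. cnj (G i x) |G. G \<in> ?S}"
    then obtain G where G: "G \<in> ?S" and H: "H = (\<lambda>i x. cnj (G i x))" by blast
    show "H \<in> rapid {()} UNIV (\<lambda>x. 1 + norm x) (\<lambda>_ _. 1)"
      using smooth_family_base[OF G] by (simp add: rapid_def H)
    show "\<exists>F'. (\<forall>b\<in>Basis. F' b \<in> {\<lambda>i x. cnj (G i x) |G. G \<in> ?S}) \<and> gradient_on {()} UNIV H F'"
    proof (intro exI[of _ "\<lambda>b i x. cnj (pderiv_dir b (G i) x)"] conjI ballI gradient_onI)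
      fix b :: 'a assume b: "b \<in> Basis"
      show "(\<lambda>i x. cnj (pderiv_dir b (G i) x)) \<in> {\<lambda>i x. cnj (G i x) |G. G \<in> ?S}"
        by (intro CollectI exI[of _ "\<lambda>i. pderiv_dir b (G i)"] conjI refl smooth_family_pderiv_dir[OF G b])
    next
      fix i :: unit and x
      show "(H i has_derivative (\<lambda>v. \<Sum>b\<in>Basis. (v \<bullet> b) *\<^sub>R cnj (pderiv_dir b (G i) x))) (at x)"
        using has_derivative_cnj[OF has_derivative_pderiv_dir[OF
              schwartz_differentiable[OF schwartz_family_member[OF G, of i]]], of x]
        unfolding H by simp
    qed
  qed
  then show ?thesis by (simp add: schwartz_iff)
qed

lemma schwartz_multiplier:
  fixes I :: "'i set" and f :: "'a::euclidean_space \<Rightarrow> complex"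
  assumes "f \<in> schwartz"
  shows "(\<lambda>_. f) \<in> multiplier_family I"
proof -
  have "(\<lambda>_. f) \<in> schwartz_family I (\<lambda>_ _. 1)" by (rule schwartz_constant_family[OF assms])
  then show ?thesis
  proof (rule smooth_family_mono)
    show "rapid I UNIV (\<lambda>x::'a. 1 + norm x) (\<lambda>_ _. 1) \<subseteq> moderate I UNIV (\<lambda>x. 1 + norm x)"
    proof
      fix F :: "'i \<Rightarrow> 'a \<Rightarrow> complex" assume "F \<in> rapid I UNIV (\<lambda>x. 1 + norm x) (\<lambda>_ _. 1)"
      then have "\<exists>k C. \<forall>i\<in>I. \<forall>x\<in>UNIV. (1 + norm x) ^ 0 * norm (F i x) \<le> C * 1"
        unfolding rapid_def by blast
      then obtain C where "\<And>i x. i \<in> I \<Longrightarrow> norm (F i x) \<le> C" by auto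
      then show "F \<in> moderate I UNIV (\<lambda>x. 1 + norm x)"
        by (intro moderateI[where C = C and k = 0]) auto
    qed
  qed auto
qed

lemma integral_dilate:
  fixes f :: "'a::euclidean_space \<Rightarrow> complex"
  assumes f: "integrable lborel f" and c: "c \<noteq> 0"
  shows "(\<integral>x. f x \<partial>lborel) = of_real (\<bar>c\<bar> ^ DIM('a)) * (\<integral>x. f (c *\<^sub>R x) \<partial>lborel)"
proof -
  have [measurable]: "f \<in> borel_measurable borel" using f by auto
  have "(\<integral>x. f x \<partial>lborel) = (\<integral>x. f x \<partial>density (distr lborel borel (\<lambda>x. 0 + c *\<^sub>R x)) (\<lambda>_. \<bar>c\<bar> ^ DIM('a)))"
    using lborel_affine[OF c, of "0::'a"] by simp
  also have "\<dots> = (\<integral>x. \<bar>c\<bar> ^ DIM('a) *\<^sub>R f x \<partial>distr lborel borel (\<lambda>x. 0 + c *\<^sub>R x))"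
    by (intro integral_density) auto
  also have "\<dots> = (\<integral>x. \<bar>c\<bar> ^ DIM('a) *\<^sub>R f (c *\<^sub>R x) \<partial>lborel)"
    by (subst integral_distr) auto
  finally show ?thesis by (simp add: scaleR_conv_of_real)
qed

lemma integral_reflect_lborel:
  fixes f :: "'a::euclidean_space \<Rightarrow> complex"
  assumes "integrable lborel f"
  shows "(\<integral>x. f (- x) \<partial>lborel) = (\<integral>x. f x \<partial>lborel)"
  using integral_dilate[OF assms, of "-1"] by simp

lemma schwartz_bounded:
  assumes "f \<in> schwartz"
  obtains C where "C \<ge> 0" "\<And>x. norm (f x) \<le> C"
  using schwartz_decay[OF assms, of 0] by auto

text \<open>For the dilate \<open>f (e x)\<close> the multiplication formula says that the integral of
  \<open>fourier f \<xi> * \<psi> (e \<xi>)\<close> equals that of \<open>f (e x) * fourier \<psi> x\<close>. In the limit \<open>e \<rightarrow> 0\<close> the dilated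
  factors become constant. Thus integration of the transform is, up to a factor that does not
  depend on \<open>f\<close>, evaluation of \<open>f\<close> at the origin.\<close>

lemma integral_fourier_eq_value_at_0:
  fixes f \<psi> :: "'a::euclidean_space \<Rightarrow> complex"
  assumes f: "f \<in> schwartz" and \<psi>: "\<psi> \<in> schwartz"
  shows "(\<integral>\<xi>. fourier f \<xi> \<partial>lborel) * \<psi> 0 = f 0 * (\<integral>\<xi>. fourier \<psi> \<xi> \<partial>lborel)"
proof -
  define e where "e n = inverse (real (Suc n))" for n
  have e: "e n > 0" for n by (simp add: e_def)
  have e0: "e \<longlonglongrightarrow> 0" unfolding e_def by (rule LIMSEQ_inverse_real_of_nat)
  have lim0: "(\<lambda>n. g (e n *\<^sub>R x)) \<longlonglongrightarrow> g 0" if "g \<in> schwartz" for g :: "'a \<Rightarrow> complex" and x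
  proof -
    have "(\<lambda>n. e n *\<^sub>R x) \<longlonglongrightarrow> 0 *\<^sub>R x" by (intro tendsto_intros e0)
    moreover have "isCont g 0"
      using differentiable_imp_continuous_within[OF schwartz_differentiable[OF that]] .
    ultimately show ?thesis using isCont_tendsto_compose by fastforce
  qed
  have Ff: "fourier f \<in> schwartz" and F\<psi>: "fourier \<psi> \<in> schwartz"
    by (intro fourier_schwartz f \<psi>)+
  have eq: "(\<integral>\<xi>. fourier f \<xi> * \<psi> (e n *\<^sub>R \<xi>) \<partial>lborel) = (\<integral>x. f (e n *\<^sub>R x) * fourier \<psi> x \<partial>lborel)" for n
  proof -
    define d where "d = complex_of_real (e n ^ DIM('a))"
    have d: "d \<noteq> 0" using e[of n] by (simp add: d_def)
    have fe: "(\<lambda>x. f (e n *\<^sub>R x)) \<in> schwartz" using schwartz_affine[OF f, of "e n" 0] e[of n] by simp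
    have dil: "fourier f (\<xi> /\<^sub>R e n) = d * fourier (\<lambda>x. f (e n *\<^sub>R x)) \<xi>" for \<xi>
    proof -
      have "fourier f (\<xi> /\<^sub>R e n) = of_real (\<bar>e n\<bar> ^ DIM('a)) *
          (\<integral>x. exp (- \<i> * of_real ((e n *\<^sub>R x) \<bullet> (\<xi> /\<^sub>R e n))) * f (e n *\<^sub>R x) \<partial>lborel)"
        unfolding fourier_def by (rule integral_dilate[OF fourier_integrable[OF f]]) (use e[of n] in simp)
      moreover have "(e n *\<^sub>R x) \<bullet> (\<xi> /\<^sub>R e n) = x \<bullet> \<xi>" for x using e[of n] by simp
      ultimately show ?thesis using e[of n] by (simp only: fourier_def d_def abs_of_pos)
    qed
    have "integrable lborel (\<lambda>\<xi>. fourier f (\<xi> /\<^sub>R e n) * \<psi> \<xi>)"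
      using schwartz_integrable[OF schwartz_mult[OF schwartz_multiplier[OF
            schwartz_affine[OF Ff, of "inverse (e n)" 0]] \<psi>]] e[of n] by simp
    from integral_dilate[OF this, of "e n"] e[of n]
    have "(\<integral>\<xi>. fourier f (\<xi> /\<^sub>R e n) * \<psi> \<xi> \<partial>lborel) = d * (\<integral>\<xi>. fourier f \<xi> * \<psi> (e n *\<^sub>R \<xi>) \<partial>lborel)"
      by (simp add: d_def)
    moreover have "(\<integral>\<xi>. fourier f (\<xi> /\<^sub>R e n) * \<psi> \<xi> \<partial>lborel) = d * (\<integral>\<xi>. fourier (\<lambda>x. f (e n *\<^sub>R x)) \<xi> * \<psi> \<xi> \<partial>lborel)"
      unfolding dil by (simp add: mult.assoc)
    ultimately have "(\<integral>\<xi>. fourier f \<xi> * \<psi> (e n *\<^sub>R \<xi>) \<partial>lborel) = (\<integral>\<xi>. fourier (\<lambda>x. f (e n *\<^sub>R x)) \<xi> * \<psi> \<xi> \<partial>lborel)"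
      using d by simp
    then show ?thesis by (simp add: fourier_multiplication_formula[OF fe \<psi>])
  qed
  have lim: "(\<lambda>n. \<integral>x. g x * h (e n *\<^sub>R x) \<partial>lborel) \<longlonglongrightarrow> (\<integral>x. g x \<partial>lborel) * h 0"
    if g: "g \<in> schwartz" and h: "h \<in> schwartz" for g h :: "'a \<Rightarrow> complex"
  proof -
    note [measurable] = schwartz_borel[OF g] schwartz_borel[OF h]
    obtain C where C: "C \<ge> 0" "\<And>x. norm (h x) \<le> C" using schwartz_bounded[OF h] by metis
    have "(\<lambda>n. \<integral>x. g x * h (e n *\<^sub>R x) \<partial>lborel) \<longlonglongrightarrow> (\<integral>x. g x * h 0 \<partial>lborel)"
    proof (rule integral_dominated_convergence[where w = "\<lambda>x. norm (g x) * C"])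
      show "integrable lborel (\<lambda>x. norm (g x) * C)"
        by (intro integrable_mult_left integrable_norm schwartz_integrable g)
      show "AE x in lborel. (\<lambda>n. g x * h (e n *\<^sub>R x)) \<longlonglongrightarrow> g x * h 0"
        by (intro always_eventually allI tendsto_intros lim0 h)
      show "AE x in lborel. norm (g x * h (e n *\<^sub>R x)) \<le> norm (g x) * C" for n
        unfolding norm_mult by (intro always_eventually allI mult_left_mono C) auto
    qed measurable
    then show ?thesis by simp
  qed
  have "(\<lambda>n. \<integral>x. f (e n *\<^sub>R x) * fourier \<psi> x \<partial>lborel) \<longlonglongrightarrow> (\<integral>x. fourier f x \<partial>lborel) * \<psi> 0"
    using lim[OF Ff \<psi>] by (simp add: eq)
  moreover have "(\<lambda>n. \<integral>x. f (e n *\<^sub>R x) * fourier \<psi> x \<partial>lborel) \<longlonglongrightarrow> f 0 * (\<integral>x. fourier \<psi> x \<partial>lborel)"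
    using lim[OF F\<psi> f] by (simp add: mult.commute)
  ultimately show ?thesis by (rule LIMSEQ_unique)
qed

lemma fourier_translate:
  fixes f :: "'a::euclidean_space \<Rightarrow> complex"
  assumes f: "f \<in> schwartz"
  shows "fourier (\<lambda>x. f (x + y)) \<xi> = exp (\<i> * of_real (y \<bullet> \<xi>)) * fourier f \<xi>"
proof -
  note [measurable] = schwartz_borel[OF f]
  let ?h = "\<lambda>x. exp (- \<i> * of_real ((x - y) \<bullet> \<xi>)) * f x"
  have "fourier (\<lambda>x. f (x + y)) \<xi> = (\<integral>x. ?h (x + y) \<partial>lborel)" by (simp add: fourier_def)
  also have "\<dots> = (\<integral>x. ?h x \<partial>lborel)" by (rule integral_translate(1)) measurable
  also have "\<dots> = (\<integral>x. exp (\<i> * of_real (y \<bullet> \<xi>)) * (exp (- \<i> * of_real (x \<bullet> \<xi>)) * f x) \<partial>lborel)"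
    by (intro Bochner_Integration.integral_cong)
      (auto simp: inner_diff_left algebra_simps simp flip: exp_add mult.assoc)
  finally show ?thesis by (simp add: fourier_def)
qed

text \<open>Apply the preceding identity to a translate of \<open>f\<close>, which becomes a character on the other side.\<close>

lemma fourier_fourier:
  fixes f \<psi> :: "'a::euclidean_space \<Rightarrow> complex"
  assumes f: "f \<in> schwartz" and \<psi>: "\<psi> \<in> schwartz" "\<psi> 0 = 1"
  shows "fourier (fourier f) x = (\<integral>\<xi>. fourier \<psi> \<xi> \<partial>lborel) * f (- x)"
proof -
  have "(\<lambda>z. f (z + - x)) \<in> schwartz" using schwartz_affine[OF f, of 1 "- x"] by simp
  from integral_fourier_eq_value_at_0[OF this \<psi>(1)]
  have "(\<integral>\<xi>. fourier (\<lambda>z. f (z + - x)) \<xi> \<partial>lborel) = f (- x) * (\<integral>\<xi>. fourier \<psi> \<xi> \<partial>lborel)"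
    using \<psi>(2) by simp
  then show ?thesis
    unfolding fourier_translate[OF f] by (simp add: fourier_def[of "fourier f"] inner_commute mult.commute)
qed

lemma of_real_norm_mult_cnj: "complex_of_real (norm (z * cnj z)) = z * cnj z"
proof -
  have "norm (z * cnj z) = (norm z)\<^sup>2" by (simp add: norm_mult power2_eq_square)
  then show ?thesis by (simp only: complex_norm_square)
qed

lemma continuous_integral_norm_eq_0:
  fixes g :: "'a::euclidean_space \<Rightarrow> complex"
  assumes cont: "continuous_on UNIV g" and int: "integrable lborel g"
    and zero: "(\<integral>x. norm (g x) \<partial>lborel) = 0"
  shows "g x = 0"
proof -
  have "AE x in lborel. norm (g x) = 0"
    using zero integral_nonneg_eq_0_iff_AE[OF integrable_norm[OF int]] by simp
  then have "AE x in lborel. x \<notin> {x. g x \<noteq> 0}" by simp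
  moreover have op: "open {x. g x \<noteq> 0}"
    by (intro open_Collect_neq cont continuous_intros)
  ultimately have "{x. g x \<noteq> 0} \<in> null_sets lborel"
    by (subst AE_iff_null_sets) auto
  then have "negligible {x. g x \<noteq> 0}"
    by (simp add: negligible_iff_null_sets null_sets_completionI)
  then show ?thesis using open_not_negligible[OF op] by blast
qed

text \<open>Otherwise the transform would vanish when applied twice. The conjugate of \<open>fourier f\<close> is itself a
  transform, so the multiplication formula would give \<open>fourier f\<close> the \<open>L\<^sup>2\<close> norm zero for every \<open>f\<close>;
  but the transform of \<open>|\<psi>|\<^sup>2\<close> is positive at the origin.\<close>

lemma fourier_constant_nonzero:
  fixes \<psi> :: "'a::euclidean_space \<Rightarrow> complex"
  assumes \<psi>: "\<psi> \<in> schwartz" "\<psi> 0 = 1"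
  shows "(\<integral>\<xi>. fourier \<psi> \<xi> \<partial>lborel) \<noteq> 0"
proof
  assume 0: "(\<integral>\<xi>. fourier \<psi> \<xi> \<partial>lborel) = 0"
  have ff: "fourier (fourier f) x = 0" if "f \<in> schwartz" for f :: "'a \<Rightarrow> complex" and x
    using fourier_fourier[OF that \<psi>] 0 by simp
  have Ff: "fourier f \<xi> = 0" if f: "f \<in> schwartz" for f :: "'a \<Rightarrow> complex" and \<xi>
  proof -
    let ?h = "\<lambda>x. cnj (f (- x))"
    have h: "?h \<in> schwartz" by (intro schwartz_cnj schwartz_reflect f)
    have Fh: "fourier ?h \<xi> = cnj (fourier f \<xi>)" for \<xi>
    proof -
      have "cnj (fourier f \<xi>) = (\<integral>x. cnj (exp (- \<i> * of_real (x \<bullet> \<xi>)) * f x) \<partial>lborel)"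
        unfolding fourier_def by (simp only: Bochner_Integration.integral_cnj)
      also have "\<dots> = (\<integral>x. cnj (exp (- \<i> * of_real (- x \<bullet> \<xi>)) * f (- x)) \<partial>lborel)"
        using fourier_integrable[OF f, of \<xi>]
        by (intro integral_reflect_lborel[symmetric]) (simp only: complex_integrable_cnj)
      finally show ?thesis by (simp add: fourier_def exp_cnj)
    qed
    have g: "fourier ?h \<in> schwartz" by (rule fourier_schwartz[OF h])
    have Ffs: "fourier f \<in> schwartz" by (rule fourier_schwartz[OF f])
    have prod: "(\<lambda>\<xi>. fourier f \<xi> * fourier ?h \<xi>) \<in> schwartz"
      by (intro schwartz_mult schwartz_multiplier g Ffs)
    have "of_real (\<integral>\<xi>. norm (fourier f \<xi> * fourier ?h \<xi>) \<partial>lborel) = (\<integral>\<xi>. fourier f \<xi> * fourier ?h \<xi> \<partial>lborel)"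
      unfolding integral_complex_of_real[symmetric]
      by (intro Bochner_Integration.integral_cong)
        (auto simp only: Fh of_real_norm_mult_cnj)
    also have "\<dots> = (\<integral>x. f x * fourier (fourier ?h) x \<partial>lborel)"
      by (rule fourier_multiplication_formula[OF f g])
    also have "\<dots> = 0" by (simp add: ff[OF h])
    finally have "(\<integral>\<xi>. norm (fourier f \<xi> * fourier ?h \<xi>) \<partial>lborel) = 0" by simp
    from continuous_integral_norm_eq_0[OF schwartz_continuous[OF prod] schwartz_integrable[OF prod] this]
    show ?thesis by (simp add: Fh)
  qed
  have p: "(\<lambda>x. cnj (\<psi> x) * \<psi> x) \<in> schwartz"
    by (intro schwartz_mult schwartz_multiplier schwartz_cnj \<psi>)
  have "of_real (\<integral>x. norm (cnj (\<psi> x) * \<psi> x) \<partial>lborel) = (\<integral>x. cnj (\<psi> x) * \<psi> x \<partial>lborel)"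
    unfolding integral_complex_of_real[symmetric]
    by (intro Bochner_Integration.integral_cong)
      (auto simp only: of_real_norm_mult_cnj mult.commute[of "cnj _"])
  also have "\<dots> = fourier (\<lambda>x. cnj (\<psi> x) * \<psi> x) 0" by (simp add: fourier_def)
  also have "\<dots> = 0" by (rule Ff[OF p])
  finally have "(\<integral>x. norm (cnj (\<psi> x) * \<psi> x) \<partial>lborel) = 0" by simp
  from continuous_integral_norm_eq_0[OF schwartz_continuous[OF p] schwartz_integrable[OF p] this, of 0]
  show False using \<psi>(2) by simp
qed

text \<open>The image of the Lizorkin space under the Fourier transform.\<close>

definition flat_schwartz :: "('a::euclidean_space \<Rightarrow> complex) set"
  where "flat_schwartz = {f \<in> schwartz. \<forall>bs\<in>lists Basis. pderivs bs f 0 = 0}"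

lemma pderivs_fourier:
  fixes f :: "'a::euclidean_space \<Rightarrow> complex"
  assumes f: "f \<in> schwartz" and bs: "bs \<in> lists Basis"
  shows "(\<lambda>x. (\<Prod>b\<leftarrow>bs. - \<i> * of_real (x \<bullet> b)) * f x) \<in> schwartz \<and>
    pderivs bs (fourier f) = fourier (\<lambda>x. (\<Prod>b\<leftarrow>bs. - \<i> * of_real (x \<bullet> b)) * f x)"
  using bs
proof (induction bs)
  case Nil
  then show ?case using f by simp
next
  case (Cons b bs)
  let ?g = "\<lambda>x. (\<Prod>b\<leftarrow>bs. - \<i> * of_real (x \<bullet> b)) * f x"
  from Cons have g: "?g \<in> schwartz" "pderivs bs (fourier f) = fourier ?g" by auto
  have s: "(\<lambda>x. of_real (x \<bullet> b) * ?g x) \<in> schwartz"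
    by (intro schwartz_mult coordinate_multiplier g Cons.hyps)
  have "pderiv_dir b (fourier ?g) = fourier (\<lambda>x. (- \<i>) * (of_real (x \<bullet> b) * ?g x))"
    by (rule ext, rule pderiv_dir_eqI[OF fourier_has_derivative[OF g(1)] Cons.hyps(1)])
  moreover have "(\<lambda>x. (- \<i>) * (of_real (x \<bullet> b) * ?g x)) \<in> schwartz"
    using schwartz_linear[OF s s, of "- \<i>" 0] by simp
  ultimately show ?case using g(2) by (simp add: mult.assoc)
qed

text \<open>Up to powers of \<open>- \<i>\<close> the derivatives of the transform at the origin are the moments; a word and
  a multi-index correspond if the multi-index counts the letters.\<close>

lemma lizorkin_iff: "f \<in> lizorkin \<longleftrightarrow> f \<in> schwartz \<and> fourier f \<in> flat_schwartz"
proof (cases "f \<in> schwartz")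
  case True
  have at0: "pderivs bs (fourier f) 0 = (- \<i>) ^ length bs * (\<integral>x. of_real (\<Prod>b\<leftarrow>bs. x \<bullet> b) * f x \<partial>lborel)"
    if "bs \<in> lists Basis" for bs
  proof -
    have "(\<Prod>b\<leftarrow>bs. - \<i> * of_real (x \<bullet> b)) = (- \<i>) ^ length bs * of_real (\<Prod>b\<leftarrow>bs. x \<bullet> b)" for x
      by (induction bs) (auto simp: algebra_simps)
    then have "pderivs bs (fourier f) 0 = (\<integral>x. (- \<i>) ^ length bs * (of_real (\<Prod>b\<leftarrow>bs. x \<bullet> b) * f x) \<partial>lborel)"
      using pderivs_fourier[OF True that] by (simp add: fourier_def mult.assoc)
    then show ?thesis by simp
  qed
  have "(\<forall>\<alpha>::'a\<Rightarrow>nat. (\<integral>x. of_real (\<Prod>b\<in>Basis. (x \<bullet> b) ^ \<alpha> b) * f x \<partial>lborel) = 0) \<longleftrightarrow>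
      (\<forall>bs\<in>lists Basis. (\<integral>x. of_real (\<Prod>b\<leftarrow>bs. x \<bullet> b) * f x \<partial>lborel) = 0)"
  proof (intro iffI ballI allI)
    fix bs :: "'a list" assume "bs \<in> lists Basis"
    then have "(\<Prod>b\<leftarrow>bs. x \<bullet> b) = (\<Prod>b\<in>Basis. (x \<bullet> b) ^ count_list bs b)" for x
    proof (induction bs)
      case (Cons c bs)
      have "(\<Prod>b\<in>Basis. (x \<bullet> b) ^ count_list (c # bs) b)
          = (\<Prod>b\<in>Basis. (if b = c then x \<bullet> c else 1) * (x \<bullet> b) ^ count_list bs b)"
        by (intro prod.cong) auto
      also have "\<dots> = (\<Prod>b\<in>Basis. if b = c then x \<bullet> c else 1) * (\<Prod>b\<in>Basis. (x \<bullet> b) ^ count_list bs b)"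
        by (rule prod.distrib)
      also have "(\<Prod>b\<in>Basis. if b = c then x \<bullet> c else 1) = x \<bullet> c"
        using Cons.hyps by (simp add: prod.delta)
      finally show ?case using Cons by simp
    qed auto
    moreover assume "\<forall>\<alpha>::'a\<Rightarrow>nat. (\<integral>x. of_real (\<Prod>b\<in>Basis. (x \<bullet> b) ^ \<alpha> b) * f x \<partial>lborel) = 0"
    ultimately show "(\<integral>x. of_real (\<Prod>b\<leftarrow>bs. x \<bullet> b) * f x \<partial>lborel) = 0" by simp
  next
    fix \<alpha> :: "'a \<Rightarrow> nat"
    assume all: "\<forall>bs\<in>lists Basis. (\<integral>x. of_real (\<Prod>b\<leftarrow>bs. x \<bullet> b) * f x \<partial>lborel) = 0"
    obtain xs :: "'a list" where xs: "set xs = Basis" "distinct xs"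
      using finite_distinct_list[OF finite_Basis] by metis
    let ?bs = "concat (map (\<lambda>b. replicate (\<alpha> b) b) xs)"
    have "(\<Prod>b\<leftarrow>?bs. x \<bullet> b) = (\<Prod>b\<leftarrow>xs. (x \<bullet> b) ^ \<alpha> b)" for x
      by (induction xs) (auto simp: map_replicate)
    also have "(\<Prod>b\<leftarrow>xs. (x \<bullet> b) ^ \<alpha> b) = (\<Prod>b\<in>Basis. (x \<bullet> b) ^ \<alpha> b)" for x
      using prod.distinct_set_conv_list[OF xs(2), of "\<lambda>b. (x \<bullet> b) ^ \<alpha> b"] xs(1) by simp
    finally show "(\<integral>x. of_real (\<Prod>b\<in>Basis. (x \<bullet> b) ^ \<alpha> b) * f x \<partial>lborel) = 0"
      using all[rule_format, of ?bs] xs(1) by (auto simp: in_lists_conv_set)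
  qed
  then show ?thesis
    using True fourier_schwartz[OF True] at0
    by (auto simp: lizorkin_def flat_schwartz_def)
next
  case False
  then show ?thesis by (simp add: lizorkin_def)
qed

section \<open>Functions that are flat at the origin\<close>

text \<open>Comparable to \<open>1/|x|\<close> near the origin and to \<open>|x|\<close> near infinity, so that its powers measure
  the order of vanishing at the origin and the decay at infinity simultaneously.\<close>

definition origin_weight :: "'a::real_normed_vector \<Rightarrow> real"
  where "origin_weight x = norm x + 1 / norm x"

abbreviation punctured :: "'a::euclidean_space set"
  where "punctured \<equiv> - {0}"

lemma open_punctured [simp]: "open (punctured :: 'a::euclidean_space set)"
  by auto

lemma origin_weight_bounds:
  assumes "x \<noteq> 0"
  shows "norm x \<le> origin_weight x" "1 / norm x \<le> origin_weight x" "1 \<le> origin_weight x"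
    "1 + norm x \<le> 2 * origin_weight x"
proof -
  show *: "norm x \<le> origin_weight x" "1 / norm x \<le> origin_weight x"
    by (auto simp: origin_weight_def)
  show **: "1 \<le> origin_weight x"
  proof (cases "norm x \<ge> 1")
    case True
    with * show ?thesis by linarith
  next
    case False
    then have "1 \<le> 1 / norm x" using assms by (simp add: field_simps)
    with * show ?thesis by linarith
  qed
  from * ** show "1 + norm x \<le> 2 * origin_weight x" by linarith
qed

lemma weight_on_origin [simp]: "0 \<notin> S \<Longrightarrow> weight_on S origin_weight"
  unfolding weight_on_def by (metis origin_weight_bounds(3))

lemma flat_schwartzD:
  assumes "f \<in> flat_schwartz"
  shows "f \<in> schwartz" and "f 0 = 0"
proof -
  show "f \<in> schwartz" using assms by (simp add: flat_schwartz_def)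
  have "pderivs [] f 0 = 0" using assms lists.Nil unfolding flat_schwartz_def by blast
  then show "f 0 = 0" by simp
qed

lemma flat_pderivs:
  assumes "f \<in> flat_schwartz" "bs \<in> lists Basis"
  shows "pderivs bs f \<in> flat_schwartz"
proof -
  have "pderivs cs (pderivs bs f) 0 = 0" if "cs \<in> lists Basis" for cs
    using assms that unfolding pderivs_append[symmetric] flat_schwartz_def by auto
  then show ?thesis
    using schwartz_pderivs[OF flat_schwartzD(1)[OF assms(1)] assms(2)] by (simp add: flat_schwartz_def)
qed

text \<open>The mean value inequality between the origin and \<open>x\<close> gains one power of \<open>|x|\<close> over the derivatives.\<close>

lemma flat_vanishing_order:
  fixes f :: "'a::euclidean_space \<Rightarrow> complex"
  assumes "f \<in> flat_schwartz"
  shows "\<exists>C\<ge>0. \<forall>x. norm x \<le> 1 \<longrightarrow> norm (f x) \<le> C * norm x ^ N"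
  using assms
proof (induction N arbitrary: f)
  case 0
  then show ?case using schwartz_bounded[OF flat_schwartzD(1)] by (metis mult.right_neutral power_0)
next
  case (Suc N)
  have "pderiv_dir b f \<in> flat_schwartz" if "b \<in> Basis" for b
    using flat_pderivs[OF Suc.prems, of "[b]"] that by simp
  then have "\<exists>C\<ge>0. \<forall>x. norm x \<le> 1 \<longrightarrow> norm (pderiv_dir b f x) \<le> C * norm x ^ N" if "b \<in> Basis" for b
    using Suc.IH that by blast
  then obtain C where C: "\<And>b. b \<in> Basis \<Longrightarrow> C b \<ge> 0"
    "\<And>b x. b \<in> Basis \<Longrightarrow> norm x \<le> 1 \<Longrightarrow> norm (pderiv_dir b f x) \<le> C b * norm x ^ N" by metis
  define K where "K = (\<Sum>b\<in>Basis. C b)"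
  have K: "0 \<le> K" "\<And>b. b \<in> Basis \<Longrightarrow> C b \<le> K"
    unfolding K_def using C(1) by (auto intro: sum_nonneg member_le_sum)
  have "norm (f x) \<le> (real DIM('a) * K) * norm x ^ Suc N" if x: "norm x \<le> 1" for x
  proof -
    have "norm (f x - f 0) \<le> (real DIM('a) * (K * norm x ^ N)) * norm (x - 0)"
    proof (rule differentiable_bound[where S = "cball 0 (norm x)"])
      fix y :: 'a assume y: "y \<in> cball 0 (norm x)"
      show "(f has_derivative (\<lambda>v. \<Sum>b\<in>Basis. (v \<bullet> b) *\<^sub>R pderiv_dir b f y)) (at y within cball 0 (norm x))"
        by (rule has_derivative_at_withinI[OF has_derivative_pderiv_dir[OF
              schwartz_differentiable[OF flat_schwartzD(1)[OF Suc.prems]]]])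
      show "onorm (\<lambda>v. \<Sum>b\<in>Basis. (v \<bullet> b) *\<^sub>R pderiv_dir b f y) \<le> real DIM('a) * (K * norm x ^ N)"
      proof (intro onorm_le norm_sum_coordinates_le)
        fix b :: 'a assume b: "b \<in> Basis"
        have "norm (pderiv_dir b f y) \<le> C b * norm y ^ N" using C(2)[OF b] x y by simp
        also have "\<dots> \<le> K * norm x ^ N"
          using y K b C(1) by (intro mult_mono power_mono) auto
        finally show "norm (pderiv_dir b f y) \<le> K * norm x ^ N" .
      qed
    qed auto
    then show ?thesis using flat_schwartzD(2)[OF Suc.prems] by (simp add: mult_ac)
  qed
  with K(1) show ?case by (intro exI[of _ "real DIM('a) * K"]) auto
qed

lemma flat_rapid:
  fixes f :: "'a::euclidean_space \<Rightarrow> complex"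
  assumes f: "f \<in> flat_schwartz"
  shows "(\<lambda>_. f) \<in> smooth_family {()} punctured (rapid {()} punctured origin_weight (\<lambda>_ _. 1))"
  unfolding smooth_family_def
proof (intro CollectI ballI conjI rapidI)
  fix bs :: "'a list" assume bs: "bs \<in> lists Basis"
  note g = flat_pderivs[OF f bs]
  show "pderivs bs f differentiable at x" for x
    by (rule schwartz_differentiable[OF flat_schwartzD(1)[OF g]])
  fix N
  obtain C where C: "C \<ge> 0" "\<And>x. (1 + norm x) ^ N * norm (pderivs bs f x) \<le> C"
    using schwartz_decay[OF flat_schwartzD(1)[OF g]] by metis
  obtain D where D: "D \<ge> 0" "\<And>x. norm x \<le> 1 \<Longrightarrow> norm (pderivs bs f x) \<le> D * norm x ^ N"
    using flat_vanishing_order[OF g] by metis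
  have "origin_weight x ^ N * norm (pderivs bs f x) \<le> 2 ^ N * (C + D)" if x: "x \<noteq> 0" for x
  proof (cases "norm x \<le> 1")
    case True
    have "origin_weight x \<le> 2 / norm x"
      using True x mult_mono[OF True True] by (simp add: origin_weight_def field_simps)
    then have "origin_weight x ^ N * norm (pderivs bs f x) \<le> (2 / norm x) ^ N * (D * norm x ^ N)"
      using origin_weight_bounds(3)[OF x] D(2)[OF True] D(1)
      by (intro mult_mono power_mono) auto
    also have "\<dots> = 2 ^ N * D" using x by (simp add: power_divide)
    also have "\<dots> \<le> 2 ^ N * (C + D)" using C(1) by (intro mult_left_mono) auto
    finally show ?thesis .
  next
    case False
    then have "1 / norm x \<le> 1" by (simp add: divide_le_eq)
    then have "origin_weight x \<le> norm x + 1" by (simp add: origin_weight_def)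
    also have "\<dots> \<le> 2 * (1 + norm x)" by simp
    finally have "origin_weight x \<le> 2 * (1 + norm x)" .
    then have "origin_weight x ^ N * norm (pderivs bs f x) \<le> (2 * (1 + norm x)) ^ N * norm (pderivs bs f x)"
      using origin_weight_bounds(3)[OF x] by (intro mult_right_mono power_mono) auto
    also have "\<dots> = 2 ^ N * ((1 + norm x) ^ N * norm (pderivs bs f x))"
      by (simp only: power_mult_distrib mult.assoc)
    also have "\<dots> \<le> 2 ^ N * (C + D)" using C(2)[of x] D(1) by (intro mult_left_mono) auto
    finally show ?thesis .
  qed
  then show "\<exists>(k::nat) C. \<forall>i\<in>{()}. \<forall>x\<in>punctured. origin_weight x ^ N * norm (pderivs bs f x) \<le> C * 1"
    by (intro exI[of _ 0] exI[of _ "2 ^ N * (C + D)"]) auto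
qed

lemma has_derivative_zero_quadratic:
  fixes f :: "'a::euclidean_space \<Rightarrow> complex"
  assumes "f 0 = 0" "\<And>x. norm (f x) \<le> C * norm x ^ 2"
  shows "(f has_derivative (\<lambda>v. 0)) (at 0)"
  unfolding has_derivative_within
proof
  show "((\<lambda>y. (1 / norm (y - 0)) *\<^sub>R (f y - (f 0 + 0))) \<longlongrightarrow> 0) (at 0)"
  proof (rule Lim_null_comparison)
    show "\<forall>\<^sub>F x in at 0. norm ((1 / norm (x - 0)) *\<^sub>R (f x - (f 0 + 0))) \<le> C * norm x"
    proof (intro always_eventually allI)
      fix x :: 'a
      show "norm ((1 / norm (x - 0)) *\<^sub>R (f x - (f 0 + 0))) \<le> C * norm x"
        using assms(1) assms(2)[of x] by (cases "x = 0") (auto simp: field_simps power2_eq_square)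
    qed
    have "((\<lambda>x::'a. C * norm x) \<longlongrightarrow> C * norm (0::'a)) (at 0)" by (intro tendsto_intros)
    then show "((\<lambda>x::'a. C * norm x) \<longlongrightarrow> 0) (at 0)" by simp
  qed
qed auto

text \<open>What has to be shown is smoothness at the origin. Every derivative is \<open>O(|x|\<^sup>2)\<close> there, so its
  extension by zero is differentiable at the origin with derivative zero: the extensions by
  zero are a class closed under differentiation.\<close>

lemma flat_schwartzI_rapid:
  fixes f :: "'a::euclidean_space \<Rightarrow> complex"
  assumes f0: "f 0 = 0"
    and f: "(\<lambda>_. f) \<in> smooth_family {()} punctured (rapid {()} punctured origin_weight (\<lambda>_ _. 1))"
  shows "f \<in> flat_schwartz"
proof -
  let ?R = "rapid {()} punctured origin_weight (\<lambda>_ _. 1) :: (unit \<Rightarrow> 'a \<Rightarrow> complex) set"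
  let ?S = "rapid {()} UNIV (\<lambda>x. 1 + norm x) (\<lambda>_ _. 1) :: (unit \<Rightarrow> 'a \<Rightarrow> complex) set"
  let ?B = "?S \<inter> {F. F () 0 = 0}"
  let ?C = "{F. F () 0 = 0 \<and> F \<in> smooth_family {()} punctured ?R}"
  have cong: "cong_closed {()} UNIV ?B"
    using cong_closed_rapid[of "{()}" UNIV] unfolding cong_closed_def by auto
  have "(\<lambda>_. f) \<in> smooth_family {()} UNIV ?B"
  proof (rule smooth_family_coinduct[OF open_UNIV cong])
    show "(\<lambda>_. f) \<in> ?C" using assms by simp
    fix F :: "unit \<Rightarrow> 'a \<Rightarrow> complex" assume "F \<in> ?C"
    then have F0: "F () 0 = 0" and F: "F \<in> smooth_family {()} punctured ?R" by auto
    have bound: "\<exists>C. \<forall>x. x \<noteq> 0 \<longrightarrow> origin_weight x ^ N * norm (F () x) \<le> C" for N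
    proof -
      have "F \<in> ?R" by (rule smooth_family_base[OF F])
      then have "\<exists>k C. \<forall>i\<in>{()}. \<forall>x\<in>punctured. origin_weight x ^ N * norm (F i x) \<le> C * 1"
        unfolding rapid_def by blast
      then show ?thesis by auto
    qed
    have "F \<in> ?S"
    proof (rule rapidI)
      fix N
      obtain C where C: "\<And>x. x \<noteq> 0 \<Longrightarrow> origin_weight x ^ N * norm (F () x) \<le> C"
        using bound by blast
      have "(1 + norm x) ^ N * norm (F () x) \<le> 2 ^ N * max C 0" for x
      proof (cases "x = 0")
        case False
        have "(1 + norm x) ^ N * norm (F () x) \<le> (2 * origin_weight x) ^ N * norm (F () x)"
          using origin_weight_bounds(4)[OF False] by (intro mult_right_mono power_mono) auto
        also have "\<dots> = 2 ^ N * (origin_weight x ^ N * norm (F () x))"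
          by (simp only: power_mult_distrib mult.assoc)
        also have "\<dots> \<le> 2 ^ N * max C 0" using C[OF False] by (intro mult_left_mono) auto
        finally show ?thesis .
      qed (simp add: F0)
      then show "\<exists>(k::nat) C. \<forall>i\<in>{()}. \<forall>x\<in>UNIV. (1 + norm x) ^ N * norm (F i x) \<le> C * 1"
        by (intro exI[of _ 0] exI[of _ "2 ^ N * max C 0"]) auto
    qed
    with F0 show "F \<in> ?B" by simp
    define F' where "F' b = (\<lambda>(_::unit) x. if x = 0 then 0 else pderiv_dir b (F ()) x)" for b
    have "F' b \<in> ?C" if b: "b \<in> Basis" for b
    proof -
      have "F' b \<in> smooth_family {()} punctured ?R"
        by (rule smooth_family_cong[OF open_punctured cong_closed_rapid smooth_family_pderiv_dir[OF F b]])
          (auto simp: F'_def)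
      then show ?thesis by (simp add: F'_def)
    qed
    moreover have "gradient_on {()} UNIV F F'"
    proof (rule gradient_onI)
      fix i :: unit and x :: 'a
      show "(F i has_derivative (\<lambda>v. \<Sum>b\<in>Basis. (v \<bullet> b) *\<^sub>R F' b i x)) (at x)"
      proof (cases "x = 0")
        case True
        obtain C where C: "\<And>x. x \<noteq> 0 \<Longrightarrow> origin_weight x ^ 2 * norm (F () x) \<le> C"
          using bound by blast
        have "norm (F () x) \<le> C * norm x ^ 2" for x
        proof (cases "x = 0")
          case False
          have "(1 / norm x) ^ 2 * norm (F () x) \<le> origin_weight x ^ 2 * norm (F () x)"
            using origin_weight_bounds(2)[OF False] by (intro mult_right_mono power_mono) auto
          also have "\<dots> \<le> C" by (rule C[OF False])
          finally show ?thesis using False by (simp add: power_divide field_simps)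
        qed (simp add: F0)
        from has_derivative_zero_quadratic[OF F0 this] show ?thesis
          using True by (simp add: F'_def)
      next
        case False
        have "F () differentiable at x" using smooth_familyD(2)[OF F, of "[]" "()" x] False by simp
        from has_derivative_pderiv_dir[OF this] False show ?thesis by (simp add: F'_def)
      qed
    qed
    ultimately show "\<exists>F'. (\<forall>b\<in>Basis. F' b \<in> ?C) \<and> gradient_on {()} UNIV F F'" by blast
  qed
  from smooth_familyD[OF this] show ?thesis
    unfolding flat_schwartz_def schwartz_iff smooth_family_def by auto
qed

text \<open>Multipliers such as the logarithm or \<open>x/|x|\<close> may be singular at the origin: flatness outweighs
  every power of \<open>origin_weight\<close>.\<close>

lemma flat_mult:
  fixes f h :: "'a::euclidean_space \<Rightarrow> complex"
  assumes m: "(\<lambda>_. m) \<in> smooth_family {()} punctured (moderate {()} punctured origin_weight)"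
    and f: "f \<in> flat_schwartz"
    and h: "h 0 = 0" "\<And>x. x \<noteq> 0 \<Longrightarrow> h x = m x * f x"
  shows "h \<in> flat_schwartz"
proof (rule flat_schwartzI_rapid)
  have "(\<lambda>_ x. m x * f x) \<in> smooth_family {()} punctured (rapid {()} punctured origin_weight (\<lambda>_ _. 1))"
    by (rule smooth_family_mult[OF _ cong_closed_rapid add_closed_rapid mult_into_rapid m flat_rapid[OF f]])
      auto
  then show "(\<lambda>_. h) \<in> smooth_family {()} punctured (rapid {()} punctured origin_weight (\<lambda>_ _. 1))"
    by (rule smooth_family_cong[OF open_punctured cong_closed_rapid]) (use h in auto)
qed (rule h)

text \<open>Since the derivative of \<open>1/m\<close> is \<open>- (1/m) (1/m)\<close> times that of \<open>m\<close>, adjoining \<open>1/m\<close> to the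
  moderate smooth families generates an algebra closed under differentiation.\<close>

lemma smooth_family_moderate_inverse:
  fixes m :: "'i \<Rightarrow> 'a::euclidean_space \<Rightarrow> complex"
  assumes S: "open S" and w: "weight_on S w" and m: "m \<in> smooth_family I S (moderate I S w)"
    and c: "0 < c" "\<And>i x. i \<in> I \<Longrightarrow> x \<in> S \<Longrightarrow> c \<le> norm (m i x)"
  shows "(\<lambda>i x. inverse (m i x)) \<in> smooth_family I S (moderate I S w)"
proof -
  let ?A = "smooth_family I S (moderate I S w)"
  let ?inv = "\<lambda>i x. inverse (m i x)"
  let ?G = "insert ?inv ?A"
  have inv: "?inv \<in> moderate I S w"
  proof (rule moderateI[where C = "1 / c" and k = 0])
    fix i x assume "i \<in> I" "x \<in> S"
    from le_imp_inverse_le[OF c(2)[OF this] c(1)]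
    show "norm (inverse (m i x)) \<le> 1 / c * w x ^ 0"
      by (simp add: norm_inverse flip: inverse_eq_divide)
  qed
  show ?thesis
  proof (rule generated_algebra_smooth_family[OF S cong_closed_moderate add_closed_moderate[OF w]
        mult_into_moderate[OF w]])
    show "?inv \<in> generated_algebra ?G" by (rule generated_algebra.generator[OF insertI1])
    show "?G \<subseteq> moderate I S w" using inv smooth_family_base[of _ I S "moderate I S w"] by (intro insert_subsetI subsetI)
    fix F assume "F \<in> ?G"
    then show "\<exists>F'. (\<forall>b\<in>Basis. F' b \<in> generated_algebra ?G) \<and> gradient_on I S F F'"
    proof
      assume F: "F \<in> ?A"
      show ?thesis
        using smooth_family_gradient[OF F] smooth_family_pderiv_dir[OF F]
        by (intro exI[of _ "\<lambda>b i. pderiv_dir b (F i)"]) (auto intro: generated_algebra.generator)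
    next
      assume F: "F = ?inv"
      show ?thesis
      proof (intro exI[of _ "\<lambda>b i x. (- 1) * (pderiv_dir b (m i) x * (?inv i x * ?inv i x))"] conjI ballI)
        fix b :: 'a assume b: "b \<in> Basis"
        have "(\<lambda>i x. - 1) \<in> ?A" by (rule const_smooth_family[OF S, of _ _ 1]) simp
        then have 1: "(\<lambda>i x. - 1) \<in> generated_algebra ?G"
          by (intro generated_algebra.generator insertI2)
        have 2: "(\<lambda>i. pderiv_dir b (m i)) \<in> generated_algebra ?G"
          using smooth_family_pderiv_dir[OF m b] by (intro generated_algebra.generator insertI2)
        have 3: "?inv \<in> generated_algebra ?G"
          by (rule generated_algebra.generator[OF insertI1])
        show "(\<lambda>i x. (- 1) * (pderiv_dir b (m i) x * (?inv i x * ?inv i x))) \<in> generated_algebra ?G"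
          by (rule generated_algebra.product[OF 1 generated_algebra.product[OF 2
                generated_algebra.product[OF 3 3]]])
      next
        show "gradient_on I S F (\<lambda>b i x. (- 1) * (pderiv_dir b (m i) x * (?inv i x * ?inv i x)))"
        proof (rule gradient_onI)
          fix i x assume ix: "i \<in> I" "x \<in> S"
          have "m i x \<noteq> 0" using c(2)[OF ix] c(1) by auto
          have "((\<lambda>x. inverse (m i x)) has_derivative
              (\<lambda>v. - (inverse (m i x) * (\<Sum>b\<in>Basis. (v \<bullet> b) *\<^sub>R pderiv_dir b (m i) x) * inverse (m i x)))) (at x)"
            by (rule Deriv.has_derivative_inverse[OF \<open>m i x \<noteq> 0\<close> gradient_onD[OF smooth_family_gradient[OF m] ix]])
          moreover have "- (inverse (m i x) * (\<Sum>b\<in>Basis. (v \<bullet> b) *\<^sub>R pderiv_dir b (m i) x) * inverse (m i x))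
              = (\<Sum>b\<in>Basis. (v \<bullet> b) *\<^sub>R ((- 1) * (pderiv_dir b (m i) x * (?inv i x * ?inv i x))))" for v
            unfolding sum_distrib_left sum_distrib_right sum_negf[symmetric]
            by (intro sum.cong refl) (simp add: scaleR_conv_of_real)
          ultimately show "(F i has_derivative (\<lambda>v. \<Sum>b\<in>Basis. (v \<bullet> b) *\<^sub>R ((- 1) * (pderiv_dir b (m i) x * (?inv i x * ?inv i x))))) (at x)"
            unfolding F by (simp only:)
        qed
      qed
    qed
  qed
qed

section \<open>Functions along rays\<close>

text \<open>The curve \<open>t \<mapsto> |x|^(t-1) x\<close> runs along the ray through \<open>x\<close>, from the point \<open>x/|x|\<close> of the unit sphere at
  \<open>t = 0\<close> to \<open>x\<close> at \<open>t = 1\<close>. The generators are the Schwartz functions composed with it and those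
  functions of \<open>t\<close> and \<open>x\<close> that appear in their derivatives, together with the logarithm of \<open>|x|\<close>.\<close>

definition radial_generators :: "(real \<Rightarrow> 'a::euclidean_space \<Rightarrow> complex) set"
  where "radial_generators =
    range (\<lambda>c t x. c) \<union> {\<lambda>t x. of_real t} \<union> (\<lambda>b t x. of_real (x \<bullet> b)) ` Basis \<union>
    {\<lambda>t x. of_real (1 / norm x), \<lambda>t x. of_real (ln (norm x)), \<lambda>t x. of_real (norm x powr t)} \<union>
    (\<lambda>f t x. f (norm x powr (t - 1) *\<^sub>R x)) ` schwartz"

abbreviation radial_algebra :: "(real \<Rightarrow> 'a::euclidean_space \<Rightarrow> complex) set"
  where "radial_algebra \<equiv> generated_algebra radial_generators"

lemma radial_algebra_intros:
  "(\<lambda>t x. c) \<in> radial_algebra"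
  "(\<lambda>t x. of_real t) \<in> radial_algebra"
  "b \<in> Basis \<Longrightarrow> (\<lambda>t x. of_real (x \<bullet> b)) \<in> radial_algebra"
  "(\<lambda>t x. of_real (1 / norm x)) \<in> radial_algebra"
  "(\<lambda>t x. of_real (ln (norm x))) \<in> radial_algebra"
  "(\<lambda>t x. of_real (norm x powr t)) \<in> radial_algebra"
  "f \<in> schwartz \<Longrightarrow> (\<lambda>t x. f (norm x powr (t - 1) *\<^sub>R x)) \<in> radial_algebra"
  unfolding radial_generators_def by (rule generated_algebra.generator, blast)+

lemma generated_algebra_sum:
  assumes "finite A" "\<And>a. a \<in> A \<Longrightarrow> F a \<in> generated_algebra \<G>" "(\<lambda>i x. 0) \<in> generated_algebra \<G>"
  shows "(\<lambda>i x. \<Sum>a\<in>A. F a i x) \<in> generated_algebra \<G>"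
  using assms
proof (induction A rule: finite_induct)
  case (insert a A)
  have "(\<lambda>i x. F a i x + (\<Sum>a\<in>A. F a i x)) \<in> generated_algebra \<G>"
    by (rule generated_algebra.sum) (use insert in auto)
  then show ?case using insert(1,2) by simp
qed auto

lemma radial_has_derivative:
  fixes x :: "'a::euclidean_space"
  assumes "x \<noteq> 0" and \<phi>: "(\<phi> has_real_derivative \<phi>') (at (norm x))"
  shows "((\<lambda>x. of_real (\<phi> (norm x))) has_derivative
    (\<lambda>v. \<Sum>b\<in>Basis. (v \<bullet> b) *\<^sub>R (complex_of_real (\<phi>' * (1 / norm x)) * of_real (x \<bullet> b)))) (at x)"
proof -
  have 1: "((\<lambda>x. \<phi> (norm x)) has_derivative (\<lambda>v. \<phi>' * (v \<bullet> sgn x))) (at x)"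
    using has_derivative_compose[OF has_derivative_norm[OF assms(1)] \<phi>[unfolded has_field_derivative_def]] .
  have "(\<lambda>v. complex_of_real (\<phi>' * (v \<bullet> sgn x))) =
      (\<lambda>v. \<Sum>b\<in>Basis. (v \<bullet> b) *\<^sub>R (complex_of_real (\<phi>' * (1 / norm x)) * of_real (x \<bullet> b)))"
  proof
    fix v
    show "complex_of_real (\<phi>' * (v \<bullet> sgn x)) =
        (\<Sum>b\<in>Basis. (v \<bullet> b) *\<^sub>R (complex_of_real (\<phi>' * (1 / norm x)) * of_real (x \<bullet> b)))"
      by (subst euclidean_inner[of v "sgn x"])
        (simp add: sgn_div_norm sum_distrib_left scaleR_conv_of_real divide_inverse mult_ac)
  qed
  with has_derivative_of_real[OF 1, where 'a = complex] show ?thesis by (rule has_derivative_eq_rhs)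
qed

lemma radial_generators_gradient:
  fixes F :: "real \<Rightarrow> 'a::euclidean_space \<Rightarrow> complex"
  assumes "F \<in> radial_generators"
  shows "\<exists>F'. (\<forall>b\<in>Basis. F' b \<in> radial_algebra) \<and> gradient_on I punctured F F'"
proof -
  note alg = radial_algebra_intros(1-6) generated_algebra.sum generated_algebra.product
  from assms consider
      (const) c where "F = (\<lambda>t x. c)"
    | (param) "F = (\<lambda>t x. of_real t)"
    | (coord) c where "F = (\<lambda>t x. of_real (x \<bullet> c))" "c \<in> Basis"
    | (inv) "F = (\<lambda>t x. of_real (1 / norm x))"
    | (ln) "F = (\<lambda>t x. of_real (ln (norm x)))"
    | (powr) "F = (\<lambda>t x. of_real (norm x powr t))"
    | (comp) f where "F = (\<lambda>t x. f (norm x powr (t - 1) *\<^sub>R x))" "f \<in> schwartz"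
    unfolding radial_generators_def by blast
  then show ?thesis
  proof cases
    case const
    then show ?thesis
      by (intro exI[of _ "\<lambda>b t x. 0"]) (auto intro!: gradient_onI radial_algebra_intros)
  next
    case param
    then show ?thesis
      by (intro exI[of _ "\<lambda>b t x. 0"]) (auto intro!: gradient_onI radial_algebra_intros)
  next
    case coord
    then show ?thesis
      by (intro exI[of _ "\<lambda>b t x. of_real (b \<bullet> c)"])
        (auto intro!: gradient_onI coordinate_has_derivative radial_algebra_intros(1))
  next
    case inv
    show ?thesis
    proof (intro exI[of _ "\<lambda>b t x. (- 1) * (of_real (1 / norm x) * of_real (1 / norm x)) * of_real (1 / norm x) * of_real (x \<bullet> b)"]
        conjI ballI gradient_onI)
      fix t :: real and x :: 'a assume "x \<in> punctured"
      then have x: "x \<noteq> 0" by simp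
      have "((\<lambda>r. 1 / r) has_real_derivative - (1 / norm x * (1 / norm x))) (at (norm x))"
        using x by (auto intro!: derivative_eq_intros simp: divide_simps)
      from radial_has_derivative[OF x this]
      show "(F t has_derivative (\<lambda>v. \<Sum>b\<in>Basis. (v \<bullet> b) *\<^sub>R ((- 1) * (of_real (1 / norm x) * of_real (1 / norm x)) * of_real (1 / norm x) * of_real (x \<bullet> b)))) (at x)"
        unfolding inv by (simp only: of_real_mult of_real_minus mult_minus1 mult_minus_left mult_1)
    qed (intro alg)
  next
    case ln
    show ?thesis
    proof (intro exI[of _ "\<lambda>b t x. of_real (1 / norm x) * of_real (1 / norm x) * of_real (x \<bullet> b)"]
        conjI ballI gradient_onI)
      fix t :: real and x :: 'a assume "x \<in> punctured"
      then have x: "x \<noteq> 0" by simp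
      have "(ln has_real_derivative 1 / norm x) (at (norm x))"
        using x by (auto intro!: derivative_eq_intros)
      from radial_has_derivative[OF x this]
      show "(F t has_derivative (\<lambda>v. \<Sum>b\<in>Basis. (v \<bullet> b) *\<^sub>R (of_real (1 / norm x) * of_real (1 / norm x) * of_real (x \<bullet> b)))) (at x)"
        unfolding ln by (simp only: of_real_mult)
    qed (intro alg)
  next
    case powr
    show ?thesis
    proof (intro exI[of _ "\<lambda>b t x. of_real t * (of_real (norm x powr t) * of_real (1 / norm x)) * of_real (1 / norm x) * of_real (x \<bullet> b)"]
        conjI ballI gradient_onI)
      fix t :: real and x :: 'a assume "x \<in> punctured"
      then have x: "x \<noteq> 0" by simp
      have "((\<lambda>r. r powr t) has_real_derivative t * (norm x powr t * (1 / norm x))) (at (norm x))"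
        using x by (auto intro!: derivative_eq_intros simp: powr_diff divide_simps)
      from radial_has_derivative[OF x this]
      show "(F t has_derivative (\<lambda>v. \<Sum>b\<in>Basis. (v \<bullet> b) *\<^sub>R (of_real t * (of_real (norm x powr t) * of_real (1 / norm x)) * of_real (1 / norm x) * of_real (x \<bullet> b)))) (at x)"
        unfolding powr by (simp only: of_real_mult)
    qed (intro alg)
  next
    case comp
    let ?p = "\<lambda>t x::'a. complex_of_real (norm x powr t) * of_real (1 / norm x)"
    let ?F = "\<lambda>c t x. pderiv_dir c f (norm x powr (t - 1) *\<^sub>R x)"
    \<comment> \<open>The entry with indices c, b of the Jacobian matrix of the curve with respect to its end point.\<close>
    let ?J = "\<lambda>b c t x. of_real (b \<bullet> c) * ?p t x
      + (of_real t + (- 1)) * (?p t x * of_real (1 / norm x) * of_real (1 / norm x)) * of_real (x \<bullet> b) * of_real (x \<bullet> c)"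
    show ?thesis
    proof (intro exI[of _ "\<lambda>b t x. \<Sum>c\<in>Basis. ?F c t x * ?J b c t x"] conjI ballI gradient_onI)
      fix b :: 'a assume b: "b \<in> Basis"
      show "(\<lambda>t x. \<Sum>c\<in>Basis. ?F c t x * ?J b c t x) \<in> radial_algebra"
      proof (rule generated_algebra_sum[OF finite_Basis generated_algebra.product radial_algebra_intros(1)])
        fix c :: 'a assume c: "c \<in> Basis"
        show "?F c \<in> radial_algebra"
          by (rule radial_algebra_intros(7)[OF schwartz_pderiv_dir[OF comp(2) c]])
        show "?J b c \<in> radial_algebra"
          by (intro alg b c)
      qed
    next
      fix t :: real and x :: 'a assume "x \<in> punctured"
      then have x: "x \<noteq> 0" by simp
      let ?q = "norm x powr t * (1 / norm x)"
      let ?D = "\<lambda>v. ?q *\<^sub>R v + ((t - 1) * (?q * (1 / norm x) * (1 / norm x)) * (v \<bullet> x)) *\<^sub>R x"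
      have q: "norm x powr (t - 1) = ?q" using x by (simp add: powr_diff)
      have "norm x powr (t - 1 - 1) = ?q * (1 / norm x)"
        using x by (simp only: powr_diff) simp
      then have "((\<lambda>r. r powr (t - 1)) has_real_derivative (t - 1) * (?q * (1 / norm x))) (at (norm x))"
        using has_real_derivative_powr[OF x[folded zero_less_norm_iff], of "t - 1"] by (simp only:)
      from has_derivative_compose[OF has_derivative_norm[OF x] this[unfolded has_field_derivative_def]]
      have "((\<lambda>x. norm x powr (t - 1)) has_derivative (\<lambda>v. (t - 1) * (?q * (1 / norm x)) * (v \<bullet> sgn x))) (at x)" .
      from has_derivative_scaleR[OF this has_derivative_ident]
      have "((\<lambda>x. norm x powr (t - 1) *\<^sub>R x) has_derivative ?D) (at x)"
        unfolding q by (simp add: sgn_div_norm divide_inverse mult_ac)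
      from has_derivative_compose[OF this has_derivative_pderiv_dir[OF schwartz_differentiable[OF comp(2)]]]
      have "(F t has_derivative (\<lambda>v. \<Sum>c\<in>Basis. (?D v \<bullet> c) *\<^sub>R ?F c t x)) (at x)"
        unfolding comp(1) .
      moreover have "(\<Sum>c\<in>Basis. (?D v \<bullet> c) *\<^sub>R ?F c t x) =
          (\<Sum>b\<in>Basis. (v \<bullet> b) *\<^sub>R (\<Sum>c\<in>Basis. ?F c t x * ?J b c t x))" for v
      proof -
        have D: "(?D v \<bullet> c) *\<^sub>R ?F c t x = (\<Sum>b\<in>Basis. (v \<bullet> b) *\<^sub>R (?F c t x * ?J b c t x))"
          if c: "c \<in> Basis" for c
        proof -
          have lin: "?D v = (\<Sum>b\<in>Basis. (v \<bullet> b) *\<^sub>R ?D b)"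
          proof -
            have "linear (\<lambda>v. r *\<^sub>R v + (s * (v \<bullet> x)) *\<^sub>R x)" for r s
              by (rule linearI) (simp_all add: algebra_simps inner_add_left)
            then have "linear ?D" .
            then interpret linear ?D .
            have "?D v = ?D (\<Sum>b\<in>Basis. (v \<bullet> b) *\<^sub>R b)" by (simp only: euclidean_representation)
            also have "\<dots> = (\<Sum>b\<in>Basis. (v \<bullet> b) *\<^sub>R ?D b)" by (simp only: sum scale)
            finally show ?thesis .
          qed
          have "(?D b \<bullet> c) *\<^sub>R ?F c t x = ?F c t x * ?J b c t x" for b
            by (simp add: scaleR_conv_of_real inner_add_left inner_commute[of b x] algebra_simps)
          then show ?thesis
            by (subst lin) (simp only: inner_sum_left inner_scaleR_left scaleR_sum_left scaleR_scaleR[symmetric])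
        qed
        have "(\<Sum>c\<in>Basis. (?D v \<bullet> c) *\<^sub>R ?F c t x) = (\<Sum>c\<in>Basis. \<Sum>b\<in>Basis. (v \<bullet> b) *\<^sub>R (?F c t x * ?J b c t x))"
          by (rule sum.cong[OF refl D])
        also have "\<dots> = (\<Sum>b\<in>Basis. \<Sum>c\<in>Basis. (v \<bullet> b) *\<^sub>R (?F c t x * ?J b c t x))"
          by (rule sum.swap)
        finally show ?thesis by (simp only: scaleR_sum_right)
      qed
      ultimately show "(F t has_derivative (\<lambda>v. \<Sum>b\<in>Basis. (v \<bullet> b) *\<^sub>R (\<Sum>c\<in>Basis. ?F c t x * ?J b c t x))) (at x)"
        by (simp only:)
    qed
  qed
qed

lemma radial_generators_moderate:
  "radial_generators \<subseteq> moderate {0..1} punctured (origin_weight :: 'a::euclidean_space \<Rightarrow> real)"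
proof
  fix F :: "real \<Rightarrow> 'a \<Rightarrow> complex"
  assume "F \<in> radial_generators"
  then consider
      (const) c where "F = (\<lambda>t x. c)"
    | (param) "F = (\<lambda>t x. of_real t)"
    | (coord) c where "F = (\<lambda>t x. of_real (x \<bullet> c))" "c \<in> Basis"
    | (inv) "F = (\<lambda>t x. of_real (1 / norm x))"
    | (ln) "F = (\<lambda>t x. of_real (ln (norm x)))"
    | (powr) "F = (\<lambda>t x. of_real (norm x powr t))"
    | (comp) f where "F = (\<lambda>t x. f (norm x powr (t - 1) *\<^sub>R x))" "f \<in> schwartz"
    unfolding radial_generators_def by blast
  then show "F \<in> moderate {0..1} punctured origin_weight"
  proof cases
    case const
    then show ?thesis by (intro moderateI[where C = "norm c" and k = 0]) simp
  next
    case param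
    then show ?thesis by (intro moderateI[where C = 1 and k = 0]) simp
  next
    case coord
    show ?thesis
    proof (rule moderateI[where C = 1 and k = 1])
      fix t :: real and x :: 'a assume "x \<in> punctured"
      then show "norm (F t x) \<le> 1 * origin_weight x ^ 1"
        using Basis_le_norm[OF coord(2), of x] origin_weight_bounds(1)[of x] by (simp add: coord(1))
    qed
  next
    case inv
    show ?thesis
    proof (rule moderateI[where C = 1 and k = 1])
      fix t :: real and x :: 'a assume "x \<in> punctured"
      then show "norm (F t x) \<le> 1 * origin_weight x ^ 1"
        using origin_weight_bounds(2)[of x] by (simp add: inv norm_divide)
    qed
  next
    case ln
    show ?thesis
    proof (rule moderateI[where C = 1 and k = 1])
      fix t :: real and x :: 'a assume "x \<in> punctured"
      then have x: "x \<noteq> 0" by simp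
      have "ln (norm x) \<le> norm x" using ln_le_minus_one[of "norm x"] x by simp
      moreover have "- ln (norm x) \<le> 1 / norm x"
        using ln_le_minus_one[of "1 / norm x"] x by (simp add: ln_div)
      ultimately have "\<bar>ln (norm x)\<bar> \<le> origin_weight x"
        using origin_weight_bounds(1,2)[OF x] by linarith
      then show "norm (F t x) \<le> 1 * origin_weight x ^ 1" by (simp add: ln)
    qed
  next
    case powr
    show ?thesis
    proof (rule moderateI[where C = 1 and k = 1])
      fix t :: real and x :: 'a assume t: "t \<in> {0..1}" and "x \<in> punctured"
      then have x: "x \<noteq> 0" by simp
      have "norm x powr t \<le> origin_weight x"
      proof (cases "norm x \<le> 1")
        case True
        then have "norm x powr t \<le> 1" using t by (intro powr_le1) auto
        then show ?thesis using origin_weight_bounds(3)[OF x] by linarith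
      next
        case False
        then have "norm x powr t \<le> norm x powr 1" using t by (intro powr_mono) auto
        then show ?thesis using origin_weight_bounds(1)[OF x] by simp
      qed
      then show "norm (F t x) \<le> 1 * origin_weight x ^ 1" by (simp add: powr)
    qed
  next
    case comp
    obtain C where "\<And>x. norm (f x) \<le> C" using schwartz_bounded[OF comp(2)] by blast
    then show ?thesis using comp(1) by (intro moderateI[where C = C and k = 0]) simp
  qed
qed

lemma radial_algebra_smooth:
  assumes "F \<in> radial_algebra"
  shows "F \<in> smooth_family {0..1} punctured (moderate {0..1} punctured origin_weight)"
  by (rule generated_algebra_smooth_family[OF open_punctured cong_closed_moderate
        add_closed_moderate mult_into_moderate radial_generators_moderate radial_generators_gradient assms]) auto

lemma radial_algebra_slice:
  assumes F: "F \<in> radial_algebra" and t: "t \<in> {0..1}"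
  shows "(\<lambda>_. F t) \<in> smooth_family {()} punctured (moderate {()} punctured origin_weight)"
  unfolding smooth_family_def
proof (intro CollectI ballI conjI)
  note sm = smooth_familyD[OF radial_algebra_smooth[OF F]]
  fix bs :: "'a list" assume bs: "bs \<in> lists Basis"
  show "pderivs bs (F t) differentiable at x" if "x \<in> punctured" for x
    using sm(2)[OF bs t that] .
  show "(\<lambda>_. pderivs bs (F t)) \<in> moderate {()} punctured origin_weight"
    using sm(1)[OF bs] t unfolding moderate_def by blast
qed

lemma radial_algebra_continuous:
  assumes "F \<in> radial_algebra" "x \<noteq> 0"
  shows "continuous_on S (\<lambda>t. F t x)"
  using assms(1)
proof induction
  case (generator F)
  have "continuous_on S (\<lambda>t. f (norm x powr (t - 1) *\<^sub>R x))" if "f \<in> schwartz" for f :: "'a \<Rightarrow> complex"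
    by (rule continuous_on_compose2[OF schwartz_continuous[OF that, of UNIV]])
      (use assms(2) in \<open>auto intro!: continuous_intros\<close>)
  with generator assms(2) show ?case
    unfolding radial_generators_def by (auto intro!: continuous_intros)
qed (auto intro!: continuous_intros)

abbreviation unit_interval_measure :: "real measure"
  where "unit_interval_measure \<equiv> restrict_space lborel {0..1}"

interpretation unit_interval: finite_measure unit_interval_measure
  by (rule finite_measureI) (simp add: emeasure_restrict_space space_restrict_space)

lemma measure_unit_interval: "measure unit_interval_measure (space unit_interval_measure) = 1"
  by (simp add: measure_restrict_space space_restrict_space)

lemma radial_algebra_measurable:
  assumes "F \<in> radial_algebra" "x \<noteq> 0"
  shows "(\<lambda>t. F t x) \<in> borel_measurable unit_interval_measure"
proof -
  have "(\<lambda>t. F t x) \<in> borel_measurable (restrict_space borel {0..1})"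
    by (rule borel_measurable_continuous_on_restrict[OF radial_algebra_continuous[OF assms]])
  then show ?thesis
    by (simp cong: measurable_cong_sets sets_restrict_space_cong)
qed

lemma radial_algebra_bound:
  assumes "F \<in> radial_algebra"
  obtains k C where "C \<ge> 0"
    "\<And>t x. t \<in> {0..1} \<Longrightarrow> x \<noteq> 0 \<Longrightarrow> norm (F t x) \<le> C * origin_weight x ^ k"
proof (rule moderateE[OF smooth_family_base[OF radial_algebra_smooth[OF assms]]])
  show "weight_on (punctured :: 'a set) origin_weight" by simp
  fix k C assume "0 \<le> C" "\<And>t x. t \<in> {0..1} \<Longrightarrow> x \<in> punctured \<Longrightarrow> norm (F t x) \<le> C * origin_weight x ^ k"
  then show thesis by (intro that[of C k]) auto
qed

text \<open>Differentiation under the integral sign leads from the integral of a member of the algebra to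
  integrals of other members: the integrals are a class closed under differentiation.\<close>

lemma radial_algebra_integral_smooth:
  fixes F :: "real \<Rightarrow> 'a::euclidean_space \<Rightarrow> complex"
  assumes F: "F \<in> radial_algebra"
  shows "(\<lambda>_ x. \<integral>t. F t x \<partial>unit_interval_measure) \<in>
    smooth_family {()} punctured (moderate {()} punctured origin_weight)"
proof (rule smooth_family_coinduct[where
      \<C> = "{\<lambda>_ x. \<integral>t. F t x \<partial>unit_interval_measure |F. F \<in> radial_algebra}",
      OF open_punctured cong_closed_moderate])
  let ?M = unit_interval_measure
  let ?C = "{\<lambda>(_::unit) (x::'a). \<integral>t. F t x \<partial>?M |F. F \<in> radial_algebra}"
  show "(\<lambda>_ x. \<integral>t. F t x \<partial>?M) \<in> ?C" by (intro CollectI exI[of _ F] conjI refl F)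
  fix H :: "unit \<Rightarrow> 'a \<Rightarrow> complex" assume "H \<in> ?C"
  then obtain F where F: "F \<in> radial_algebra" and H: "H = (\<lambda>_ x. \<integral>t. F t x \<partial>?M)" by blast
  have int: "integrable ?M (\<lambda>t. F t x)" if F: "F \<in> radial_algebra" and x: "x \<noteq> 0"
    for F :: "real \<Rightarrow> 'a \<Rightarrow> complex" and x
  proof -
    obtain k C where "\<And>t x. t \<in> {0..1} \<Longrightarrow> x \<noteq> 0 \<Longrightarrow> norm (F t x) \<le> C * origin_weight x ^ k"
      by (rule radial_algebra_bound[OF F]) blast
    with x show ?thesis
      by (intro unit_interval.integrable_const_bound[where B = "C * origin_weight x ^ k"]
          radial_algebra_measurable F AE_I2) (auto simp: space_restrict_space)
  qed
  obtain k C where C: "C \<ge> 0"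
    "\<And>t x. t \<in> {0..1} \<Longrightarrow> x \<noteq> 0 \<Longrightarrow> norm (F t x) \<le> C * origin_weight x ^ k"
    by (rule radial_algebra_bound[OF F]) blast
  show "H \<in> moderate {()} punctured origin_weight"
  proof (rule moderateI)
    fix i :: unit and x :: 'a assume "x \<in> punctured"
    then have x: "x \<noteq> 0" by simp
    have "norm (H i x) \<le> (\<integral>t. norm (F t x) \<partial>?M)" unfolding H by (rule integral_norm_bound)
    also have "\<dots> \<le> (\<integral>t. C * origin_weight x ^ k \<partial>?M)"
      using C(2) x int[OF F x] by (intro integral_mono) (auto simp: space_restrict_space)
    also have "\<dots> = C * origin_weight x ^ k" using measure_unit_interval by simp
    finally show "norm (H i x) \<le> C * origin_weight x ^ k" .
  qed
  obtain F' where F': "\<And>b. b \<in> Basis \<Longrightarrow> F' b \<in> radial_algebra" "gradient_on {0..1} punctured F F'"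
    using generated_algebra_gradient[OF radial_generators_gradient F] by blast
  show "\<exists>F'. (\<forall>b\<in>Basis. F' b \<in> ?C) \<and> gradient_on {()} punctured H F'"
  proof (intro exI[of _ "\<lambda>b _ x. \<integral>t. F' b t x \<partial>?M"] conjI ballI gradient_onI)
    fix b :: 'a assume "b \<in> Basis"
    then show "(\<lambda>_ x. \<integral>t. F' b t x \<partial>?M) \<in> ?C"
      by (intro CollectI exI[of _ "F' b"] conjI refl F')
  next
    fix i :: unit and x0 :: 'a assume "x0 \<in> punctured"
    then have x0: "x0 \<noteq> 0" by simp
    have "\<exists>k C. C \<ge> 0 \<and> (\<forall>t\<in>{0..1}. \<forall>x. x \<noteq> 0 \<longrightarrow> norm (F' b t x) \<le> C * origin_weight x ^ k)"
      if b: "b \<in> Basis" for b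
      using radial_algebra_bound[OF F'(1)[OF b]] by metis
    then obtain k C where C: "\<And>b. b \<in> Basis \<Longrightarrow> C b \<ge> 0"
      "\<And>b t x. b \<in> Basis \<Longrightarrow> t \<in> {0..1} \<Longrightarrow> x \<noteq> 0 \<Longrightarrow> norm (F' b t x) \<le> C b * origin_weight x ^ k b"
      by metis
    let ?W = "2 * norm x0 + 2 / norm x0"
    have W: "x \<noteq> 0" "origin_weight x \<le> ?W" if x: "x \<in> ball x0 (norm x0 / 2)" for x
    proof -
      have d: "norm (x0 - x) < norm x0 / 2" using x by (simp add: dist_norm)
      have lo: "norm x0 / 2 \<le> norm x" using norm_triangle_ineq2[of x0 x] d by linarith
      have up: "norm x \<le> 2 * norm x0" using norm_triangle_ineq2[of x x0] d norm_minus_commute[of x x0]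
        norm_ge_zero[of x0] by linarith
      show "x \<noteq> 0" using lo x0 by auto
      have "1 / norm x \<le> 1 / (norm x0 / 2)" using lo x0 by (intro divide_left_mono mult_pos_pos) auto
      with up show "origin_weight x \<le> ?W" by (simp add: origin_weight_def)
    qed
    show "(H i has_derivative (\<lambda>v. \<Sum>b\<in>Basis. (v \<bullet> b) *\<^sub>R (\<integral>t. F' b t x0 \<partial>?M))) (at x0)"
      unfolding H
    proof (rule has_derivative_integral_dominated[where e = "norm x0 / 2" and f = "\<lambda>x t. F t x"
          and f' = "\<lambda>b x t. F' b t x" and g = "\<lambda>t. \<Sum>b\<in>Basis. C b * ?W ^ k b"])
      show "integrable ?M (\<lambda>t. \<Sum>b\<in>Basis. C b * ?W ^ k b)" by simp
      fix x assume x: "x \<in> ball x0 (norm x0 / 2)"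
      show "integrable ?M (\<lambda>t. F t x)" by (rule int[OF F W(1)[OF x]])
      fix t assume "t \<in> space ?M"
      then have t: "t \<in> {0..1}" by (simp add: space_restrict_space)
      show "((\<lambda>x. F t x) has_derivative (\<lambda>v. \<Sum>b\<in>Basis. (v \<bullet> b) *\<^sub>R F' b t x)) (at x)"
        using gradient_onD[OF F'(2) t] W(1)[OF x] by auto
      fix b :: 'a assume b: "b \<in> Basis"
      have "norm (F' b t x) \<le> C b * origin_weight x ^ k b" by (rule C(2)[OF b t W(1)[OF x]])
      also have "\<dots> \<le> C b * ?W ^ k b"
        using W(2)[OF x] origin_weight_bounds(3)[OF W(1)[OF x]] C(1)[OF b]
        by (intro mult_left_mono power_mono) auto
      also have "\<dots> \<le> (\<Sum>b\<in>Basis. C b * ?W ^ k b)"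
        using C(1) b by (intro member_le_sum mult_nonneg_nonneg zero_le_power) auto
      finally show "norm (F' b t x) \<le> (\<Sum>b\<in>Basis. C b * ?W ^ k b)" .
    next
      fix b :: 'a assume b: "b \<in> Basis"
      show "(\<lambda>t. F' b t x0) \<in> borel_measurable ?M"
        by (rule radial_algebra_measurable[OF F'(1)[OF b] x0])
    qed (use x0 in auto)
  qed
qed

section \<open>Division by the logarithm\<close>

text \<open>The derivative of \<open>g\<close> along the curve is \<open>ln |x|\<close> times this function.\<close>

definition radial_derivative :: "('a::euclidean_space \<Rightarrow> complex) \<Rightarrow> real \<Rightarrow> 'a \<Rightarrow> complex"
  where "radial_derivative g t x = (\<Sum>c\<in>Basis. pderiv_dir c g (norm x powr (t - 1) *\<^sub>R x) *
    (of_real (norm x powr t) * (of_real (1 / norm x) * of_real (x \<bullet> c))))"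

lemma radial_derivative_in_algebra:
  fixes g :: "'a::euclidean_space \<Rightarrow> complex"
  assumes "g \<in> schwartz"
  shows "radial_derivative g \<in> radial_algebra"
proof -
  have "(\<lambda>t x. \<Sum>c\<in>Basis. pderiv_dir c g (norm x powr (t - 1) *\<^sub>R x) *
    (of_real (norm x powr t) * (of_real (1 / norm x) * of_real (x \<bullet> c)))) \<in> radial_algebra"
  proof (rule generated_algebra_sum[OF finite_Basis generated_algebra.product radial_algebra_intros(1)])
    fix c :: 'a assume c: "c \<in> Basis"
    show "(\<lambda>t x. pderiv_dir c g (norm x powr (t - 1) *\<^sub>R x)) \<in> radial_algebra"
      by (rule radial_algebra_intros(7)[OF schwartz_pderiv_dir[OF assms c]])
    show "(\<lambda>t x. of_real (norm x powr t) * (of_real (1 / norm x) * of_real (x \<bullet> c))) \<in> radial_algebra"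
      by (intro radial_algebra_intros(3,4,6) generated_algebra.product c)
  qed
  then show ?thesis unfolding radial_derivative_def .
qed

lemma radial_difference:
  fixes g :: "'a::euclidean_space \<Rightarrow> complex"
  assumes g: "g \<in> schwartz" and x: "x \<noteq> 0"
  shows "g x - g (x /\<^sub>R norm x) =
    of_real (ln (norm x)) * (\<integral>t. radial_derivative g t x \<partial>unit_interval_measure)"
proof -
  let ?f = "\<lambda>t. of_real (ln (norm x)) * radial_derivative g t x"
  let ?G = "\<lambda>t. g (norm x powr (t - 1) *\<^sub>R x)"
  have der: "(?G has_vector_derivative ?f t) (at t within {0..1})" for t
  proof -
    let ?p = "norm x powr (t - 1)"
    have p: "?p = norm x powr t * (1 / norm x)" using x by (simp add: powr_diff)
    have "((\<lambda>t. norm x powr (t - 1)) has_real_derivative ?p * ln (norm x)) (at t)"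
      using x by (auto intro!: derivative_eq_intros)
    then have "((\<lambda>t. norm x powr (t - 1) *\<^sub>R x) has_derivative (\<lambda>h. (h * (?p * ln (norm x))) *\<^sub>R x)) (at t)"
      unfolding has_field_derivative_def
      by (auto intro!: derivative_eq_intros simp: mult.commute)
    from has_derivative_compose[OF this has_derivative_pderiv_dir[OF schwartz_differentiable[OF g]]]
    have "(?G has_derivative (\<lambda>h. \<Sum>c\<in>Basis. (((h * (?p * ln (norm x))) *\<^sub>R x) \<bullet> c) *\<^sub>R pderiv_dir c g (?p *\<^sub>R x))) (at t)" .
    moreover have "(\<Sum>c\<in>Basis. (((h * (?p * ln (norm x))) *\<^sub>R x) \<bullet> c) *\<^sub>R pderiv_dir c g (?p *\<^sub>R x)) = h *\<^sub>R ?f t" for h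
      unfolding radial_derivative_def sum_distrib_left scaleR_sum_right
      by (intro sum.cong refl) (simp add: p scaleR_conv_of_real mult_ac)
    ultimately have "(?G has_derivative (\<lambda>h. h *\<^sub>R ?f t)) (at t)" by (simp only:)
    then show ?thesis unfolding has_vector_derivative_def by (rule has_derivative_at_withinI)
  qed
  have cont: "continuous_on {0..1} ?f"
    by (intro continuous_intros radial_algebra_continuous[OF radial_derivative_in_algebra[OF g] x])
  have "?G 1 - ?G 0 = (\<integral>t. indicator {0..1} t *\<^sub>R ?f t \<partial>lborel)"
    by (rule integral_FTC_atLeastAtMost[symmetric]) (use der cont in auto)
  also have "\<dots> = (\<integral>t. ?f t \<partial>unit_interval_measure)"
    by (rule integral_restrict_space[symmetric]) simp
  finally show ?thesis using x by (simp add: powr_minus_divide inverse_eq_divide)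
qed

lemma sphere_projection_smooth:
  fixes f :: "'a::euclidean_space \<Rightarrow> complex"
  assumes "f \<in> schwartz"
  shows "(\<lambda>_ x. f (x /\<^sub>R norm x)) \<in> smooth_family {()} punctured (moderate {()} punctured origin_weight)"
proof (rule smooth_family_cong[OF open_punctured cong_closed_moderate])
  show "(\<lambda>_ x. f (norm x powr (0 - 1) *\<^sub>R x)) \<in> smooth_family {()} punctured (moderate {()} punctured origin_weight)"
    by (rule radial_algebra_slice[OF radial_algebra_intros(7)[OF assms]]) simp
  show "f (x /\<^sub>R norm x) = f (norm x powr (0 - 1) *\<^sub>R x)" if "x \<in> punctured" for i :: unit and x
    using that by (simp add: powr_minus)
qed

lemma log_norm_smooth:
  "(\<lambda>_ x. of_real (ln (norm x))) \<in> smooth_family {()} punctured (moderate {()} punctured origin_weight)"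
  using radial_algebra_slice[OF radial_algebra_intros(5), of 0] by simp

definition log_multiply :: "('a::euclidean_space \<Rightarrow> complex) \<Rightarrow> 'a \<Rightarrow> complex"
  where "log_multiply h x = of_real (2 * ln (norm x)) * h x"

lemma flat_log_multiply:
  assumes "h \<in> flat_schwartz"
  shows "log_multiply h \<in> flat_schwartz"
proof (rule flat_mult[of "\<lambda>x. 2 * of_real (ln (norm x))"])
  have "(\<lambda>_ x. 2 * of_real (ln (norm x))) \<in> smooth_family {()} punctured (moderate {()} punctured origin_weight)"
    by (rule smooth_family_mult[OF open_punctured cong_closed_moderate add_closed_moderate mult_into_moderate
          const_smooth_family[of _ _ _ 2] log_norm_smooth]) auto
  then show "(\<lambda>_ x. 2 * of_real (ln (norm x))) \<in> smooth_family {()} punctured (moderate {()} punctured origin_weight)" .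
qed (auto simp: log_multiply_def assms)

lemma rapid_constant_bound:
  assumes "(\<lambda>_. f) \<in> rapid {()} S w (\<lambda>_ _. 1)"
  shows "\<exists>C. \<forall>x\<in>S. w x ^ N * norm (f x) \<le> C"
proof -
  have "\<exists>(k::nat) C. \<forall>i\<in>{()}. \<forall>x\<in>S. w x ^ N * norm (f x) \<le> C * 1"
    using assms unfolding rapid_def by blast
  then show ?thesis by auto
qed

lemma moderate_subset:
  assumes "T \<subseteq> S"
  shows "moderate I S w \<subseteq> moderate I T w"
  using assms unfolding moderate_def by (intro Collect_mono) (meson subsetD)

lemma rapid_subset:
  assumes "T \<subseteq> S"
  shows "rapid I S w q \<subseteq> rapid I T w q"
  using assms unfolding rapid_def by (intro Collect_mono) (meson subsetD)

text \<open>As \<open>g\<close> vanishes on the sphere, it equals \<open>ln |x|\<close> times the integral of its radial derivative.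
  That integral is smooth off the origin and grows moderately; this settles the shell around
  the sphere. Elsewhere the logarithm is bounded away from zero, and the quotient of \<open>g\<close> by the
  logarithm inherits the decay of \<open>g\<close> at the origin and at infinity.\<close>

theorem log_division:
  fixes g :: "'a::euclidean_space \<Rightarrow> complex"
  assumes g: "g \<in> flat_schwartz" and zero: "\<And>x. norm x = 1 \<Longrightarrow> g x = 0"
  shows "\<exists>h\<in>flat_schwartz. g = log_multiply h"
proof -
  note gs = flat_schwartzD(1)[OF g]
  define h where "h x = (if x = 0 then 0 else
    (1/2) * (\<integral>t. radial_derivative g t x \<partial>unit_interval_measure))" for x
  have div: "g x = log_multiply h x" for x
  proof (cases "x = 0")
    case True
    then show ?thesis using flat_schwartzD(2)[OF g] by (simp add: log_multiply_def)
  next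
    case False
    have "g (x /\<^sub>R norm x) = 0" using False by (intro zero) simp
    with radial_difference[OF gs False] False show ?thesis
      by (simp add: log_multiply_def h_def)
  qed
  let ?M = "moderate {()} punctured origin_weight :: (unit \<Rightarrow> 'a \<Rightarrow> complex) set"
  let ?S = "{x::'a. x \<noteq> 0 \<and> (norm x < 1/2 \<or> 2 < norm x)}"
  let ?R = "rapid {()} ?S origin_weight (\<lambda>_ _. 1) :: (unit \<Rightarrow> 'a \<Rightarrow> complex) set"
  have "(\<lambda>_ x. (1/2) * (\<integral>t. radial_derivative g t x \<partial>unit_interval_measure)) \<in> smooth_family {()} punctured ?M"
    by (rule smooth_family_mult[OF open_punctured cong_closed_moderate add_closed_moderate mult_into_moderate
          const_smooth_family[of _ _ _ "1/2"] radial_algebra_integral_smooth[OF radial_derivative_in_algebra[OF gs]]]) auto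
  then have hM: "(\<lambda>_. h) \<in> smooth_family {()} punctured ?M"
    by (rule smooth_family_cong[OF open_punctured cong_closed_moderate]) (simp add: h_def)
  have S: "open ?S" "0 \<notin> ?S" "?S \<subseteq> punctured"
  proof -
    have "?S = - {0} \<inter> ({x. norm x < 1/2} \<union> {x. 2 < norm x})" by auto
    then show "open ?S"
      by (simp only:) (intro open_Int open_Un open_Collect_less continuous_intros open_Compl closed_singleton)
  qed auto
  have hR: "(\<lambda>_. h) \<in> smooth_family {()} ?S ?R"
  proof (rule smooth_family_cong[OF S(1) cong_closed_rapid])
    have "(\<lambda>_ x. 2 * of_real (ln (norm x))) \<in> smooth_family {()} punctured ?M"
      by (rule smooth_family_mult[OF open_punctured cong_closed_moderate add_closed_moderate mult_into_moderate
            const_smooth_family[of _ _ _ 2] log_norm_smooth]) auto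
    then have "(\<lambda>_ x. 2 * of_real (ln (norm x))) \<in> smooth_family {()} ?S (moderate {()} ?S origin_weight)"
      by (rule smooth_family_mono[OF _ order_refl S(3) moderate_subset[OF S(3)]])
    then have inv: "(\<lambda>_ x. inverse (2 * of_real (ln (norm x)))) \<in> smooth_family {()} ?S (moderate {()} ?S origin_weight)"
    proof (rule smooth_family_moderate_inverse[OF S(1), rotated])
      show "0 < 2 * ln (2::real)" by simp
      fix x assume x: "x \<in> ?S"
      have "ln 2 \<le> \<bar>ln (norm x)\<bar>"
      proof (cases "2 < norm x")
        case True
        then have "ln 2 \<le> ln (norm x)" using x by (subst ln_le_cancel_iff) auto
        then show ?thesis by linarith
      next
        case False
        then have "ln (norm x) \<le> ln (1/2)" using x by (subst ln_le_cancel_iff) auto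
        then show ?thesis by (simp add: ln_div)
      qed
      then show "2 * ln 2 \<le> norm (2 * complex_of_real (ln (norm x)))" by (simp add: norm_mult)
    qed (use S in simp)
    have gR: "(\<lambda>_. g) \<in> smooth_family {()} ?S ?R"
      by (rule smooth_family_mono[OF flat_rapid[OF g] order_refl S(3) rapid_subset[OF S(3)]])
    have w: "weight_on ?S origin_weight" using S(2) by (rule weight_on_origin)
    show "(\<lambda>_ x. inverse (2 * of_real (ln (norm x))) * g x) \<in> smooth_family {()} ?S ?R"
      by (rule smooth_family_mult[OF S(1) cong_closed_rapid add_closed_rapid[OF w graded_on_const_one]
            mult_into_rapid[OF w graded_on_const_one] inv gR])
    fix x assume x: "x \<in> ?S"
    then have "ln (norm x) \<noteq> 0" by auto
    then show "h x = inverse (2 * of_real (ln (norm x))) * g x"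
      unfolding div[of x] log_multiply_def by simp
  qed
  have "(\<lambda>_. h) \<in> smooth_family {()} punctured (rapid {()} punctured origin_weight (\<lambda>_ _. 1))"
    unfolding smooth_family_def
  proof (intro CollectI ballI conjI rapidI)
    fix bs :: "'a list" assume bs: "bs \<in> lists Basis"
    show "pderivs bs h differentiable at x" if "x \<in> punctured" for x
      using smooth_familyD(2)[OF hM bs] that by simp
    fix N
    obtain C where C: "\<And>x. x \<in> ?S \<Longrightarrow> origin_weight x ^ N * norm (pderivs bs h x) \<le> C"
      using rapid_constant_bound[OF smooth_familyD(1)[OF hR bs]] by blast
    obtain k D where D: "D \<ge> 0" "\<And>x. x \<noteq> 0 \<Longrightarrow> norm (pderivs bs h x) \<le> D * origin_weight x ^ k"
      by (rule moderateE[OF smooth_familyD(1)[OF hM bs]]) auto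
    have "origin_weight x ^ N * norm (pderivs bs h x) \<le> max C (D * 4 ^ (N + k))" if x: "x \<noteq> 0" for x
    proof (cases "x \<in> ?S")
      case True
      then show ?thesis using C by (simp add: le_max_iff_disj)
    next
      case False
      then have n: "1/2 \<le> norm x" "norm x \<le> 2" using x by auto
      then have "1 / norm x \<le> 2" using x by (simp add: field_simps)
      \<comment> \<open>On the shell all powers of the weight are bounded, so moderate growth is enough.\<close>
      then have w: "1 \<le> origin_weight x" "origin_weight x \<le> 4"
        using n origin_weight_bounds(3)[OF x] by (auto simp: origin_weight_def)
      have "origin_weight x ^ N * norm (pderivs bs h x) \<le> origin_weight x ^ N * (D * origin_weight x ^ k)"
        using w D(2)[OF x] by (intro mult_left_mono) auto
      also have "\<dots> = D * origin_weight x ^ (N + k)" by (simp add: power_add)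
      also have "\<dots> \<le> D * 4 ^ (N + k)" using w D(1) by (intro mult_left_mono power_mono) auto
      finally show ?thesis by simp
    qed
    then show "\<exists>(k::nat) C. \<forall>i\<in>{()}. \<forall>x\<in>punctured. origin_weight x ^ N * norm (pderivs bs h x) \<le> C * 1"
      by (intro exI[of _ 0] exI[of _ "max C (D * 4 ^ (N + k))"]) auto
  qed
  then have "h \<in> flat_schwartz" by (rule flat_schwartzI_rapid[rotated]) (simp add: h_def)
  with div show ?thesis by blast
qed

section \<open>Test functions and functions on the sphere\<close>

lemma pderivs_cong_open:
  fixes f g :: "'a::euclidean_space \<Rightarrow> 'b::real_normed_vector"
  assumes S: "open S" and eq: "\<And>x. x \<in> S \<Longrightarrow> f x = g x" and x: "x \<in> S"
  shows "pderivs bs f x = pderivs bs g x"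
  using x
proof (induction bs arbitrary: x)
  case (Cons b bs)
  have "(pderivs bs f has_derivative D) (at x) \<longleftrightarrow> (pderivs bs g has_derivative D) (at x)" for D
    using has_derivative_transform_within_open[OF _ S Cons.prems] Cons.IH by metis
  then show ?case by (simp add: pderiv_dir_def frechet_derivative_def)
qed (simp add: eq)

lemma pderivs_outside_supp:
  fixes f :: "'a::euclidean_space \<Rightarrow> 'b::real_normed_vector"
  assumes "x \<notin> supp f"
  shows "pderivs bs f x = 0"
proof -
  have "pderivs bs f x = pderivs bs (\<lambda>x. 0) x"
    using assms closure_subset[of "{x. f x \<noteq> 0}"]
    by (intro pderivs_cong_open[of "- supp f"]) (auto simp: supp_def)
  then show ?thesis by simp
qed

lemma zero_outside_supp: "x \<notin> supp f \<Longrightarrow> f x = 0"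
  using closure_subset[of "{x. f x \<noteq> 0}"] by (auto simp: supp_def)

text \<open>On a fixed ball all powers of the weight are bounded, so bounds for the derivatives suffice.\<close>

lemma compactly_supported_schwartz_family:
  fixes F :: "'i \<Rightarrow> 'a::euclidean_space \<Rightarrow> complex"
  assumes q: "graded_on I q" and sm: "\<And>i. i \<in> I \<Longrightarrow> smooth (F i)"
    and K: "\<And>i x. i \<in> I \<Longrightarrow> x \<in> supp (F i) \<Longrightarrow> norm x \<le> R"
    and bound: "\<And>bs. bs \<in> lists Basis \<Longrightarrow>
      \<exists>k C. \<forall>i\<in>I. \<forall>x\<in>supp (F i). norm (pderivs bs (F i) x) \<le> C * q k i"
  shows "F \<in> schwartz_family I q"
  unfolding smooth_family_def
proof (intro CollectI ballI conjI rapidI)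
  fix bs :: "'a list" assume bs: "bs \<in> lists Basis"
  show "pderivs bs (F i) differentiable at x" if "i \<in> I" for i x
    using sm[OF that] bs by (auto simp: smooth_def differentiable_on_def)
  fix N
  obtain k C where C: "\<And>i x. i \<in> I \<Longrightarrow> x \<in> supp (F i) \<Longrightarrow> norm (pderivs bs (F i) x) \<le> C * q k i"
    using bound[OF bs] by blast
  have "(1 + norm x) ^ N * norm (pderivs bs (F i) x) \<le> ((1 + \<bar>R\<bar>) ^ N * \<bar>C\<bar>) * q k i" if i: "i \<in> I" for i x
  proof (cases "x \<in> supp (F i)")
    case True
    have "C * q k i \<le> \<bar>C\<bar> * q k i" using graded_onD(1)[OF q i] by (intro mult_right_mono) auto
    then have "norm (pderivs bs (F i) x) \<le> \<bar>C\<bar> * q k i" using C[OF i True] by linarith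
    then have "(1 + norm x) ^ N * norm (pderivs bs (F i) x) \<le> (1 + \<bar>R\<bar>) ^ N * (\<bar>C\<bar> * q k i)"
      using K[OF i True] by (intro mult_mono power_mono) auto
    then show ?thesis by (simp only: mult.assoc)
  next
    case False
    then show ?thesis using graded_onD(1)[OF q i] by (simp add: pderivs_outside_supp)
  qed
  then show "\<exists>k C. \<forall>i\<in>I. \<forall>x\<in>UNIV. (1 + norm x) ^ N * norm (pderivs bs (F i) x) \<le> C * q k i"
    by blast
qed

lemma test_functions_schwartz:
  fixes f :: "'a::euclidean_space \<Rightarrow> complex"
  assumes "f \<in> test_functions"
  shows "f \<in> schwartz"
proof -
  have f: "smooth f" "compact (supp f)" using assms by (auto simp: test_functions_def)
  obtain R where R: "\<And>x. x \<in> supp f \<Longrightarrow> norm x \<le> R"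
    using compact_imp_bounded[OF f(2)] by (auto simp: bounded_iff)
  have "(\<lambda>_. f) \<in> schwartz_family {()} (\<lambda>_ _. 1)"
  proof (rule compactly_supported_schwartz_family[where R = R])
    fix bs :: "'a list" assume "bs \<in> lists Basis"
    then have "pderivs bs f differentiable_on UNIV" using f(1) by (auto simp: smooth_def)
    then have "continuous_on (supp f) (pderivs bs f)"
      using differentiable_imp_continuous_on continuous_on_subset by blast
    from compact_imp_bounded[OF compact_continuous_image[OF this f(2)]]
    obtain C where "\<And>x. x \<in> supp f \<Longrightarrow> norm (pderivs bs f x) \<le> C" by (auto simp: bounded_iff)
    then show "\<exists>(k::nat) C. \<forall>i\<in>{()}. \<forall>x\<in>supp f. norm (pderivs bs f x) \<le> C * 1"
      by (intro exI[of _ 0] exI[of _ C]) auto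
  qed (use f R in auto)
  then show ?thesis by (simp add: schwartz_iff)
qed

lemma smooth_of_real:
  fixes f :: "'a::euclidean_space \<Rightarrow> real"
  assumes "smooth f"
  shows "smooth (\<lambda>x. complex_of_real (f x))"
proof -
  let ?C = "{\<lambda>(_::unit) x. complex_of_real (pderivs bs f x) |bs. bs \<in> lists Basis}"
  have "(\<lambda>_ x. complex_of_real (f x)) \<in> smooth_family {()} UNIV UNIV"
  proof (rule smooth_family_coinduct[where \<C> = ?C])
    show "(\<lambda>_ x. complex_of_real (f x)) \<in> ?C" by (intro CollectI exI[of _ "[]"]) auto
    fix H assume "H \<in> ?C"
    then obtain bs where bs: "bs \<in> lists Basis" and H: "H = (\<lambda>_ x. complex_of_real (pderivs bs f x))" by blast
    show "\<exists>F'. (\<forall>b\<in>Basis. F' b \<in> ?C) \<and> gradient_on {()} UNIV H F'"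
    proof (intro exI[of _ "\<lambda>b _ x. complex_of_real (pderivs (b # bs) f x)"] conjI ballI gradient_onI)
      fix b :: 'a assume "b \<in> Basis"
      then show "(\<lambda>_ x. complex_of_real (pderivs (b # bs) f x)) \<in> ?C"
        using bs by (intro CollectI exI[of _ "b # bs"]) auto
    next
      fix i :: unit and x :: 'a
      have "pderivs bs f differentiable at x"
        using assms bs by (auto simp: smooth_def differentiable_on_def)
      from has_derivative_of_real[OF has_derivative_pderiv_dir[OF this], where 'a = complex]
      show "(H i has_derivative (\<lambda>v. \<Sum>b\<in>Basis. (v \<bullet> b) *\<^sub>R complex_of_real (pderivs (b # bs) f x))) (at x)"
        unfolding H by (simp add: scaleR_conv_of_real)
    qed
  qed (auto simp: cong_closed_def)
  from smooth_familyD(2)[OF this] show ?thesis by (simp add: smooth_def differentiable_on_def)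
qed

lemma compact_supp_bounded:
  fixes f :: "'a::euclidean_space \<Rightarrow> 'b::zero"
  assumes "supp f \<subseteq> B" "bounded B"
  shows "compact (supp f)"
  using assms bounded_subset unfolding compact_eq_bounded_closed supp_def by blast

text \<open>Besides defining test functions on the sphere, the cutoff removes a neighbourhood of the origin
  from a frequency-side function, and a translate of it serves as a bump function.\<close>

locale sphere_cutoff_function =
  fixes \<Lambda> :: "'a::euclidean_space \<Rightarrow> real"
  assumes cutoff: "sphere_cutoff \<Lambda>"
begin

abbreviation \<Lambda>\<^sub>c :: "'a \<Rightarrow> complex"
  where "\<Lambda>\<^sub>c x \<equiv> of_real (\<Lambda> x)"

lemma supp_cutoff: "supp \<Lambda>\<^sub>c = supp \<Lambda>"
  by (simp add: supp_def)

lemma cutoff_supp: "supp \<Lambda> \<subseteq> ball 0 2" "0 \<notin> supp \<Lambda>"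
  using cutoff unfolding sphere_cutoff_def by blast+

lemma cutoff_sphere: "norm x = 1 \<Longrightarrow> \<Lambda> x = 1"
  using cutoff unfolding sphere_cutoff_def by (metis dist_0_norm mem_sphere)

lemma cutoff_test: "\<Lambda>\<^sub>c \<in> test_functions"
proof -
  have "smooth \<Lambda>" using cutoff unfolding sphere_cutoff_def by blast
  then show ?thesis
    using compact_supp_bounded[OF cutoff_supp(1) bounded_ball] smooth_of_real
    by (simp add: test_functions_def supp_cutoff)
qed

lemma cutoff_flat: "\<Lambda>\<^sub>c \<in> flat_schwartz"
  using test_functions_schwartz[OF cutoff_test] pderivs_outside_supp[of 0 \<Lambda>\<^sub>c] cutoff_supp(2)
  by (simp add: flat_schwartz_def supp_cutoff)

lemma cutoff_mult_flat: "f \<in> schwartz \<Longrightarrow> (\<lambda>x. \<Lambda>\<^sub>c x * f x) \<in> flat_schwartz"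
proof -
  assume f: "f \<in> schwartz"
  have "(\<lambda>x. \<Lambda>\<^sub>c x * f x) \<in> schwartz"
    by (intro schwartz_mult schwartz_multiplier f flat_schwartzD cutoff_flat)
  moreover have "0 \<notin> supp (\<lambda>x. \<Lambda>\<^sub>c x * f x)"
  proof -
    have "supp (\<lambda>x. \<Lambda>\<^sub>c x * f x) \<subseteq> supp \<Lambda>" unfolding supp_def by (intro closure_mono) auto
    then show ?thesis using cutoff_supp(2) by blast
  qed
  ultimately show ?thesis by (simp add: flat_schwartz_def pderivs_outside_supp)
qed

lemma sphere_ext_restrict_flat:
  assumes "f \<in> schwartz"
  shows "sphere_ext \<Lambda> (sphere_restrict f) \<in> flat_schwartz"
  by (rule flat_mult[OF sphere_projection_smooth[OF assms] cutoff_flat])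
    (auto simp: sphere_ext_def sphere_restrict_def)

end

section \<open>Continuous functionals as bounded functionals\<close>

definition linear_on :: "('a \<Rightarrow> complex) set \<Rightarrow> (('a \<Rightarrow> complex) \<Rightarrow> complex) \<Rightarrow> bool"
  where "linear_on A T \<longleftrightarrow>
    (\<forall>f\<in>A. \<forall>g\<in>A. \<forall>a b. T (\<lambda>x. a * f x + b * g x) = a * T f + b * T g)"

definition lin_closed :: "('a \<Rightarrow> complex) set \<Rightarrow> bool"
  where "lin_closed A \<longleftrightarrow> (\<lambda>x. 0) \<in> A \<and>
    (\<forall>f\<in>A. \<forall>g\<in>A. \<forall>a b. (\<lambda>x. a * f x + b * g x) \<in> A)"

definition seminorms_on :: "('a \<Rightarrow> complex) set \<Rightarrow> (nat \<Rightarrow> ('a \<Rightarrow> complex) \<Rightarrow> real) \<Rightarrow> bool"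
  where "seminorms_on V p \<longleftrightarrow> lin_closed V \<and> graded_on V p \<and>
    (\<forall>f\<in>V. \<forall>g\<in>V. \<forall>a b m. p m (\<lambda>x. a * f x + b * g x) \<le> norm a * p m f + norm b * p m g)"

definition seminorm_bounded ::
    "'i set \<Rightarrow> (nat \<Rightarrow> 'i \<Rightarrow> real) \<Rightarrow> ('i \<Rightarrow> complex) \<Rightarrow> bool"
  where "seminorm_bounded A p T \<longleftrightarrow> (\<exists>m C. 0 \<le> C \<and> (\<forall>f\<in>A. norm (T f) \<le> C * p m f))"

lemma lin_closedD:
  assumes "lin_closed A"
  shows "(\<lambda>x. 0) \<in> A"
    and "f \<in> A \<Longrightarrow> g \<in> A \<Longrightarrow> (\<lambda>x. a * f x + b * g x) \<in> A"
    and "f \<in> A \<Longrightarrow> g \<in> A \<Longrightarrow> (\<lambda>x. g x - f x) \<in> A"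
    and "f \<in> A \<Longrightarrow> (\<lambda>x. a * f x) \<in> A"
proof -
  show *: "(\<lambda>x. 0) \<in> A" "f \<in> A \<Longrightarrow> g \<in> A \<Longrightarrow> (\<lambda>x. a * f x + b * g x) \<in> A" for f g a b
    using assms unfolding lin_closed_def by blast+
  show "f \<in> A \<Longrightarrow> g \<in> A \<Longrightarrow> (\<lambda>x. g x - f x) \<in> A" using *(2)[of g f 1 "-1"] by simp
  show "f \<in> A \<Longrightarrow> (\<lambda>x. a * f x) \<in> A" using *(2)[of f f a 0] by simp
qed

lemma linear_onD:
  assumes "linear_on A T"
  shows "f \<in> A \<Longrightarrow> g \<in> A \<Longrightarrow> T (\<lambda>x. a * f x + b * g x) = a * T f + b * T g"
    and "f \<in> A \<Longrightarrow> g \<in> A \<Longrightarrow> T (\<lambda>x. g x - f x) = T g - T f"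
    and "f \<in> A \<Longrightarrow> T (\<lambda>x. a * f x) = a * T f"
    and "f \<in> A \<Longrightarrow> T (\<lambda>x. 0) = 0"
proof -
  have *: "f \<in> A \<Longrightarrow> g \<in> A \<Longrightarrow> T (\<lambda>x. a * f x + b * g x) = a * T f + b * T g" for f g a b
    using assms unfolding linear_on_def by blast
  then show "f \<in> A \<Longrightarrow> g \<in> A \<Longrightarrow> T (\<lambda>x. a * f x + b * g x) = a * T f + b * T g" .
  show "f \<in> A \<Longrightarrow> g \<in> A \<Longrightarrow> T (\<lambda>x. g x - f x) = T g - T f" using *[of g f 1 "-1"] by simp
  show "f \<in> A \<Longrightarrow> T (\<lambda>x. a * f x) = a * T f" using *[of f f a 0] by simp
  show "f \<in> A \<Longrightarrow> T (\<lambda>x. 0) = 0" using *[of f f 0 0] by simp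
qed

lemma seminorms_onD:
  assumes "seminorms_on V p"
  shows "lin_closed V" "graded_on V p" "p m (\<lambda>x. 0) = 0"
    and "f \<in> V \<Longrightarrow> g \<in> V \<Longrightarrow> p m (\<lambda>x. a * f x + b * g x) \<le> norm a * p m f + norm b * p m g"
    and "f \<in> V \<Longrightarrow> p m (\<lambda>x. a * f x) \<le> norm a * p m f"
proof -
  show V: "lin_closed V" "graded_on V p" using assms by (auto simp: seminorms_on_def)
  show *: "p m (\<lambda>x. a * f x + b * g x) \<le> norm a * p m f + norm b * p m g"
    if "f \<in> V" "g \<in> V" for f g a b
    using assms that unfolding seminorms_on_def by blast
  show "p m (\<lambda>x. 0) = 0"
    using *[OF lin_closedD(1)[OF V(1)] lin_closedD(1)[OF V(1)], of 0 0]
      graded_onD(1)[OF V(2) lin_closedD(1)[OF V(1)], of m] by simp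
  show "f \<in> V \<Longrightarrow> p m (\<lambda>x. a * f x) \<le> norm a * p m f" using *[of f f a 0] by simp
qed

text \<open>The subbasic open sets are balls around arbitrary centres. As the seminorms increase with their
  index, every open set contains a single ball around each of its points.\<close>

lemma open_contains_seminorm_ball:
  assumes p: "seminorms_on V p" and U: "openin (seminorm_topology V p) U" and f: "f \<in> U"
  shows "\<exists>m d. 0 < d \<and> (\<forall>g\<in>V. p m (\<lambda>x. g x - f x) < d \<longrightarrow> g \<in> U)"
proof -
  note V = seminorms_onD[OF p]
  let ?S = "{{g \<in> V. p m (\<lambda>x. g x - f x) < e} |f m e. f \<in> V \<and> 0 < e}"
  have top: "f \<in> V" if "f \<in> U" for f
    using openin_subset[OF U] that topspace_seminorm_topology[of p V] V(3) by auto
  have "generate_topology_on ?S U"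
    using U unfolding seminorm_topology_def openin_topology_generated_by_iff .
  from this f top[OF f] show ?thesis
  proof (induction arbitrary: f)
    case (Int A B)
    then have fAB: "f \<in> A" "f \<in> B" by auto
    from Int.IH(1)[OF fAB(1) Int.prems(2)] obtain m d where
      md: "0 < d" "\<And>g. g \<in> V \<Longrightarrow> p m (\<lambda>x. g x - f x) < d \<Longrightarrow> g \<in> A" by blast
    from Int.IH(2)[OF fAB(2) Int.prems(2)] obtain n e where
      ne: "0 < e" "\<And>g. g \<in> V \<Longrightarrow> p n (\<lambda>x. g x - f x) < e \<Longrightarrow> g \<in> B" by blast
    have "g \<in> A \<inter> B" if g: "g \<in> V" "p (max m n) (\<lambda>x. g x - f x) < min d e" for g
    proof -
      have "(\<lambda>x. g x - f x) \<in> V" by (rule lin_closedD(3)[OF V(1) Int.prems(2) g(1)])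
      from graded_onD(2)[OF V(2) this]
      have "p m (\<lambda>x. g x - f x) \<le> p (max m n) (\<lambda>x. g x - f x)"
        "p n (\<lambda>x. g x - f x) \<le> p (max m n) (\<lambda>x. g x - f x)" by auto
      with g md(2) ne(2) show ?thesis by auto
    qed
    with md(1) ne(1) show ?case by (intro exI[of _ "max m n"] exI[of _ "min d e"]) auto
  next
    case (UN K)
    then obtain k where k: "k \<in> K" "f \<in> k" by blast
    from UN.IH[OF k UN.prems(2)] show ?case using k(1) by blast
  next
    case (Basis s)
    then obtain h m e where s: "s = {g \<in> V. p m (\<lambda>x. g x - h x) < e}" and h: "h \<in> V" "0 < e" by blast
    have f: "f \<in> V" "p m (\<lambda>x. f x - h x) < e" using Basis.prems s by auto
    have "g \<in> s" if g: "g \<in> V" "p m (\<lambda>x. g x - f x) < e - p m (\<lambda>x. f x - h x)" for g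
    proof -
      have "(\<lambda>x. 1 * (g x - f x) + 1 * (f x - h x)) = (\<lambda>x. g x - h x)" by auto
      then have "p m (\<lambda>x. g x - h x) \<le> p m (\<lambda>x. g x - f x) + p m (\<lambda>x. f x - h x)"
        using V(4)[OF lin_closedD(3)[OF V(1) f(1) g(1)] lin_closedD(3)[OF V(1) h(1) f(1)], of m 1 1] by simp
      with g show ?thesis by (auto simp: s)
    qed
    with f(2) show ?case by (intro exI[of _ m] exI[of _ "e - p m (\<lambda>x. f x - h x)"]) auto
  qed auto
qed

text \<open>A ball that is mapped into the unit disc gives a linear bound by scaling.\<close>

theorem continuous_dual_iff_bounded:
  assumes p: "seminorms_on V p" and A: "A \<subseteq> V" "lin_closed A"
  shows "T \<in> continuous_dual (subtopology (seminorm_topology V p) A) \<longleftrightarrow>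
    linear_on A T \<and> seminorm_bounded A p T"
proof -
  note V = seminorms_onD[OF p]
  let ?X = "subtopology (seminorm_topology V p) A"
  have top: "topspace ?X = A"
    using topspace_seminorm_topology[of p V, OF V(3)] A(1) by auto
  have "continuous_map ?X euclidean T \<longleftrightarrow> seminorm_bounded A p T" if lin: "linear_on A T"
  proof
    assume cont: "continuous_map ?X euclidean T"
    have T0: "T (\<lambda>x. 0) = 0" by (rule linear_onD(4)[OF lin lin_closedD(1)[OF A(2)]])
    have "openin ?X {f \<in> topspace ?X. T f \<in> ball 0 1}"
      using cont by (rule openin_continuous_map_preimage) simp
    then obtain W where W: "openin (seminorm_topology V p) W" "{f \<in> A. T f \<in> ball 0 1} = W \<inter> A"
      unfolding top openin_subtopology by blast
    have "(\<lambda>x. 0) \<in> {f \<in> A. T f \<in> ball 0 1}"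
      by (rule CollectI, rule conjI[OF lin_closedD(1)[OF A(2)]]) (simp add: T0)
    then have "(\<lambda>x. 0) \<in> W" unfolding W(2) by (rule IntD1)
    from open_contains_seminorm_ball[OF p W(1) this] obtain m d where
      d: "0 < d" "\<And>g. g \<in> V \<Longrightarrow> p m g < d \<Longrightarrow> g \<in> W" by auto
    have small: "norm (T f) < 1" if "f \<in> A" "p m f < d" for f
      using d(2)[of f] that A(1) W(2) by auto
    have "norm (T f) \<le> (2 / d) * p m f" if f: "f \<in> A" for f
    proof -
      have sc: "norm a * norm (T f) < 1" if "norm a * p m f < d" for a :: complex
      proof -
        have "p m (\<lambda>x. a * f x) < d" using V(5)[of f m a] f A(1) that by force
        from small[OF lin_closedD(4)[OF A(2) f] this] show ?thesis
          by (simp add: linear_onD(3)[OF lin f] norm_mult)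
      qed
      have nn: "0 \<le> p m f" using graded_onD(1)[OF V(2)] f A(1) by auto
      show ?thesis
      proof (cases "p m f = 0")
        case True
        have "T f = 0"
        proof (rule ccontr)
          assume "T f \<noteq> 0"
          with sc[of "of_real (1 / norm (T f))"] True d(1) show False by (simp add: norm_divide)
        qed
        with True show ?thesis by simp
      next
        case False
        then have pos: "0 < p m f" using nn by simp
        then have "d / (2 * p m f) * norm (T f) < 1"
          using sc[of "of_real (d / (2 * p m f))"] d(1) by (simp add: norm_divide norm_mult)
        then show ?thesis using pos d(1) by (simp add: field_simps)
      qed
    qed
    with d(1) show "seminorm_bounded A p T"
      unfolding seminorm_bounded_def by (intro exI[of _ m] exI[of _ "2 / d"]) auto
  next
    assume "seminorm_bounded A p T"
    then obtain m C where C: "0 \<le> C" "\<And>f. f \<in> A \<Longrightarrow> norm (T f) \<le> C * p m f"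
      unfolding seminorm_bounded_def by blast
    show "continuous_map ?X euclidean T"
      unfolding continuous_map_def top
    proof (intro conjI allI impI)
      fix U :: "complex set" assume "openin euclidean U"
      then have U: "open U" by simp
      show "openin ?X {f \<in> A. T f \<in> U}"
      proof (subst openin_subopen, intro ballI)
        fix f assume f: "f \<in> {f \<in> A. T f \<in> U}"
        then have fA: "f \<in> A" "f \<in> V" using A(1) by auto
        obtain e where e: "0 < e" "ball (T f) e \<subseteq> U" using f U open_contains_ball by blast
        let ?N = "{g \<in> V. p m (\<lambda>x. g x - f x) < e / (C + 1)}"
        have "openin (seminorm_topology V p) ?N"
          unfolding seminorm_topology_def
          using fA(2) e(1) C(1) by (intro topology_generated_by_Basis) fastforce
        then have "openin ?X (?N \<inter> A)" by (rule openin_subtopology_Int)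
        moreover have "f \<in> ?N \<inter> A" using fA V(3) e(1) C(1) by simp
        moreover have "?N \<inter> A \<subseteq> {f \<in> A. T f \<in> U}"
        proof
          fix g assume g: "g \<in> ?N \<inter> A"
          have "(\<lambda>x. g x - f x) \<in> A" using lin_closedD(3)[OF A(2)] fA g by blast
          have "norm (T g - T f) = norm (T (\<lambda>x. g x - f x))"
            using linear_onD(2)[OF lin fA(1)] g by simp
          also have "\<dots> \<le> C * p m (\<lambda>x. g x - f x)"
            by (rule C(2)[OF \<open>(\<lambda>x. g x - f x) \<in> A\<close>])
          also have "\<dots> \<le> C * (e / (C + 1))" using g C(1) by (intro mult_left_mono) auto
          also have "\<dots> < e" using e(1) C(1) by (simp add: field_simps)
          finally have "T g \<in> ball (T f) e" by (simp add: dist_norm norm_minus_commute)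
          with e(2) g show "g \<in> {f \<in> A. T f \<in> U}" by auto
        qed
        ultimately show "\<exists>N. openin ?X N \<and> f \<in> N \<and> N \<subseteq> {f \<in> A. T f \<in> U}" by blast
      qed
    qed auto
  qed
  then show ?thesis
    unfolding continuous_dual_def top linear_on_def by auto
qed

lemma pderivs_linear:
  fixes f g :: "'a::euclidean_space \<Rightarrow> complex"
  assumes f: "f \<in> schwartz" and g: "g \<in> schwartz" and bs: "bs \<in> lists Basis"
  shows "pderivs bs (\<lambda>x. a * f x + b * g x) x = a * pderivs bs f x + b * pderivs bs g x"
  using bs
proof (induction bs arbitrary: x)
  case (Cons c bs)
  have eq: "pderivs bs (\<lambda>x. a * f x + b * g x) = (\<lambda>x. a * pderivs bs f x + b * pderivs bs g x)"
    using Cons.IH by auto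
  have "((\<lambda>x. a * pderivs bs f x + b * pderivs bs g x) has_derivative
      (\<lambda>v. a * (\<Sum>c\<in>Basis. (v \<bullet> c) *\<^sub>R pderiv_dir c (pderivs bs f) x) +
           b * (\<Sum>c\<in>Basis. (v \<bullet> c) *\<^sub>R pderiv_dir c (pderivs bs g) x))) (at x)"
    using Cons.hyps f g
    by (intro has_derivative_add has_derivative_mult_right has_derivative_pderiv_dir
        schwartz_differentiable schwartz_pderivs)
  moreover have "(\<lambda>v. a * (\<Sum>c\<in>Basis. (v \<bullet> c) *\<^sub>R pderiv_dir c (pderivs bs f) x) +
           b * (\<Sum>c\<in>Basis. (v \<bullet> c) *\<^sub>R pderiv_dir c (pderivs bs g) x)) =
      (\<lambda>v. \<Sum>c\<in>Basis. (v \<bullet> c) *\<^sub>R (a * pderiv_dir c (pderivs bs f) x + b * pderiv_dir c (pderivs bs g) x))"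
    by (simp add: sum_distrib_left sum.distrib scaleR_add_right)
  ultimately have "((\<lambda>x. a * pderivs bs f x + b * pderivs bs g x) has_derivative
      (\<lambda>v. \<Sum>c\<in>Basis. (v \<bullet> c) *\<^sub>R (a * pderiv_dir c (pderivs bs f) x + b * pderiv_dir c (pderivs bs g) x))) (at x)"
    by (rule has_derivative_eq_rhs)
  from pderiv_dir_eqI[OF this Cons.hyps(1)] show ?case by (simp add: eq)
qed simp

lemma sup_seminorm_upper:
  fixes f :: "'a::euclidean_space \<Rightarrow> complex"
  assumes f: "f \<in> schwartz" and W: "\<And>x. 0 \<le> W x" "\<And>x. W x \<le> (1 + norm x) ^ m"
    and bs: "bs \<in> words m" "x \<in> X"
  shows "W x * norm (pderivs bs f x) \<le> (SUP (bs, x)\<in>words m \<times> X. W x * norm (pderivs bs f x))"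
proof -
  have "bdd_above ((\<lambda>(bs, x). W x * norm (pderivs bs f x)) ` (words m \<times> X))"
  proof (rule bdd_aboveI2)
    fix z :: "'a list \<times> 'a" assume "z \<in> words m \<times> X"
    then obtain bs x where z: "z = (bs, x)" "bs \<in> words m" by auto
    have "W x * norm (pderivs bs f x) \<le> (1 + norm x) ^ m * norm (pderivs bs f x)"
      by (intro mult_right_mono W) auto
    also have "\<dots> \<le> schwartz_seminorm m f" by (rule schwartz_seminorm_upper[OF f z(2)])
    finally show "(case z of (bs, x) \<Rightarrow> W x * norm (pderivs bs f x)) \<le> schwartz_seminorm m f"
      using z by simp
  qed
  from cSUP_upper[OF _ this, of "(bs, x)"] bs show ?thesis by simp
qed

text \<open>Covers the seminorms of Schwartz functions and of test functions, with \<open>E\<close> the identity, and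
  those of functions on the sphere, with \<open>E\<close> the extension to the whole space.\<close>

lemma sup_seminorms_on:
  fixes E :: "('c \<Rightarrow> complex) \<Rightarrow> 'a::euclidean_space \<Rightarrow> complex"
  assumes V: "lin_closed V"
    and p: "\<And>m f. p m f = (SUP (bs, x)\<in>words m \<times> X. W m x * norm (pderivs bs (E f) x))"
    and E: "\<And>f. f \<in> V \<Longrightarrow> E f \<in> schwartz"
    and lin: "\<And>f g a b. f \<in> V \<Longrightarrow> g \<in> V \<Longrightarrow> E (\<lambda>x. a * f x + b * g x) = (\<lambda>x. a * E f x + b * E g x)"
    and X: "X \<noteq> {}"
    and W: "\<And>m x. 0 \<le> W m x" "\<And>m x. W m x \<le> (1 + norm x) ^ m" "\<And>m x. W m x \<le> W (Suc m) x"
  shows "seminorms_on V p"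
  unfolding seminorms_on_def
proof (intro conjI V ballI allI)
  note up = sup_seminorm_upper[where X = X, OF E W(1,2), folded p]
  have least: "p m f \<le> C" if "\<And>bs x. bs \<in> words m \<Longrightarrow> x \<in> X \<Longrightarrow> W m x * norm (pderivs bs (E f) x) \<le> C" for m f C
    unfolding p by (rule cSUP_least) (use that X in auto)
  obtain x0 where x0: "x0 \<in> X" using X by blast
  show "graded_on V p"
    unfolding graded_on_def
  proof (intro ballI allI conjI)
    fix f k assume f: "f \<in> V"
    have "0 \<le> W k x0 * norm (pderivs [] (E f) x0)" using W(1) by simp
    also have "\<dots> \<le> p k f" by (rule up[OF f Nil_in_words x0])
    finally show "0 \<le> p k f" .
    show "p k f \<le> p (Suc k) f"
    proof (rule least)
      fix bs x assume bs: "bs \<in> (words k :: 'a list set)" and x: "x \<in> X"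
      have "W k x * norm (pderivs bs (E f) x) \<le> W (Suc k) x * norm (pderivs bs (E f) x)"
        by (intro mult_right_mono W) auto
      also have "\<dots> \<le> p (Suc k) f" using up[OF f _ x, of bs "Suc k"] words_Suc bs by blast
      finally show "W k x * norm (pderivs bs (E f) x) \<le> p (Suc k) f" .
    qed
  qed
  fix f g a b m assume f: "f \<in> V" and g: "g \<in> V"
  show "p m (\<lambda>x. a * f x + b * g x) \<le> norm a * p m f + norm b * p m g"
  proof (rule least)
    fix bs x assume bs: "bs \<in> (words m :: 'a list set)" and x: "x \<in> X"
    then have "bs \<in> lists Basis" by (auto simp: words_def)
    then have "pderivs bs (E (\<lambda>x. a * f x + b * g x)) x = a * pderivs bs (E f) x + b * pderivs bs (E g) x"
      unfolding lin[OF f g] by (rule pderivs_linear[OF E[OF f] E[OF g]])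
    then have "W m x * norm (pderivs bs (E (\<lambda>x. a * f x + b * g x)) x)
        \<le> W m x * (norm a * norm (pderivs bs (E f) x) + norm b * norm (pderivs bs (E g) x))"
      using norm_triangle_ineq[of "a * pderivs bs (E f) x" "b * pderivs bs (E g) x"]
      by (intro mult_left_mono W) (simp add: norm_mult)
    also have "\<dots> = norm a * (W m x * norm (pderivs bs (E f) x)) + norm b * (W m x * norm (pderivs bs (E g) x))"
      by (simp add: algebra_simps)
    also have "\<dots> \<le> norm a * p m f + norm b * p m g"
      by (intro add_mono mult_left_mono up f g bs x) auto
    finally show "W m x * norm (pderivs bs (E (\<lambda>x. a * f x + b * g x)) x) \<le> norm a * p m f + norm b * p m g" .
  qed
qed

lemma lin_closed_schwartz: "lin_closed (schwartz :: ('a::euclidean_space \<Rightarrow> complex) set)"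
proof -
  have "(\<lambda>_. 0) \<in> (schwartz :: ('a \<Rightarrow> complex) set)"
    by (auto simp: schwartz_def smooth_def)
  then show ?thesis using schwartz_linear by (auto simp: lin_closed_def)
qed

lemma seminorms_on_schwartz: "seminorms_on schwartz schwartz_seminorm"
proof (rule sup_seminorms_on[where E = "\<lambda>f. f" and X = UNIV and W = "\<lambda>m x. (1 + norm x) ^ m"])
  show "(1 + norm x) ^ m \<le> (1 + norm x) ^ Suc m" for m and x :: 'a
    by (intro power_increasing) auto
qed (auto simp: lin_closed_schwartz schwartz_seminorm_def)

lemma tempered_iff:
  fixes T :: "('a::euclidean_space \<Rightarrow> complex) \<Rightarrow> complex"
  shows
  "T \<in> tempered_distributions \<longleftrightarrow> linear_on schwartz T \<and> seminorm_bounded schwartz schwartz_seminorm T"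
  using continuous_dual_iff_bounded[OF seminorms_on_schwartz order_refl lin_closed_schwartz, of T]
    subtopology_topspace[of "schwartz_topology :: ('a \<Rightarrow> complex) topology"]
  unfolding tempered_distributions_def topspace_schwartz_topology unfolding schwartz_topology_def by simp

lemma flat_linear:
  fixes f g :: "'a::euclidean_space \<Rightarrow> complex"
  assumes "f \<in> flat_schwartz" "g \<in> flat_schwartz"
  shows "(\<lambda>x. a * f x + b * g x) \<in> flat_schwartz"
  unfolding flat_schwartz_def
proof (intro CollectI conjI ballI)
  show "(\<lambda>x. a * f x + b * g x) \<in> schwartz"
    by (intro schwartz_linear flat_schwartzD assms)
  fix bs :: "'a list" assume bs: "bs \<in> lists Basis"
  have "pderivs bs f 0 = 0" "pderivs bs g 0 = 0"
    using assms bs unfolding flat_schwartz_def by blast+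
  then show "pderivs bs (\<lambda>x. a * f x + b * g x) 0 = 0"
    using pderivs_linear[OF flat_schwartzD(1)[OF assms(1)] flat_schwartzD(1)[OF assms(2)] bs] by simp
qed

lemma fourier_linear:
  fixes f g :: "'a::euclidean_space \<Rightarrow> complex"
  assumes "f \<in> schwartz" "g \<in> schwartz"
  shows "fourier (\<lambda>x. a * f x + b * g x) = (\<lambda>\<xi>. a * fourier f \<xi> + b * fourier g \<xi>)"
proof
  fix \<xi> :: 'a
  let ?e = "\<lambda>x. exp (- \<i> * of_real (x \<bullet> \<xi>))"
  have "fourier (\<lambda>x. a * f x + b * g x) \<xi> = (\<integral>x. a * (?e x * f x) + b * (?e x * g x) \<partial>lborel)"
    unfolding fourier_def by (intro Bochner_Integration.integral_cong) (auto simp: algebra_simps)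
  also have "\<dots> = (\<integral>x. a * (?e x * f x) \<partial>lborel) + (\<integral>x. b * (?e x * g x) \<partial>lborel)"
    by (intro Bochner_Integration.integral_add integrable_mult_right fourier_integrable assms)
  finally show "fourier (\<lambda>x. a * f x + b * g x) \<xi> = a * fourier f \<xi> + b * fourier g \<xi>"
    by (simp add: fourier_def)
qed

lemma lin_closed_lizorkin: "lin_closed (lizorkin :: ('a::euclidean_space \<Rightarrow> complex) set)"
  unfolding lin_closed_def
proof (intro conjI ballI allI)
  have "(\<lambda>x. 0) \<in> (schwartz :: ('a \<Rightarrow> complex) set)" by (rule lin_closedD(1)[OF lin_closed_schwartz])
  then show "(\<lambda>x. 0) \<in> (lizorkin :: ('a \<Rightarrow> complex) set)" by (simp add: lizorkin_def)
  fix f g :: "'a \<Rightarrow> complex" and a b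
  assume "f \<in> lizorkin" "g \<in> lizorkin"
  then have fg: "f \<in> schwartz" "fourier f \<in> flat_schwartz" "g \<in> schwartz" "fourier g \<in> flat_schwartz"
    by (simp_all add: lizorkin_iff)
  then show "(\<lambda>x. a * f x + b * g x) \<in> lizorkin"
    unfolding lizorkin_iff fourier_linear[OF fg(1,3)] by (intro conjI schwartz_linear flat_linear)
qed

lemma lizorkin_schwartz: "lizorkin \<subseteq> schwartz"
  by (auto simp: lizorkin_def)

lemma lizorkin_dual_iff:
  "T \<in> lizorkin_dual \<longleftrightarrow> linear_on lizorkin T \<and> seminorm_bounded lizorkin schwartz_seminorm T"
  unfolding lizorkin_dual_def schwartz_topology_def
  by (rule continuous_dual_iff_bounded[OF seminorms_on_schwartz lizorkin_schwartz lin_closed_lizorkin])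

lemma supp_linear_subset:
  fixes f g :: "'a::topological_space \<Rightarrow> complex"
  assumes "supp f \<subseteq> K" "supp g \<subseteq> K" "closed K"
  shows "supp (\<lambda>x. a * f x + b * g x) \<subseteq> K"
  unfolding supp_def
proof (rule closure_minimal[OF _ assms(3)])
  show "{x. a * f x + b * g x \<noteq> 0} \<subseteq> K"
  proof
    fix x assume x: "x \<in> {x. a * f x + b * g x \<noteq> 0}"
    show "x \<in> K"
    proof (rule ccontr)
      assume "x \<notin> K"
      then have "f x = 0" "g x = 0" using assms(1,2) by (auto intro: zero_outside_supp)
      with x show False by simp
    qed
  qed
qed

lemma test_functions_linear:
  fixes f g :: "'a::euclidean_space \<Rightarrow> complex"
  assumes f: "f \<in> test_functions" and g: "g \<in> test_functions"
  shows "(\<lambda>x. a * f x + b * g x) \<in> test_functions"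
proof -
  have "(\<lambda>x. a * f x + b * g x) \<in> schwartz"
    by (intro schwartz_linear test_functions_schwartz f g)
  then have "smooth (\<lambda>x. a * f x + b * g x)" by (simp add: schwartz_def)
  moreover have K: "compact (supp f \<union> supp g)" using f g by (auto simp: test_functions_def)
  have "compact (supp (\<lambda>x. a * f x + b * g x))"
  proof (rule compact_supp_bounded[OF supp_linear_subset])
    show "bounded (supp f \<union> supp g)" "closed (supp f \<union> supp g)"
      using K compact_imp_bounded compact_imp_closed by blast+
  qed auto
  ultimately show ?thesis by (simp add: test_functions_def)
qed

lemma zero_test_function: "(\<lambda>x. 0) \<in> test_functions" "supp (\<lambda>x. 0) = {}"
  by (auto simp: test_functions_def smooth_def supp_def)

lemma supported_test_functions:
  fixes K :: "'a::euclidean_space set"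
  assumes K: "compact K"
  shows "lin_closed {\<phi> \<in> test_functions. supp \<phi> \<subseteq> K}"
    and "seminorms_on {\<phi> \<in> test_functions. supp \<phi> \<subseteq> K} sup_seminorm"
proof -
  show lc: "lin_closed {\<phi> \<in> test_functions. supp \<phi> \<subseteq> K}"
    unfolding lin_closed_def
    using zero_test_function test_functions_linear supp_linear_subset[OF _ _ compact_imp_closed[OF K]]
    by auto
  show "seminorms_on {\<phi> \<in> test_functions. supp \<phi> \<subseteq> K} sup_seminorm"
    by (rule sup_seminorms_on[where E = "\<lambda>f. f" and X = UNIV and W = "\<lambda>m x. 1", OF lc])
      (auto simp: sup_seminorm_def test_functions_schwartz)
qed

lemma distributions_iff:
  fixes T :: "('a::euclidean_space \<Rightarrow> complex) \<Rightarrow> complex"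
  shows
  "T \<in> distributions \<longleftrightarrow> (\<forall>K. compact K \<longrightarrow> linear_on {\<phi> \<in> test_functions. supp \<phi> \<subseteq> K} T \<and>
    seminorm_bounded {\<phi> \<in> test_functions. supp \<phi> \<subseteq> K} sup_seminorm T)"
proof -
  have "T \<in> continuous_dual (test_topology_on K) \<longleftrightarrow> linear_on {\<phi> \<in> test_functions. supp \<phi> \<subseteq> K} T \<and>
    seminorm_bounded {\<phi> \<in> test_functions. supp \<phi> \<subseteq> K} sup_seminorm T" if K: "compact K" for K :: "'a set"
    using continuous_dual_iff_bounded[OF supported_test_functions(2)[OF K] order_refl supported_test_functions(1)[OF K], of T]
      subtopology_topspace[of "test_topology_on K"]
    unfolding topspace_test_topology_on unfolding test_topology_on_def by simp
  then show ?thesis by (auto simp: distributions_def)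
qed

lemma supported_test_functions_family:
  fixes K :: "'a::euclidean_space set"
  assumes K: "compact K"
  shows "(\<lambda>\<phi>. \<phi>) \<in> schwartz_family {\<phi> \<in> test_functions. supp \<phi> \<subseteq> K} sup_seminorm"
proof -
  obtain R where R: "\<And>x. x \<in> K \<Longrightarrow> norm x \<le> R"
    using compact_imp_bounded[OF K] by (auto simp: bounded_iff)
  show ?thesis
  proof (rule compactly_supported_schwartz_family[where R = R])
    show "graded_on {\<phi> \<in> test_functions. supp \<phi> \<subseteq> K} sup_seminorm"
      by (rule seminorms_onD(2)[OF supported_test_functions(2)[OF K]])
    fix bs :: "'a list" assume bs: "bs \<in> lists Basis"
    have "norm (pderivs bs \<phi> x) \<le> 1 * sup_seminorm (length bs) \<phi>" if "\<phi> \<in> test_functions" for \<phi> x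
      using sup_seminorm_upper[OF test_functions_schwartz[OF that], of "\<lambda>x. 1" "length bs" bs x UNIV] bs
      by (auto simp: sup_seminorm_def words_def)
    then show "\<exists>k C. \<forall>\<phi>\<in>{\<phi> \<in> test_functions. supp \<phi> \<subseteq> K}. \<forall>x\<in>supp \<phi>.
        norm (pderivs bs \<phi> x) \<le> C * sup_seminorm k \<phi>" by blast
  qed (use R in \<open>auto simp: test_functions_def\<close>)
qed

context sphere_cutoff_function
begin

lemma sphere_ext_linear:
  "sphere_ext \<Lambda> (\<lambda>x. a * \<tau> x + b * \<sigma> x) = (\<lambda>x. a * sphere_ext \<Lambda> \<tau> x + b * sphere_ext \<Lambda> \<sigma> x)"
  by (auto simp: sphere_ext_def algebra_simps)

lemma sphere_ext_test: "\<tau> \<in> sphere_test_functions \<Lambda> \<Longrightarrow> sphere_ext \<Lambda> \<tau> \<in> test_functions"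
  by (simp add: sphere_test_functions_def)

lemma lin_closed_sphere_test_functions: "lin_closed (sphere_test_functions \<Lambda>)"
proof -
  have "sphere_ext \<Lambda> (\<lambda>x. 0) = (\<lambda>x. 0)" by (auto simp: sphere_ext_def)
  then show ?thesis
    using zero_test_function test_functions_linear
    by (auto simp: lin_closed_def sphere_test_functions_def sphere_ext_linear)
qed

lemma seminorms_on_sphere: "seminorms_on (sphere_test_functions \<Lambda>) (sphere_seminorm \<Lambda>)"
  by (rule sup_seminorms_on[where E = "sphere_ext \<Lambda>" and X = "ball 0 2" and W = "\<lambda>m x. 1",
        OF lin_closed_sphere_test_functions])
    (auto simp: sphere_seminorm_def test_functions_schwartz sphere_ext_test sphere_ext_linear)

lemma sphere_distributions_iff:
  "T \<in> sphere_distributions \<Lambda> \<longleftrightarrow> linear_on (sphere_test_functions \<Lambda>) T \<and>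
    seminorm_bounded (sphere_test_functions \<Lambda>) (sphere_seminorm \<Lambda>) T"
  using continuous_dual_iff_bounded[OF seminorms_on_sphere order_refl lin_closed_sphere_test_functions, of T]
    subtopology_topspace[of "seminorm_topology (sphere_test_functions \<Lambda>) (sphere_seminorm \<Lambda>)"]
  unfolding topspace_sphere_topology sphere_distributions_def by simp

lemma supp_sphere_ext: "supp (sphere_ext \<Lambda> \<tau>) \<subseteq> supp \<Lambda>"
  unfolding supp_def by (intro closure_mono) (auto simp: sphere_ext_def)

lemma sphere_ext_family: "sphere_ext \<Lambda> \<in> schwartz_family (sphere_test_functions \<Lambda>) (sphere_seminorm \<Lambda>)"
proof (rule compactly_supported_schwartz_family[where R = 2])
  show "graded_on (sphere_test_functions \<Lambda>) (sphere_seminorm \<Lambda>)"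
    by (rule seminorms_onD(2)[OF seminorms_on_sphere])
  have ball: "x \<in> ball 0 2" if "x \<in> supp (sphere_ext \<Lambda> \<tau>)" for x \<tau>
    using that supp_sphere_ext cutoff_supp(1) by blast
  show "norm x \<le> 2" if "x \<in> supp (sphere_ext \<Lambda> \<tau>)" for x \<tau>
    using ball[OF that] by simp
  show "smooth (sphere_ext \<Lambda> \<tau>)" if "\<tau> \<in> sphere_test_functions \<Lambda>" for \<tau>
    using sphere_ext_test[OF that] by (simp add: test_functions_def)
  fix bs :: "'a list" assume bs: "bs \<in> lists Basis"
  have "norm (pderivs bs (sphere_ext \<Lambda> \<tau>) x) \<le> 1 * sphere_seminorm \<Lambda> (length bs) \<tau>"
    if "\<tau> \<in> sphere_test_functions \<Lambda>" "x \<in> ball 0 2" for \<tau> x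
    using sup_seminorm_upper[OF test_functions_schwartz[OF sphere_ext_test[OF that(1)]],
        of "\<lambda>x. 1" "length bs" bs x "ball 0 2"] bs that(2)
    by (auto simp: sphere_seminorm_def words_def)
  with ball show "\<exists>k C. \<forall>\<tau>\<in>sphere_test_functions \<Lambda>. \<forall>x\<in>supp (sphere_ext \<Lambda> \<tau>).
      norm (pderivs bs (sphere_ext \<Lambda> \<tau>) x) \<le> C * sphere_seminorm \<Lambda> k \<tau>" by blast
qed

end

text \<open>A bounded functional composed with a continuous operator, the latter given as a family.\<close>

lemma seminorm_bounded_family:
  fixes F :: "'i \<Rightarrow> 'a::euclidean_space \<Rightarrow> complex"
  assumes T: "seminorm_bounded A schwartz_seminorm T"
    and q: "graded_on I q" and F: "F \<in> schwartz_family I q" "\<And>i. i \<in> I \<Longrightarrow> F i \<in> A"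
  shows "seminorm_bounded I q (\<lambda>i. T (F i))"
proof -
  obtain m C where C: "0 \<le> C" "\<And>f. f \<in> A \<Longrightarrow> norm (T f) \<le> C * schwartz_seminorm m f"
    using T unfolding seminorm_bounded_def by blast
  obtain k D where D: "D \<ge> 0" "\<And>i. i \<in> I \<Longrightarrow> schwartz_seminorm m (F i) \<le> D * q k i"
    by (rule schwartz_family_seminorm[OF q F(1)]) blast
  have "norm (T (F i)) \<le> (C * D) * q k i" if i: "i \<in> I" for i
  proof -
    have "norm (T (F i)) \<le> C * schwartz_seminorm m (F i)" by (rule C(2)[OF F(2)[OF i]])
    also have "\<dots> \<le> C * (D * q k i)" by (intro mult_left_mono D i C(1))
    finally show ?thesis by simp
  qed
  with C(1) D(1) show ?thesis
    unfolding seminorm_bounded_def by (intro exI[of _ k] exI[of _ "C * D"]) auto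
qed

lemma linear_on_compose:
  assumes "linear_on A T" "\<And>f. f \<in> B \<Longrightarrow> F f \<in> A"
    "\<And>f g a b. f \<in> B \<Longrightarrow> g \<in> B \<Longrightarrow> F (\<lambda>x. a * f x + b * g x) = (\<lambda>x. a * F f x + b * F g x)"
  shows "linear_on B (\<lambda>f. T (F f))"
  unfolding linear_on_def using assms(2,3) linear_onD(1)[OF assms(1)] by simp

lemma add_tempered:
  fixes S T :: "('a::euclidean_space \<Rightarrow> complex) \<Rightarrow> complex" and k :: complex
  assumes A: "A \<subseteq> schwartz" and S: "linear_on A S" "seminorm_bounded A schwartz_seminorm S"
    and T: "linear_on schwartz T" "seminorm_bounded schwartz schwartz_seminorm T"
  shows "linear_on A (\<lambda>\<psi>. S \<psi> + k * T \<psi>) \<and> seminorm_bounded A schwartz_seminorm (\<lambda>\<psi>. S \<psi> + k * T \<psi>)"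
proof
  show "linear_on A (\<lambda>\<psi>. S \<psi> + k * T \<psi>)"
    unfolding linear_on_def
  proof (intro ballI allI)
    fix f g a b assume fg: "f \<in> A" "g \<in> A"
    then have "f \<in> schwartz" "g \<in> schwartz" using A by auto
    with fg show "S (\<lambda>x. a * f x + b * g x) + k * T (\<lambda>x. a * f x + b * g x) = a * (S f + k * T f) + b * (S g + k * T g)"
      by (simp add: linear_onD(1)[OF S(1)] linear_onD(1)[OF T(1)] algebra_simps)
  qed
  obtain m C where C: "0 \<le> C" "\<And>f. f \<in> A \<Longrightarrow> norm (S f) \<le> C * schwartz_seminorm m f"
    using S(2) unfolding seminorm_bounded_def by blast
  obtain n D where D: "0 \<le> D" "\<And>f. f \<in> schwartz \<Longrightarrow> norm (T f) \<le> D * schwartz_seminorm n f"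
    using T(2) unfolding seminorm_bounded_def by blast
  have "norm (S f + k * T f) \<le> (C + norm k * D) * schwartz_seminorm (max m n) f" if f: "f \<in> A" for f
  proof -
    have fs: "f \<in> schwartz" using A f by blast
    have "norm (S f + k * T f) \<le> norm (S f) + norm k * norm (T f)"
      using norm_triangle_ineq[of "S f" "k * T f"] by (simp add: norm_mult)
    also have "\<dots> \<le> C * schwartz_seminorm m f + norm k * (D * schwartz_seminorm n f)"
      by (intro add_mono mult_left_mono C(2) D(2) f fs) auto
    also have "\<dots> \<le> C * schwartz_seminorm (max m n) f + norm k * (D * schwartz_seminorm (max m n) f)"
      using graded_onD(2)[OF graded_schwartz_seminorm fs] C(1) D(1)
      by (intro add_mono mult_left_mono) auto
    finally show ?thesis by (simp add: algebra_simps)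
  qed
  then show "seminorm_bounded A schwartz_seminorm (\<lambda>\<psi>. S \<psi> + k * T \<psi>)"
    unfolding seminorm_bounded_def using C(1) D(1)
    by (intro exI[of _ "max m n"] exI[of _ "C + norm k * D"]) auto
qed

lemma schwartz_lipschitz:
  fixes f :: "'a::euclidean_space \<Rightarrow> complex"
  assumes f: "f \<in> schwartz"
  shows "norm (f x - f y) \<le> (real DIM('a) * schwartz_seminorm 1 f) * norm (x - y)"
proof (rule differentiable_bound[OF convex_UNIV])
  fix z :: 'a
  show "(f has_derivative (\<lambda>v. \<Sum>b\<in>Basis. (v \<bullet> b) *\<^sub>R pderiv_dir b f z)) (at z within UNIV)"
    using has_derivative_pderiv_dir[OF schwartz_differentiable[OF f]] by simp
  show "onorm (\<lambda>v. \<Sum>b\<in>Basis. (v \<bullet> b) *\<^sub>R pderiv_dir b f z) \<le> real DIM('a) * schwartz_seminorm 1 f"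
  proof (intro onorm_le norm_sum_coordinates_le)
    fix b :: 'a assume "b \<in> Basis"
    then have "(1 + norm z) ^ 1 * norm (pderivs [b] f z) \<le> schwartz_seminorm 1 f"
      by (intro schwartz_seminorm_upper[OF f]) (auto simp: words_def)
    moreover have "norm (pderiv_dir b f z) \<le> (1 + norm z) ^ 1 * norm (pderivs [b] f z)"
      using mult_right_mono[of 1 "1 + norm z" "norm (pderiv_dir b f z)"] by simp
    ultimately show "norm (pderiv_dir b f z) \<le> schwartz_seminorm 1 f"
      by (rule order_trans[rotated])
  qed
qed auto

text \<open>The quotient is bounded by a multiple of \<open>|x|\<close>, uniformly in \<open>e\<close>; its derivatives have the form
  \<open>e^n f (e x)\<close> with Schwartz functions \<open>f\<close>. Dividing by \<open>e\<close> records the rate at which the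
  truncations \<open>\<eta> (e x) g x\<close> converge to \<open>g\<close>.\<close>

lemma truncation_multiplier:
  fixes \<eta> :: "'a::euclidean_space \<Rightarrow> complex"
  assumes \<eta>: "\<eta> \<in> schwartz" "\<eta> 0 = 1"
  shows "(\<lambda>e x. (1 - \<eta> (e *\<^sub>R x)) / of_real e) \<in> multiplier_family {0<..1::real}"
proof -
  let ?m = "\<lambda>(e::real) x. (1 - \<eta> (e *\<^sub>R x)) / of_real e"
  let ?I = "{0<..1::real}"
  let ?C = "insert ?m {\<lambda>e x. of_real e ^ n * f (e *\<^sub>R x) |n f. f \<in> schwartz}"
  have dil: "((\<lambda>x. f (e *\<^sub>R x)) has_derivative (\<lambda>v. \<Sum>b\<in>Basis. (v \<bullet> b) *\<^sub>R (of_real e * pderiv_dir b f (e *\<^sub>R x)))) (at x)"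
    if "f \<in> schwartz" for f :: "'a \<Rightarrow> complex" and e x
  proof -
    have 1: "((\<lambda>x. e *\<^sub>R x) has_derivative (\<lambda>v. e *\<^sub>R v)) (at x)" by (auto intro!: derivative_eq_intros)
    from has_derivative_compose[OF 1 has_derivative_pderiv_dir[OF schwartz_differentiable[OF that]]]
    show ?thesis by (simp add: scaleR_conv_of_real mult_ac)
  qed
  show ?thesis
  proof (rule smooth_family_coinduct[where \<C> = ?C, OF open_UNIV cong_closed_moderate])
    fix F assume F: "F \<in> ?C"
    show "F \<in> moderate ?I UNIV (\<lambda>x. 1 + norm x)"
      using F
    proof
      assume F: "F = ?m"
      let ?L = "real DIM('a) * schwartz_seminorm 1 \<eta>"
      have L: "0 \<le> ?L" using graded_onD(1)[OF graded_schwartz_seminorm \<eta>(1)] by simp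
      show ?thesis
      proof (rule moderateI[where C = ?L and k = 1])
        fix e :: real and x :: 'a assume e: "e \<in> ?I"
        have "norm (\<eta> 0 - \<eta> (e *\<^sub>R x)) \<le> ?L * norm (0 - e *\<^sub>R x)" by (rule schwartz_lipschitz[OF \<eta>(1)])
        then have "norm (F e x) \<le> ?L * norm x" using e by (simp add: F \<eta>(2) norm_divide field_simps)
        also have "\<dots> \<le> ?L * (1 + norm x) ^ 1" using L by (intro mult_left_mono) auto
        finally show "norm (F e x) \<le> ?L * (1 + norm x) ^ 1" .
      qed
    next
      assume "F \<in> {\<lambda>e x. of_real e ^ n * f (e *\<^sub>R x) |n f. f \<in> schwartz}"
      then obtain n f where F: "F = (\<lambda>e x. of_real e ^ n * f (e *\<^sub>R x))" and f: "f \<in> schwartz" by blast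
      obtain C where C: "C \<ge> 0" "\<And>x. norm (f x) \<le> C" using schwartz_bounded[OF f] by metis
      show ?thesis
      proof (rule moderateI[where C = C and k = 0])
        fix e :: real and x :: 'a assume e: "e \<in> ?I"
        then have "\<bar>e\<bar> ^ n \<le> 1" by (intro power_le_one) auto
        then have "\<bar>e\<bar> ^ n * norm (f (e *\<^sub>R x)) \<le> 1 * C" by (intro mult_mono C) auto
        then show "norm (F e x) \<le> C * (1 + norm x) ^ 0" by (simp add: F norm_mult norm_power)
      qed
    qed
    show "\<exists>F'. (\<forall>b\<in>Basis. F' b \<in> ?C) \<and> gradient_on ?I UNIV F F'"
      using F
    proof
      assume F: "F = ?m"
      show ?thesis
      \<comment> \<open>The gradient is put as a linear combination because linearity gives membership in the class.\<close>
      proof (intro exI[of _ "\<lambda>b e x. of_real e ^ 0 * (- 1 * pderiv_dir b \<eta> (e *\<^sub>R x) + 0 * pderiv_dir b \<eta> (e *\<^sub>R x))"] conjI ballI gradient_onI)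
        fix b :: 'a assume b: "b \<in> Basis"
        show "(\<lambda>e x. of_real e ^ 0 * (- 1 * pderiv_dir b \<eta> (e *\<^sub>R x) + 0 * pderiv_dir b \<eta> (e *\<^sub>R x))) \<in> ?C"
          using schwartz_linear[OF schwartz_pderiv_dir[OF \<eta>(1) b] schwartz_pderiv_dir[OF \<eta>(1) b], of "- 1" 0]
          by (intro insertI2 CollectI exI[of _ 0] exI[of _ "\<lambda>x. - 1 * pderiv_dir b \<eta> x + 0 * pderiv_dir b \<eta> x"] conjI refl)
      next
        fix e :: real and x :: 'a assume e: "e \<in> ?I"
        have "((\<lambda>x. (1 - \<eta> (e *\<^sub>R x)) * (1 / of_real e)) has_derivative
            (\<lambda>v. (0 - (\<Sum>b\<in>Basis. (v \<bullet> b) *\<^sub>R (of_real e * pderiv_dir b \<eta> (e *\<^sub>R x)))) * (1 / of_real e))) (at x)"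
          by (intro has_derivative_mult_left has_derivative_diff has_derivative_const dil \<eta>(1))
        moreover have "(\<lambda>v. (0 - (\<Sum>b\<in>Basis. (v \<bullet> b) *\<^sub>R (of_real e * pderiv_dir b \<eta> (e *\<^sub>R x)))) * (1 / of_real e)) =
            (\<lambda>v. \<Sum>b\<in>Basis. (v \<bullet> b) *\<^sub>R (of_real e ^ 0 * (- 1 * pderiv_dir b \<eta> (e *\<^sub>R x) + 0 * pderiv_dir b \<eta> (e *\<^sub>R x))))"
        proof
          fix v :: 'a
          have "(\<Sum>b\<in>Basis. (v \<bullet> b) *\<^sub>R (of_real e * pderiv_dir b \<eta> (e *\<^sub>R x))) =
              of_real e * (\<Sum>b\<in>Basis. (v \<bullet> b) *\<^sub>R pderiv_dir b \<eta> (e *\<^sub>R x))"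
            by (simp add: sum_distrib_left)
          then show "(0 - (\<Sum>b\<in>Basis. (v \<bullet> b) *\<^sub>R (of_real e * pderiv_dir b \<eta> (e *\<^sub>R x)))) * (1 / of_real e) =
            (\<Sum>b\<in>Basis. (v \<bullet> b) *\<^sub>R (of_real e ^ 0 * (- 1 * pderiv_dir b \<eta> (e *\<^sub>R x) + 0 * pderiv_dir b \<eta> (e *\<^sub>R x))))"
            using e by (simp add: sum_negf)
        qed
        ultimately show "(F e has_derivative (\<lambda>v. \<Sum>b\<in>Basis. (v \<bullet> b) *\<^sub>R
            (of_real e ^ 0 * (- 1 * pderiv_dir b \<eta> (e *\<^sub>R x) + 0 * pderiv_dir b \<eta> (e *\<^sub>R x))))) (at x)"
          unfolding F by (simp add: has_derivative_eq_rhs)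
      qed
    next
      assume "F \<in> {\<lambda>e x. of_real e ^ n * f (e *\<^sub>R x) |n f. f \<in> schwartz}"
      then obtain n f where F: "F = (\<lambda>e x. of_real e ^ n * f (e *\<^sub>R x))" and f: "f \<in> schwartz" by blast
      show ?thesis
      proof (intro exI[of _ "\<lambda>b e x. of_real e ^ Suc n * pderiv_dir b f (e *\<^sub>R x)"] conjI ballI gradient_onI)
        fix b :: 'a assume b: "b \<in> Basis"
        show "(\<lambda>e x. of_real e ^ Suc n * pderiv_dir b f (e *\<^sub>R x)) \<in> ?C"
          by (intro insertI2 CollectI exI[of _ "Suc n"] exI[of _ "pderiv_dir b f"] conjI refl schwartz_pderiv_dir f b)
      next
        fix e :: real and x :: 'a
        from has_derivative_mult_right[OF dil[OF f], of "of_real e ^ n" e x]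
        show "(F e has_derivative (\<lambda>v. \<Sum>b\<in>Basis. (v \<bullet> b) *\<^sub>R (of_real e ^ Suc n * pderiv_dir b f (e *\<^sub>R x)))) (at x)"
          unfolding F by (simp add: sum_distrib_left mult_ac)
      qed
    qed
  qed auto
qed

section \<open>Tempered distributions\<close>

lemma flat_reflect_scale:
  fixes f :: "'a::euclidean_space \<Rightarrow> complex"
  assumes f: "f \<in> flat_schwartz"
  shows "(\<lambda>x. c * f (- x)) \<in> flat_schwartz"
proof -
  let ?C = "{\<lambda>(_::unit) (x::'a). k * g (- x) |k g. g \<in> flat_schwartz}"
  have F: "(\<lambda>_ x. c * f (- x)) \<in> ?C" using f by blast
  have step: "\<exists>F'. (\<forall>b\<in>Basis. F' b \<in> ?C) \<and> gradient_on {()} UNIV F F'" if "F \<in> ?C" for F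
  proof -
    from that obtain k g where F: "F = (\<lambda>_ x. k * g (- x))" and g: "g \<in> flat_schwartz" by blast
    show ?thesis
    proof (intro exI[of _ "\<lambda>b _ x. (- k) * pderiv_dir b g (- x)"] conjI ballI gradient_onI)
      fix b :: 'a assume "b \<in> Basis"
      then have "pderiv_dir b g \<in> flat_schwartz" using flat_pderivs[OF g, of "[b]"] by simp
      then show "(\<lambda>_ x. (- k) * pderiv_dir b g (- x)) \<in> ?C" by blast
    next
      fix i :: unit and x :: 'a
      have 1: "((\<lambda>x. - x) has_derivative (\<lambda>v. - v)) (at x)" by (auto intro!: derivative_eq_intros)
      from has_derivative_mult_right[OF has_derivative_compose[OF 1 has_derivative_pderiv_dir[OF
            schwartz_differentiable[OF flat_schwartzD(1)[OF g]]]], of k]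
      show "(F i has_derivative (\<lambda>v. \<Sum>b\<in>Basis. (v \<bullet> b) *\<^sub>R ((- k) * pderiv_dir b g (- x)))) (at x)"
        unfolding F by (simp add: sum_distrib_left sum_negf)
    qed
  qed
  have "pderivs bs (\<lambda>x. c * f (- x)) 0 = 0" if bs: "bs \<in> lists Basis" for bs
  proof -
    have "\<exists>G\<in>?C. \<forall>x. pderivs bs (\<lambda>x. c * f (- x)) x = G () x"
    proof (rule pderivs_in_closed_class[of UNIV ?C "{()}", OF open_UNIV step F bs])
      fix G assume "G \<in> ?C" and
        eq: "\<And>i x. i \<in> {()} \<Longrightarrow> x \<in> UNIV \<Longrightarrow> pderivs bs (\<lambda>x. c * f (- x)) x = G i x"
      then show ?thesis by (intro bexI[of _ G] allI eq) auto
    qed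
    then obtain G where G: "G \<in> ?C" "\<And>x. pderivs bs (\<lambda>x. c * f (- x)) x = G () x" by blast
    from G(1) have "G () 0 = 0" by (auto simp: flat_schwartzD(2))
    with G(2)[of 0] show ?thesis by simp
  qed
  moreover have "(\<lambda>x. c * f (- x)) \<in> schwartz"
    by (rule lin_closedD(4)[OF lin_closed_schwartz schwartz_reflect[OF flat_schwartzD(1)[OF f]]])
  ultimately show ?thesis by (simp add: flat_schwartz_def)
qed

lemma tempered_fourier_dist:
  assumes "T \<in> tempered_distributions"
  shows "fourier_dist T \<in> tempered_distributions"
proof -
  have T: "linear_on schwartz T" "seminorm_bounded schwartz schwartz_seminorm T"
    using assms by (simp_all add: tempered_iff)
  have "linear_on schwartz (\<lambda>f. T (fourier f))"
    by (rule linear_on_compose[OF T(1) fourier_schwartz fourier_linear])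
  moreover have "seminorm_bounded schwartz schwartz_seminorm (\<lambda>f. T (fourier f))"
    by (rule seminorm_bounded_family[OF T(2) graded_schwartz_seminorm
          fourier_family[OF graded_schwartz_seminorm schwartz_identity_family] fourier_schwartz])
  ultimately show ?thesis unfolding tempered_iff fourier_dist_def by blast
qed

lemma tempered_distributions_subset:
  "tempered_distributions \<subseteq> (distributions :: (('a::euclidean_space \<Rightarrow> complex) \<Rightarrow> complex) set)"
proof
  fix T :: "('a \<Rightarrow> complex) \<Rightarrow> complex"
  assume "T \<in> tempered_distributions"
  then have T: "linear_on schwartz T" "seminorm_bounded schwartz schwartz_seminorm T"
    by (simp_all add: tempered_iff)
  show "T \<in> distributions"
    unfolding distributions_iff
  proof (intro allI impI conjI)
    fix K :: "'a set" assume K: "compact K"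
    let ?V = "{\<phi> \<in> test_functions. supp \<phi> \<subseteq> K}"
    show "linear_on ?V T"
      using T(1) test_functions_schwartz unfolding linear_on_def by blast
    show "seminorm_bounded ?V sup_seminorm T"
      by (rule seminorm_bounded_family[OF T(2) seminorms_onD(2)[OF supported_test_functions(2)[OF K]]
            supported_test_functions_family[OF K]]) (auto intro: test_functions_schwartz)
  qed
qed

text \<open>The difference between \<open>g\<close> and its truncation is \<open>e\<close> times a bounded family, so \<open>T g = O(e)\<close>.\<close>

lemma truncation_limit:
  fixes T :: "('a::euclidean_space \<Rightarrow> complex) \<Rightarrow> complex"
  assumes T: "T \<in> tempered_distributions" and g: "g \<in> schwartz"
    and \<eta>: "\<eta> \<in> schwartz" "\<eta> 0 = 1"
    and zero: "\<And>e::real. 0 < e \<Longrightarrow> T (\<lambda>x. \<eta> (e *\<^sub>R x) * g x) = 0"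
  shows "T g = 0"
proof -
  have lin: "linear_on schwartz T" and bd: "seminorm_bounded schwartz schwartz_seminorm T"
    using T by (simp_all add: tempered_iff)
  let ?F = "\<lambda>(e::real) x. (1 - \<eta> (e *\<^sub>R x)) / of_real e * g x"
  let ?I = "{0<..1::real}"
  have F: "?F \<in> schwartz_family ?I (\<lambda>_ _. 1)"
    by (rule schwartz_family_mult[OF graded_on_const_one truncation_multiplier[OF \<eta>] schwartz_constant_family[OF g]])
  from seminorm_bounded_family[OF bd graded_on_const_one F schwartz_family_member[OF F]]
  obtain C where C0: "\<forall>e\<in>?I. norm (T (?F e)) \<le> C * 1"
    unfolding seminorm_bounded_def by blast
  have C: "norm (T (?F e)) \<le> C" if "e \<in> ?I" for e
    using bspec[OF C0 that] by (simp only: mult_1_right)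
  have bound: "norm (T g) \<le> e * C" if e: "e \<in> ?I" for e
  proof -
    have cut: "(\<lambda>x. \<eta> (e *\<^sub>R x) * g x) \<in> schwartz"
      using schwartz_mult[OF schwartz_multiplier[OF schwartz_affine[OF \<eta>(1), of e 0]] g] e by simp
    have "of_real e * ?F e x = (1 - \<eta> (e *\<^sub>R x)) * g x" for x using e by simp
    then have "g = (\<lambda>x. of_real e * ?F e x + 1 * (\<eta> (e *\<^sub>R x) * g x))"
      by (simp only:) (simp add: left_diff_distrib)
    then have "T g = T (\<lambda>x. of_real e * ?F e x + 1 * (\<eta> (e *\<^sub>R x) * g x))" by (rule arg_cong)
    also have "\<dots> = of_real e * T (?F e) + 1 * T (\<lambda>x. \<eta> (e *\<^sub>R x) * g x)"
      by (rule linear_onD(1)[OF lin schwartz_family_member[OF F e] cut])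
    finally have "T g = of_real e * T (?F e)" using zero[of e] e by simp
    then have "norm (T g) = e * norm (T (?F e))" using e by (simp add: norm_mult)
    also have "\<dots> \<le> e * C" using C[OF e] e by (intro mult_left_mono) auto
    finally show ?thesis .
  qed
  have "norm (T g) \<le> 0"
  proof (rule field_le_epsilon)
    fix d :: real assume d: "0 < d"
    \<comment> \<open>Small enough for the bound to fall below d, with 1 added against a vanishing C.\<close>
    let ?e = "min 1 (d / (\<bar>C\<bar> + 1))"
    have e: "?e \<in> ?I" using d by simp
    have "norm (T g) \<le> ?e * C" by (rule bound[OF e])
    also have "\<dots> \<le> ?e * (\<bar>C\<bar> + 1)" using e by (intro mult_left_mono) auto
    also have "\<dots> \<le> d / (\<bar>C\<bar> + 1) * (\<bar>C\<bar> + 1)" by (intro mult_right_mono) auto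
    also have "\<dots> = d" by simp
    finally show "norm (T g) \<le> 0 + d" by simp
  qed
  then show ?thesis by simp
qed

section \<open>The distribution with density 1 / (2 log) off the sphere\<close>

lemma AE_norm_neq: "AE x in lborel. norm (x::'a::euclidean_space) \<noteq> r"
proof -
  have "sphere (0::'a) r \<in> null_sets lborel"
    using negligible_sphere[of "0::'a" r] unfolding negligible_iff_null_sets
    by (subst (asm) null_sets_completion_iff) auto
  from AE_not_in[OF this] show ?thesis by simp
qed

text \<open>With this bound a Lipschitz estimate for the numerator compensates the zero of the logarithm on
  the unit sphere in the inner integrand of \<open>E_log_hat\<close>.\<close>

lemma log_norm_lower:
  fixes r :: real
  assumes "0 < r" "r < 2"
  shows "\<bar>r - 1\<bar> \<le> 2 * \<bar>ln r\<bar>"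
proof (cases "1 \<le> r")
  case True
  have "- ln r \<le> 1 / r - 1" using ln_le_minus_one[of "1 / r"] assms by (simp add: ln_div)
  then have "(r - 1) / r \<le> ln r" using assms by (simp add: field_simps)
  moreover have "(r - 1) / 2 \<le> (r - 1) / r" using True assms by (intro divide_left_mono) auto
  ultimately have "(r - 1) / 2 \<le> ln r" by linarith
  then show ?thesis using True by (auto simp: abs_if)
next
  case False
  then have "1 - r \<le> - ln r" using ln_le_minus_one[of r] assms by simp
  with False assms show ?thesis by linarith
qed

abbreviation inner_region :: "'a::euclidean_space set"
  where "inner_region \<equiv> {\<xi>. \<bar>norm \<xi> - 1\<bar> < 1}"

abbreviation outer_region :: "'a::euclidean_space set"
  where "outer_region \<equiv> {\<xi>. norm \<xi> > 2}"

abbreviation inner_quotient :: "('a::euclidean_space \<Rightarrow> complex) \<Rightarrow> 'a \<Rightarrow> complex"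
  where "inner_quotient \<phi> \<equiv> (\<lambda>\<xi>. (\<phi> \<xi> - \<phi> (\<xi> /\<^sub>R norm \<xi>)) / of_real (ln (norm \<xi>)))"

abbreviation outer_quotient :: "('a::euclidean_space \<Rightarrow> complex) \<Rightarrow> 'a \<Rightarrow> complex"
  where "outer_quotient \<phi> \<equiv> (\<lambda>\<xi>. \<phi> \<xi> / of_real (ln (norm \<xi>)))"

lemma inner_quotient_integrable:
  fixes \<phi> :: "'a::euclidean_space \<Rightarrow> complex"
  assumes \<phi>: "\<phi> \<in> schwartz"
  defines "L \<equiv> real DIM('a) * schwartz_seminorm 1 \<phi>"
  shows "set_integrable lborel inner_region (inner_quotient \<phi>)"
    and "norm (LINT \<xi>:inner_region|lborel. inner_quotient \<phi> \<xi>) \<le> 2 * L * measure lborel (inner_region :: 'a set)"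
proof -
  note [measurable] = schwartz_borel[OF \<phi>]
  have L: "0 \<le> L" unfolding L_def using graded_onD(1)[OF graded_schwartz_seminorm \<phi>] by simp
  have sets: "(inner_region :: 'a set) \<in> sets lborel" by measurable
  have fin: "emeasure lborel (inner_region :: 'a set) < \<infinity>"
    by (rule emeasure_bounded_finite, rule bounded_subset[of "ball 0 2"]) auto
  have le: "norm (inner_quotient \<phi> \<xi>) \<le> 2 * L" if "\<xi> \<in> inner_region" for \<xi>
  proof (cases "norm \<xi> = 1")
    case True
    then show ?thesis using L by simp
  next
    case False
    have r: "0 < norm \<xi>" "norm \<xi> < 2" using that by auto
    have ln: "ln (norm \<xi>) \<noteq> 0" using False r by simp
    have "\<xi> - \<xi> /\<^sub>R norm \<xi> = (1 - 1 / norm \<xi>) *\<^sub>R \<xi>" by (simp add: algebra_simps divide_inverse)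
    then have "norm (\<xi> - \<xi> /\<^sub>R norm \<xi>) = \<bar>1 - 1 / norm \<xi>\<bar> * norm \<xi>" by simp
    also have "\<dots> = \<bar>norm \<xi> - 1\<bar>" using r by (simp add: abs_if field_simps)
    finally have "norm (\<phi> \<xi> - \<phi> (\<xi> /\<^sub>R norm \<xi>)) \<le> L * \<bar>norm \<xi> - 1\<bar>"
      using schwartz_lipschitz[OF \<phi>, of \<xi> "\<xi> /\<^sub>R norm \<xi>"] by (simp add: L_def)
    also have "\<dots> \<le> L * (2 * \<bar>ln (norm \<xi>)\<bar>)" by (intro mult_left_mono log_norm_lower r L)
    finally show ?thesis using ln by (simp add: norm_divide field_simps)
  qed
  have dom: "integrable lborel (\<lambda>\<xi>::'a. 2 * L * indicator inner_region \<xi>)"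
    using sets fin by (intro integrable_mult_right integrable_real_indicator) auto
  show int: "set_integrable lborel inner_region (inner_quotient \<phi>)"
    unfolding set_integrable_def
  proof (rule Bochner_Integration.integrable_bound[OF dom])
    show "AE \<xi> in lborel. norm (indicator inner_region \<xi> *\<^sub>R inner_quotient \<phi> \<xi>) \<le> norm (2 * L * indicator inner_region \<xi>)"
      using le L by (intro always_eventually allI) (auto simp: indicator_def)
  qed measurable
  have "norm (LINT \<xi>:inner_region|lborel. inner_quotient \<phi> \<xi>)
      \<le> (\<integral>\<xi>. norm (indicator inner_region \<xi> *\<^sub>R inner_quotient \<phi> \<xi>) \<partial>lborel)"
    unfolding set_lebesgue_integral_def by (rule integral_norm_bound)
  also have "\<dots> \<le> (\<integral>\<xi>. 2 * L * indicator inner_region \<xi> \<partial>(lborel :: 'a measure))"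
  proof (rule integral_mono[OF _ dom])
    show "integrable lborel (\<lambda>\<xi>. norm (indicator inner_region \<xi> *\<^sub>R inner_quotient \<phi> \<xi>))"
      using int unfolding set_integrable_def by (rule integrable_norm)
    show "norm (indicator inner_region \<xi> *\<^sub>R inner_quotient \<phi> \<xi>) \<le> 2 * L * indicator inner_region \<xi>" for \<xi>
      using le[of \<xi>] by (auto simp: indicator_def)
  qed
  also have "\<dots> = 2 * L * measure lborel (inner_region :: 'a set)"
    using sets fin by simp
  finally show "norm (LINT \<xi>:inner_region|lborel. inner_quotient \<phi> \<xi>) \<le> 2 * L * measure lborel (inner_region :: 'a set)" .
qed

lemma outer_quotient_integrable:
  fixes \<phi> :: "'a::euclidean_space \<Rightarrow> complex"
  assumes \<phi>: "\<phi> \<in> schwartz"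
  shows "set_integrable lborel outer_region (outer_quotient \<phi>)"
    and "norm (LINT \<xi>:outer_region|lborel. outer_quotient \<phi> \<xi>) \<le> (1 / ln 2) * (\<integral>\<xi>. norm (\<phi> \<xi>) \<partial>lborel)"
proof -
  note [measurable] = schwartz_borel[OF \<phi>]
  have le: "norm (outer_quotient \<phi> \<xi>) \<le> (1 / ln 2) * norm (\<phi> \<xi>)" if "\<xi> \<in> outer_region" for \<xi>
  proof -
    have "ln 2 \<le> ln (norm \<xi>)" using that by (subst ln_le_cancel_iff) auto
    moreover have pos: "0 < ln (norm \<xi>)" using \<open>ln 2 \<le> ln (norm \<xi>)\<close> ln_gt_zero[of "2::real"] by linarith
    ultimately have "norm (\<phi> \<xi>) / ln (norm \<xi>) \<le> norm (\<phi> \<xi>) / ln 2"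
      by (intro divide_left_mono mult_pos_pos) auto
    with pos show ?thesis by (simp add: norm_divide)
  qed
  have dom: "integrable lborel (\<lambda>\<xi>. (1 / ln 2) * norm (\<phi> \<xi>))"
    by (intro integrable_mult_right integrable_norm schwartz_integrable \<phi>)
  have le': "norm (indicator outer_region \<xi> *\<^sub>R outer_quotient \<phi> \<xi>) \<le> (1 / ln 2) * norm (\<phi> \<xi>)" for \<xi>
    using le[of \<xi>] by (auto simp: indicator_def)
  show int: "set_integrable lborel outer_region (outer_quotient \<phi>)"
    unfolding set_integrable_def
  proof (rule Bochner_Integration.integrable_bound[OF dom])
    show "AE \<xi> in lborel. norm (indicator outer_region \<xi> *\<^sub>R outer_quotient \<phi> \<xi>) \<le> norm ((1 / ln 2) * norm (\<phi> \<xi>))"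
      using le' by (intro always_eventually allI) (auto intro: order_trans[OF le' abs_ge_self])
  qed measurable
  have "norm (LINT \<xi>:outer_region|lborel. outer_quotient \<phi> \<xi>)
      \<le> (\<integral>\<xi>. norm (indicator outer_region \<xi> *\<^sub>R outer_quotient \<phi> \<xi>) \<partial>lborel)"
    unfolding set_lebesgue_integral_def by (rule integral_norm_bound)
  also have "\<dots> \<le> (\<integral>\<xi>. (1 / ln 2) * norm (\<phi> \<xi>) \<partial>lborel)"
    by (rule integral_mono[OF integrable_norm[OF int[unfolded set_integrable_def]] dom le'])
  also have "\<dots> = (1 / ln 2) * (\<integral>\<xi>. norm (\<phi> \<xi>) \<partial>lborel)"
    by (rule integral_mult_right_zero)
  finally show "norm (LINT \<xi>:outer_region|lborel. outer_quotient \<phi> \<xi>) \<le> (1 / ln 2) * (\<integral>\<xi>. norm (\<phi> \<xi>) \<partial>lborel)" .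
qed

lemma set_integral_linear:
  fixes f g :: "'a \<Rightarrow> complex"
  assumes "set_integrable M A f" "set_integrable M A g"
  shows "(LINT x:A|M. a * f x + b * g x) = a * (LINT x:A|M. f x) + b * (LINT x:A|M. g x)"
  using assms by (simp add: set_integral_add)

lemma E_log_hat_linear: "linear_on schwartz E_log_hat"
  unfolding linear_on_def
proof (intro ballI allI)
  fix f g :: "'a \<Rightarrow> complex" and a b
  assume f: "f \<in> schwartz" and g: "g \<in> schwartz"
  let ?h = "\<lambda>x. a * f x + b * g x"
  have "(LINT \<xi>:inner_region|lborel. inner_quotient ?h \<xi>) =
      (LINT \<xi>:inner_region|lborel. a * inner_quotient f \<xi> + b * inner_quotient g \<xi>)"
    unfolding set_lebesgue_integral_def
    by (intro Bochner_Integration.integral_cong) (auto simp: diff_divide_distrib add_divide_distrib algebra_simps)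
  also have "\<dots> = a * (LINT \<xi>:inner_region|lborel. inner_quotient f \<xi>) + b * (LINT \<xi>:inner_region|lborel. inner_quotient g \<xi>)"
    by (rule set_integral_linear[OF inner_quotient_integrable(1)[OF f] inner_quotient_integrable(1)[OF g]])
  finally have 1: "(LINT \<xi>:inner_region|lborel. inner_quotient ?h \<xi>) =
      a * (LINT \<xi>:inner_region|lborel. inner_quotient f \<xi>) + b * (LINT \<xi>:inner_region|lborel. inner_quotient g \<xi>)" .
  have "(LINT \<xi>:outer_region|lborel. outer_quotient ?h \<xi>) =
      (LINT \<xi>:outer_region|lborel. a * outer_quotient f \<xi> + b * outer_quotient g \<xi>)"
    unfolding set_lebesgue_integral_def
    by (intro Bochner_Integration.integral_cong) (auto simp: add_divide_distrib)
  also have "\<dots> = a * (LINT \<xi>:outer_region|lborel. outer_quotient f \<xi>) + b * (LINT \<xi>:outer_region|lborel. outer_quotient g \<xi>)"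
    by (rule set_integral_linear[OF outer_quotient_integrable(1)[OF f] outer_quotient_integrable(1)[OF g]])
  finally have 2: "(LINT \<xi>:outer_region|lborel. outer_quotient ?h \<xi>) =
      a * (LINT \<xi>:outer_region|lborel. outer_quotient f \<xi>) + b * (LINT \<xi>:outer_region|lborel. outer_quotient g \<xi>)" .
  show "E_log_hat ?h = a * E_log_hat f + b * E_log_hat g"
    unfolding E_log_hat_def 1 2 by (simp add: algebra_simps)
qed

lemma E_log_hat_bounded:
  "seminorm_bounded schwartz schwartz_seminorm (E_log_hat :: ('a::euclidean_space \<Rightarrow> complex) \<Rightarrow> complex)"
proof -
  let ?n = "DIM('a) + 2"
  let ?J = "\<integral>x. 1 / (1 + norm (x::'a)) ^ ?n \<partial>lborel"
  let ?A = "real DIM('a) * measure lborel (inner_region :: 'a set)"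
  let ?B = "(1 / ln 2) * ?J"
  have J: "0 \<le> ?J" by (intro integral_nonneg_AE always_eventually allI) simp
  have "norm (E_log_hat \<phi>) \<le> (?A + ?B) * schwartz_seminorm ?n \<phi>" if \<phi>: "\<phi> \<in> schwartz" for \<phi> :: "'a \<Rightarrow> complex"
  proof -
    let ?p = "schwartz_seminorm ?n \<phi>"
    have p: "0 \<le> ?p" "schwartz_seminorm 1 \<phi> \<le> ?p"
      using graded_onD[OF graded_schwartz_seminorm \<phi>] by auto
    have "(1 + norm x) ^ ?n * norm (\<phi> x) \<le> ?p" for x
      using schwartz_seminorm_upper[OF \<phi> Nil_in_words, of x ?n] by simp
    then have "(\<integral>\<xi>. norm (\<phi> \<xi>) \<partial>lborel) \<le> ?p * ?J"
      by (rule integrable_rapid_bound(2)[OF schwartz_borel[OF \<phi>]])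
    then have "(1 / ln 2) * (\<integral>\<xi>. norm (\<phi> \<xi>) \<partial>lborel) \<le> (1 / ln 2) * (?p * ?J)"
      by (intro mult_left_mono) auto
    from order_trans[OF outer_quotient_integrable(2)[OF \<phi>] this]
    have 2: "norm (LINT \<xi>:outer_region|lborel. outer_quotient \<phi> \<xi>) \<le> ?B * ?p" by (simp only: mult_ac)
    have "2 * (real DIM('a) * schwartz_seminorm 1 \<phi>) * measure lborel (inner_region :: 'a set)
        \<le> 2 * (real DIM('a) * ?p) * measure lborel (inner_region :: 'a set)"
      using p(2) by (intro mult_right_mono mult_left_mono) auto
    from order_trans[OF inner_quotient_integrable(2)[OF \<phi>] this]
    have 1: "norm (LINT \<xi>:inner_region|lborel. inner_quotient \<phi> \<xi>) \<le> 2 * (?A * ?p)" by (simp only: mult_ac)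
    have "norm (E_log_hat \<phi>) \<le> norm (1/2 * (LINT \<xi>:inner_region|lborel. inner_quotient \<phi> \<xi>))
        + norm (1/2 * (LINT \<xi>:outer_region|lborel. outer_quotient \<phi> \<xi>))"
      unfolding E_log_hat_def by (rule norm_triangle_ineq)
    also have "\<dots> = 1/2 * norm (LINT \<xi>:inner_region|lborel. inner_quotient \<phi> \<xi>)
        + 1/2 * norm (LINT \<xi>:outer_region|lborel. outer_quotient \<phi> \<xi>)"
      by (simp add: norm_mult)
    also have "\<dots> \<le> ?A * ?p + ?B * ?p"
      using 1 2 norm_ge_zero[of "LINT \<xi>:outer_region|lborel. outer_quotient \<phi> \<xi>"] by linarith
    finally show ?thesis by (simp only: distrib_right)
  qed
  moreover have "0 \<le> ?A + ?B" using J by (intro add_nonneg_nonneg mult_nonneg_nonneg) auto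
  ultimately show ?thesis unfolding seminorm_bounded_def by blast
qed

lemma E_log_hat_tempered: "E_log_hat \<in> tempered_distributions"
  unfolding tempered_iff by (intro conjI E_log_hat_linear E_log_hat_bounded)

text \<open>The product vanishes on the unit sphere, so the subtracted term disappears and the logarithms
  cancel. The two regions together miss only the origin and the sphere of radius 2.\<close>

lemma E_log_hat_log_multiply:
  fixes h :: "'a::euclidean_space \<Rightarrow> complex"
  assumes h: "h \<in> flat_schwartz"
  shows "E_log_hat (log_multiply h) = (\<integral>\<xi>. h \<xi> \<partial>lborel)"
proof -
  let ?g = "log_multiply h"
  note hs = flat_schwartzD(1)[OF h]
  note [measurable] = schwartz_borel[OF hs] schwartz_borel[OF flat_schwartzD(1)[OF flat_log_multiply[OF h]]]
  have 1: "(LINT \<xi>:inner_region|lborel. inner_quotient ?g \<xi>) = (LINT \<xi>:inner_region|lborel. 2 * h \<xi>)"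
    unfolding set_lebesgue_integral_def
  proof (rule integral_cong_AE)
    show "AE \<xi> in lborel. indicator inner_region \<xi> *\<^sub>R inner_quotient ?g \<xi> = indicator inner_region \<xi> *\<^sub>R (2 * h \<xi>)"
      using AE_norm_neq[of 1]
    proof eventually_elim
      case (elim \<xi>)
      show ?case
      proof (cases "\<xi> \<in> inner_region")
        case True
        then have "\<xi> \<noteq> 0" by auto
        then have ln: "ln (norm \<xi>) \<noteq> 0" using elim by simp
        have "norm (\<xi> /\<^sub>R norm \<xi>) = 1" using \<open>\<xi> \<noteq> 0\<close> by simp
        then have "?g (\<xi> /\<^sub>R norm \<xi>) = 0" by (simp only: log_multiply_def) simp
        then have "inner_quotient ?g \<xi> = ?g \<xi> / of_real (ln (norm \<xi>))" by (simp only: diff_zero)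
        also have "\<dots> = 2 * h \<xi>" using ln by (simp add: log_multiply_def)
        finally show ?thesis by (simp only:)
      qed simp
    qed
  qed measurable
  have 2: "(LINT \<xi>:outer_region|lborel. outer_quotient ?g \<xi>) = (LINT \<xi>:outer_region|lborel. 2 * h \<xi>)"
    unfolding set_lebesgue_integral_def
  proof (intro Bochner_Integration.integral_cong refl)
    fix \<xi> :: 'a
    show "indicator outer_region \<xi> *\<^sub>R outer_quotient ?g \<xi> = indicator outer_region \<xi> *\<^sub>R (2 * h \<xi>)"
    proof (cases "\<xi> \<in> outer_region")
      case True
      then have "0 < norm \<xi>" "norm \<xi> \<noteq> 1" by auto
      then have "ln (norm \<xi>) \<noteq> 0" by simp
      then show ?thesis by (simp add: log_multiply_def)
    qed simp
  qed
  have int: "set_integrable lborel S (\<lambda>\<xi>. 2 * h \<xi>)" if "S \<in> sets lborel" for S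
    unfolding set_integrable_def using that hs
    by (intro integrable_mult_indicator integrable_mult_right schwartz_integrable)
  have "(LINT \<xi>:inner_region|lborel. 2 * h \<xi>) + (LINT \<xi>:outer_region|lborel. 2 * h \<xi>)
      = (LINT \<xi>:inner_region \<union> outer_region|lborel. 2 * h \<xi>)"
  proof (intro set_integral_Un[symmetric] int)
    show "(inner_region :: 'a set) \<in> sets lborel" "(outer_region :: 'a set) \<in> sets lborel"
      by measurable
  qed auto
  also have "\<dots> = (\<integral>\<xi>. 2 * h \<xi> \<partial>lborel)"
    unfolding set_lebesgue_integral_def
  proof (rule integral_cong_AE)
    show "AE \<xi> in lborel. indicator (inner_region \<union> outer_region) \<xi> *\<^sub>R (2 * h \<xi>) = 2 * h \<xi>"
      using AE_norm_neq[of 0] AE_norm_neq[of 2]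
    proof eventually_elim
      case (elim \<xi>)
      then have "\<xi> \<in> inner_region \<union> outer_region" by (auto simp: abs_if)
      then show ?case by simp
    qed
  qed measurable
  finally have "(LINT \<xi>:inner_region|lborel. 2 * h \<xi>) + (LINT \<xi>:outer_region|lborel. 2 * h \<xi>)
      = 2 * (\<integral>\<xi>. h \<xi> \<partial>lborel)" by simp
  then show ?thesis
    unfolding E_log_hat_def 1 2 distrib_left[symmetric] by simp
qed

text \<open>The projection to the unit sphere leaves the support of \<open>\<phi>\<close>, so the subtracted term is zero.
  At \<open>\<xi> = 0\<close> both integrands are 0 by the conventions for \<open>ln 0\<close> and division by zero.\<close>

lemma E_log_hat_near_origin:
  fixes \<phi> :: "'a::euclidean_space \<Rightarrow> complex"
  assumes supp: "supp \<phi> \<subseteq> V" and V: "V \<subseteq> ball 0 (1/2)"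
  shows "E_log_hat \<phi> = (LINT \<xi>:V|lborel. (1 / of_real (2 * ln (norm \<xi>))) * \<phi> \<xi>)"
proof -
  have out: "\<phi> \<xi> = 0" if "\<xi> \<notin> V" for \<xi>
    using zero_outside_supp[of \<xi> \<phi>] supp that by blast
  have outer: "outer_quotient \<phi> \<xi> = 0" if "\<xi> \<in> outer_region" for \<xi>
  proof -
    have "\<xi> \<notin> ball 0 (1/2)" using that by simp
    then have "\<xi> \<notin> V" using V by blast
    then show ?thesis by (simp add: out)
  qed
  have "(LINT \<xi>:outer_region|lborel. outer_quotient \<phi> \<xi>) = (\<integral>\<xi>. 0 \<partial>(lborel :: 'a measure))"
    unfolding set_lebesgue_integral_def
    by (intro Bochner_Integration.integral_cong refl) (use outer in \<open>auto simp: indicator_def\<close>)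
  then have 2: "(LINT \<xi>:outer_region|lborel. outer_quotient \<phi> \<xi>) = 0" by simp
  have "indicator inner_region \<xi> *\<^sub>R inner_quotient \<phi> \<xi> =
      2 * (indicator V \<xi> *\<^sub>R ((1 / of_real (2 * ln (norm \<xi>))) * \<phi> \<xi>))" for \<xi>
  proof (cases "\<xi> = 0")
    case True
    then show ?thesis by simp
  next
    case False
    have "\<xi> /\<^sub>R norm \<xi> \<notin> V" using V False by auto
    then have 0: "\<phi> (\<xi> /\<^sub>R norm \<xi>) = 0" by (rule out)
    show ?thesis
    proof (cases "\<xi> \<in> V")
      case True
      then have "\<xi> \<in> inner_region" using V False by (auto simp: abs_if)
      with True 0 show ?thesis by simp
    next
      case False
      then show ?thesis using out[OF False] 0 by simp
    qed
  qed
  then have "(LINT \<xi>:inner_region|lborel. inner_quotient \<phi> \<xi>) =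
      2 * (LINT \<xi>:V|lborel. (1 / of_real (2 * ln (norm \<xi>))) * \<phi> \<xi>)"
    unfolding set_lebesgue_integral_def by (simp only: integral_mult_right_zero)
  with 2 show ?thesis unfolding E_log_hat_def by simp
qed

lemma inverse_log_locally_integrable:
  assumes V: "V \<subseteq> ball (0::'a::euclidean_space) (1/2)"
  shows "locally_integrable_on V (\<lambda>\<xi>. 1 / of_real (2 * ln (norm \<xi>)))"
  unfolding locally_integrable_on_def
proof (intro allI impI)
  fix K :: "'a set" assume K: "compact K \<and> K \<subseteq> V"
  have sets: "K \<in> sets lborel" using K by (simp add: borel_compact)
  have fin: "emeasure lborel K < \<infinity>" using K by (intro emeasure_bounded_finite compact_imp_bounded) auto
  have le: "norm (1 / complex_of_real (2 * ln (norm \<xi>))) \<le> 1 / (2 * ln 2)" if "\<xi> \<in> K" for \<xi>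
  proof (cases "\<xi> = 0")
    case False
    have "norm \<xi> < 1/2" using that K V by auto
    then have "ln (norm \<xi>) \<le> ln (1/2)" using False by (subst ln_le_cancel_iff) auto
    then have l: "ln 2 \<le> - ln (norm \<xi>)" by (simp add: ln_div)
    have "0 < ln (2::real)" by simp
    with l have neg: "ln (norm \<xi>) < 0" by linarith
    from l \<open>0 < ln (2::real)\<close> neg have "1 / (2 * (- ln (norm \<xi>))) \<le> 1 / (2 * ln 2)"
      by (intro divide_left_mono mult_left_mono mult_pos_pos) auto
    moreover have "\<bar>ln (norm \<xi>)\<bar> = - ln (norm \<xi>)" using l \<open>0 < ln (2::real)\<close> by linarith
    ultimately show ?thesis by (simp add: norm_divide norm_mult)
  qed simp
  show "set_integrable lborel K (\<lambda>\<xi>. 1 / complex_of_real (2 * ln (norm \<xi>)))"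
    unfolding set_integrable_def
  proof (rule Bochner_Integration.integrable_bound)
    show "integrable lborel (\<lambda>\<xi>. 1 / (2 * ln 2) * indicator K \<xi> :: real)"
      using sets fin by (intro integrable_mult_right integrable_real_indicator) auto
    show "AE \<xi> in lborel. norm (indicator K \<xi> *\<^sub>R (1 / complex_of_real (2 * ln (norm \<xi>)))) \<le> norm (1 / (2 * ln 2) * indicator K \<xi> :: real)"
      using le by (intro always_eventually allI) (auto simp: indicator_def)
  qed (use sets in measurable)
qed

section \<open>The logarithmic Laplacian on the frequency side\<close>

context sphere_cutoff_function
begin

text \<open>Translation by a unit vector moves the value 1 on the unit sphere to the origin.\<close>

definition bump :: "'a \<Rightarrow> complex"
  where "bump x = \<Lambda>\<^sub>c (x + (SOME b. b \<in> Basis))"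

lemma bump_schwartz: "bump \<in> schwartz"
  using schwartz_affine[OF flat_schwartzD(1)[OF cutoff_flat], of 1 "SOME b. b \<in> Basis"]
  by (simp add: bump_def[abs_def])

lemma bump_0: "bump 0 = 1"
  using SOME_Basis by (simp add: bump_def cutoff_sphere)

text \<open>This is \<open>(2 \<pi>)^d\<close>; what matters is that it is not zero.\<close>

definition fourier_constant :: complex
  where "fourier_constant = (\<integral>\<xi>. fourier bump \<xi> \<partial>lborel)"

definition inverse_fourier :: "('a \<Rightarrow> complex) \<Rightarrow> 'a \<Rightarrow> complex"
  where "inverse_fourier f x = (1 / fourier_constant) * fourier f (- x)"

lemma fourier_twice:
  fixes f :: "'a \<Rightarrow> complex"
  assumes "f \<in> schwartz"
  shows "fourier (fourier f) = (\<lambda>x. fourier_constant * f (- x))"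
  unfolding fourier_constant_def by (rule ext, rule fourier_fourier[OF assms bump_schwartz bump_0])

lemma fourier_constant_neq_0: "fourier_constant \<noteq> 0"
  unfolding fourier_constant_def by (rule fourier_constant_nonzero[OF bump_schwartz bump_0])

lemma fourier_scaled_reflect:
  fixes f :: "'a \<Rightarrow> complex"
  assumes f: "f \<in> schwartz"
  shows "fourier (\<lambda>x. c * f (- x)) \<xi> = c * fourier f (- \<xi>)"
proof -
  have "fourier (\<lambda>x. c * f (- x)) \<xi> = (\<integral>x. c * (exp (- \<i> * of_real (- x \<bullet> - \<xi>)) * f (- x)) \<partial>lborel)"
    unfolding fourier_def by (intro Bochner_Integration.integral_cong) auto
  also have "\<dots> = c * (\<integral>x. exp (- \<i> * of_real (- x \<bullet> - \<xi>)) * f (- x) \<partial>lborel)"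
    by (rule integral_mult_right_zero)
  also have "(\<integral>x. exp (- \<i> * of_real (- x \<bullet> - \<xi>)) * f (- x) \<partial>lborel) = fourier f (- \<xi>)"
    unfolding fourier_def by (rule integral_reflect_lborel[OF fourier_integrable[OF f]])
  finally show ?thesis .
qed

lemma inverse_fourier_family: "inverse_fourier \<in> schwartz_family schwartz schwartz_seminorm"
proof -
  note q = graded_schwartz_seminorm
  have "(\<lambda>f x. (1 / fourier_constant) * fourier f ((- 1) *\<^sub>R x + 0)) \<in> schwartz_family schwartz schwartz_seminorm"
    by (rule schwartz_family_scale[OF q schwartz_family_affine[OF q fourier_family[OF q schwartz_identity_family]] order_refl])
      simp
  then show ?thesis by (simp add: inverse_fourier_def[abs_def])
qed

lemma inverse_fourier_schwartz: "f \<in> schwartz \<Longrightarrow> inverse_fourier f \<in> schwartz"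
  by (rule schwartz_family_member[OF inverse_fourier_family])

lemma fourier_inverse_fourier:
  assumes f: "f \<in> schwartz"
  shows "fourier (inverse_fourier f) = f"
proof
  fix \<xi>
  have "fourier (inverse_fourier f) \<xi> = (1 / fourier_constant) * fourier (fourier f) (- \<xi>)"
    unfolding inverse_fourier_def[abs_def] by (rule fourier_scaled_reflect[OF fourier_schwartz[OF f]])
  then show "fourier (inverse_fourier f) \<xi> = f \<xi>"
    using fourier_constant_neq_0 by (simp add: fourier_twice[OF f])
qed

lemma inverse_fourier_fourier:
  assumes "f \<in> schwartz"
  shows "inverse_fourier (fourier f) = f"
  using fourier_constant_neq_0 by (auto simp: inverse_fourier_def fourier_twice[OF assms])

lemma inverse_fourier_linear:
  assumes "f \<in> schwartz" "g \<in> schwartz"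
  shows "inverse_fourier (\<lambda>x. a * f x + b * g x) = (\<lambda>x. a * inverse_fourier f x + b * inverse_fourier g x)"
  by (auto simp: inverse_fourier_def fourier_linear[OF assms] algebra_simps)

lemma fourier_flat_lizorkin:
  fixes h :: "'a \<Rightarrow> complex"
  assumes h: "h \<in> flat_schwartz"
  shows "fourier h \<in> lizorkin"
  unfolding lizorkin_iff fourier_twice[OF flat_schwartzD(1)[OF h]]
  by (intro conjI fourier_schwartz flat_schwartzD(1)[OF h] flat_reflect_scale[OF h])

lemma lizorkin_fourier_flat:
  fixes \<phi> :: "'a \<Rightarrow> complex"
  assumes \<phi>: "\<phi> \<in> lizorkin"
  obtains h where "h \<in> flat_schwartz" "\<phi> = fourier h"
proof
  have "\<phi> \<in> schwartz" "fourier \<phi> \<in> flat_schwartz" using \<phi> by (auto simp: lizorkin_iff)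
  then show "inverse_fourier \<phi> \<in> flat_schwartz" "\<phi> = fourier (inverse_fourier \<phi>)"
    unfolding inverse_fourier_def[abs_def]
    by (simp_all only: flat_reflect_scale fourier_inverse_fourier[unfolded inverse_fourier_def[abs_def]])
qed

text \<open>The logarithmic Laplacian becomes multiplication by \<open>2 ln |\<xi>|\<close>. Its value is determined although
  the defining equation excludes the origin, because transforms of Lizorkin functions vanish there.\<close>

lemma log_laplacian_fourier:
  fixes h :: "'a \<Rightarrow> complex"
  assumes h: "h \<in> flat_schwartz"
  shows "log_laplacian (fourier h) = fourier (log_multiply h)"
  unfolding log_laplacian_def
proof (rule the_equality)
  have Lh: "log_multiply h \<in> flat_schwartz" by (rule flat_log_multiply[OF h])
  have eq: "fourier (fourier (log_multiply h)) \<xi> = of_real (2 * ln (norm \<xi>)) * fourier (fourier h) \<xi>" for \<xi>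
    by (simp add: fourier_twice flat_schwartzD(1) Lh h log_multiply_def)
  then show "fourier (log_multiply h) \<in> lizorkin \<and>
      (\<forall>\<xi>. \<xi> \<noteq> 0 \<longrightarrow> fourier (fourier (log_multiply h)) \<xi> = of_real (2 * ln (norm \<xi>)) * fourier (fourier h) \<xi>)"
    using fourier_flat_lizorkin[OF Lh] by blast
  fix \<psi> :: "'a \<Rightarrow> complex"
  assume \<psi>: "\<psi> \<in> lizorkin \<and> (\<forall>\<xi>. \<xi> \<noteq> 0 \<longrightarrow> fourier \<psi> \<xi> = of_real (2 * ln (norm \<xi>)) * fourier (fourier h) \<xi>)"
  then have s: "\<psi> \<in> schwartz" "fourier \<psi> \<in> flat_schwartz" by (auto simp: lizorkin_iff)
  have "fourier \<psi> = fourier (fourier (log_multiply h))"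
  proof
    fix \<xi>
    show "fourier \<psi> \<xi> = fourier (fourier (log_multiply h)) \<xi>"
    proof (cases "\<xi> = 0")
      case True
      have "fourier (fourier (log_multiply h)) \<in> flat_schwartz"
        using fourier_flat_lizorkin[OF Lh] by (simp add: lizorkin_iff)
      then show ?thesis using flat_schwartzD(2)[OF s(2)] flat_schwartzD(2) True by simp
    next
      case False
      then show ?thesis using \<psi> eq by simp
    qed
  qed
  then have "inverse_fourier (fourier \<psi>) = inverse_fourier (fourier (fourier (log_multiply h)))" by simp
  then show "\<psi> = fourier (log_multiply h)"
    by (simp only: inverse_fourier_fourier s(1) fourier_schwartz flat_schwartzD(1)[OF Lh])
qed

lemma log_harmonic_iff:
  fixes u :: "('a \<Rightarrow> complex) \<Rightarrow> complex"
  shows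
  "log_harmonic u \<longleftrightarrow> (\<forall>h\<in>flat_schwartz. u (fourier (log_multiply h)) = 0)"
proof
  assume u: "log_harmonic u"
  show "\<forall>h\<in>flat_schwartz. u (fourier (log_multiply h)) = 0"
  proof
    fix h :: "'a \<Rightarrow> complex" assume h: "h \<in> flat_schwartz"
    then show "u (fourier (log_multiply h)) = 0"
      using u fourier_flat_lizorkin[OF h]
      unfolding log_harmonic_def log_laplacian_dist_def log_laplacian_fourier[OF h, symmetric] by blast
  qed
next
  assume u: "\<forall>h\<in>flat_schwartz. u (fourier (log_multiply h)) = 0"
  show "log_harmonic u"
    unfolding log_harmonic_def log_laplacian_dist_def
  proof
    fix \<phi> :: "'a \<Rightarrow> complex" assume "\<phi> \<in> lizorkin"
    then obtain h where "h \<in> flat_schwartz" "\<phi> = fourier h" by (rule lizorkin_fourier_flat)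
    with u show "u (log_laplacian \<phi>) = 0" by (simp add: log_laplacian_fourier)
  qed
qed

lemma log_fundamental_solution_iff:
  fixes u :: "('a \<Rightarrow> complex) \<Rightarrow> complex"
  shows
  "log_fundamental_solution u \<longleftrightarrow> (\<forall>h\<in>flat_schwartz. u (fourier (log_multiply h)) = (\<integral>\<xi>. h \<xi> \<partial>lborel))"
proof -
  have 0: "fourier h 0 = (\<integral>\<xi>. h \<xi> \<partial>lborel)" for h :: "'a \<Rightarrow> complex" by (simp add: fourier_def)
  show ?thesis
  proof
    assume u: "log_fundamental_solution u"
    show "\<forall>h\<in>flat_schwartz. u (fourier (log_multiply h)) = (\<integral>\<xi>. h \<xi> \<partial>lborel)"
    proof
      fix h :: "'a \<Rightarrow> complex" assume h: "h \<in> flat_schwartz"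
      then show "u (fourier (log_multiply h)) = (\<integral>\<xi>. h \<xi> \<partial>lborel)"
        using u fourier_flat_lizorkin[OF h]
        unfolding log_fundamental_solution_def log_laplacian_dist_def log_laplacian_fourier[OF h, symmetric] 0[symmetric]
        by blast
    qed
  next
    assume u: "\<forall>h\<in>flat_schwartz. u (fourier (log_multiply h)) = (\<integral>\<xi>. h \<xi> \<partial>lborel)"
    show "log_fundamental_solution u"
      unfolding log_fundamental_solution_def log_laplacian_dist_def
    proof
      fix \<phi> :: "'a \<Rightarrow> complex" assume "\<phi> \<in> lizorkin"
      then obtain h where "h \<in> flat_schwartz" "\<phi> = fourier h" by (rule lizorkin_fourier_flat)
      with u show "u (log_laplacian \<phi>) = \<phi> 0" by (simp add: log_laplacian_fourier 0)
    qed
  qed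
qed

lemma tempered_inverse_fourier:
  assumes T: "T \<in> tempered_distributions"
  shows "(\<lambda>\<psi>. T (inverse_fourier \<psi>)) \<in> tempered_distributions"
  unfolding tempered_iff
proof
  have T: "linear_on schwartz T" "seminorm_bounded schwartz schwartz_seminorm T"
    using T by (simp_all add: tempered_iff)
  show "linear_on schwartz (\<lambda>\<psi>. T (inverse_fourier \<psi>))"
    by (rule linear_on_compose[OF T(1) inverse_fourier_schwartz inverse_fourier_linear])
  show "seminorm_bounded schwartz schwartz_seminorm (\<lambda>\<psi>. T (inverse_fourier \<psi>))"
    by (rule seminorm_bounded_family[OF T(2) graded_schwartz_seminorm inverse_fourier_family inverse_fourier_schwartz])
qed

lemma fourier_dist_inverse_fourier:
  "f \<in> schwartz \<Longrightarrow> fourier_dist (\<lambda>\<psi>. T (inverse_fourier \<psi>)) f = T f"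
  by (simp add: fourier_dist_def inverse_fourier_fourier)

subsection \<open>Single layers and functionals annihilating the multiples of the logarithm\<close>

text \<open>For test functions this holds because their restriction to the sphere is zero. The truncations
  of a Schwartz function by dilated bumps are test functions that still vanish on the sphere.\<close>

lemma single_layer_vanishes:
  fixes T :: "('a \<Rightarrow> complex) \<Rightarrow> complex"
  assumes T: "T \<in> single_layer \<Lambda>" "T \<in> tempered_distributions"
    and g: "g \<in> schwartz" and zero: "\<And>x. norm x = 1 \<Longrightarrow> g x = 0"
  shows "T g = 0"
proof (rule truncation_limit[OF T(2) g bump_schwartz bump_0])
  obtain S where S: "S \<in> sphere_distributions \<Lambda>" "\<And>\<phi>. \<phi> \<in> test_functions \<Longrightarrow> T \<phi> = S (sphere_restrict \<phi>)"
    using T(1) by (auto simp: single_layer_def)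
  have S0: "S (\<lambda>x. 0) = 0"
    using S(1) linear_onD(4)[OF _ lin_closedD(1)[OF lin_closed_sphere_test_functions]]
    by (simp add: sphere_distributions_iff)
  fix e :: real assume e: "0 < e"
  let ?f = "\<lambda>x. bump (e *\<^sub>R x) * g x"
  have "?f \<in> test_functions"
  proof -
    have "?f \<in> schwartz"
      using schwartz_mult[OF schwartz_multiplier[OF schwartz_affine[OF bump_schwartz, of e 0]] g] e by simp
    moreover have "compact (supp ?f)"
    proof (rule compact_supp_bounded)
      \<comment> \<open>The bump lives in the ball of radius 3: radius 2 for the cutoff and 1 for the translation.\<close>
      show "supp ?f \<subseteq> cball 0 (3 / e)"
        unfolding supp_def
      proof (rule closure_minimal)
        show "{x. ?f x \<noteq> 0} \<subseteq> cball 0 (3 / e)"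
        proof
          fix x assume "x \<in> {x. ?f x \<noteq> 0}"
          then have "\<Lambda> (e *\<^sub>R x + (SOME b. b \<in> Basis)) \<noteq> 0" by (auto simp: bump_def)
          then have "e *\<^sub>R x + (SOME b. b \<in> Basis) \<in> ball 0 2"
            using zero_outside_supp cutoff_supp(1) by blast
          then have "norm (e *\<^sub>R x) \<le> 3"
            using norm_triangle_ineq4[of "e *\<^sub>R x + (SOME b. b \<in> Basis)" "SOME b. b \<in> Basis"]
              norm_Basis[OF SOME_Basis, where 'a = 'a] by simp
          then show "x \<in> cball 0 (3 / e)" using e by (simp add: field_simps)
        qed
      qed simp
    qed simp
    ultimately show ?thesis by (simp add: test_functions_def schwartz_def)
  qed
  moreover have "sphere_restrict ?f = (\<lambda>x. 0)" using zero by (auto simp: sphere_restrict_def)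
  ultimately show "T ?f = 0" using S(2) S0 by simp
qed

text \<open>The Fourier transform of the representative of \<open>u\<close>. The factor \<open>\<Lambda>\<close> makes it vanish near the
  origin and turns every Schwartz function into a flat one, to which \<open>u\<close> can be applied.\<close>

definition cutoff_transform :: "(('a \<Rightarrow> complex) \<Rightarrow> complex) \<Rightarrow> ('a \<Rightarrow> complex) \<Rightarrow> complex"
  where "cutoff_transform u f = u (fourier (\<lambda>x. \<Lambda>\<^sub>c x * f x))"

lemma cutoff_transform_tempered:
  assumes u: "u \<in> lizorkin_dual"
  shows "cutoff_transform u \<in> tempered_distributions"
  unfolding tempered_iff cutoff_transform_def[abs_def]
proof
  have u: "linear_on lizorkin u" "seminorm_bounded lizorkin schwartz_seminorm u"
    using u by (simp_all add: lizorkin_dual_iff)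
  have mem: "fourier (\<lambda>x. \<Lambda>\<^sub>c x * f x) \<in> lizorkin" if "f \<in> schwartz" for f
    by (rule fourier_flat_lizorkin[OF cutoff_mult_flat[OF that]])
  show "linear_on schwartz (\<lambda>f. u (fourier (\<lambda>x. \<Lambda>\<^sub>c x * f x)))"
  proof (rule linear_on_compose[OF u(1) mem])
    fix f g :: "'a \<Rightarrow> complex" and a b assume fg: "f \<in> schwartz" "g \<in> schwartz"
    have "(\<lambda>x. \<Lambda>\<^sub>c x * (a * f x + b * g x)) = (\<lambda>x. a * (\<Lambda>\<^sub>c x * f x) + b * (\<Lambda>\<^sub>c x * g x))"
      by (auto simp: algebra_simps)
    then show "fourier (\<lambda>x. \<Lambda>\<^sub>c x * (a * f x + b * g x)) =
        (\<lambda>x. a * fourier (\<lambda>x. \<Lambda>\<^sub>c x * f x) x + b * fourier (\<lambda>x. \<Lambda>\<^sub>c x * g x) x)"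
      by (simp only: fourier_linear flat_schwartzD(1)[OF cutoff_mult_flat] fg)
  qed
  have "(\<lambda>f x. \<Lambda>\<^sub>c x * f x) \<in> schwartz_family schwartz schwartz_seminorm"
    by (rule schwartz_family_mult[OF graded_schwartz_seminorm
          schwartz_multiplier[OF flat_schwartzD(1)[OF cutoff_flat]] schwartz_identity_family])
  from seminorm_bounded_family[OF u(2) graded_schwartz_seminorm fourier_family[OF graded_schwartz_seminorm this] mem]
  show "seminorm_bounded schwartz schwartz_seminorm (\<lambda>f. u (fourier (\<lambda>x. \<Lambda>\<^sub>c x * f x)))" .
qed

text \<open>By \<open>log_division\<close> the difference of \<open>f\<close> and \<open>g\<close> is the product of \<open>2 ln |\<xi>|\<close> and a flat function.\<close>

lemma harmonic_determined_on_sphere: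
  fixes u :: "('a \<Rightarrow> complex) \<Rightarrow> complex"
  assumes u: "u \<in> lizorkin_dual" "log_harmonic u"
    and f: "f \<in> flat_schwartz" and g: "g \<in> flat_schwartz"
    and eq: "\<And>x. norm x = 1 \<Longrightarrow> f x = g x"
  shows "u (fourier f) = u (fourier g)"
proof -
  have lin: "linear_on lizorkin u" using u(1) by (simp add: lizorkin_dual_iff)
  have "(\<lambda>x. 1 * f x + (- 1) * g x) \<in> flat_schwartz" by (rule flat_linear[OF f g])
  then have fg: "(\<lambda>x. f x - g x) \<in> flat_schwartz" by simp
  from log_division[OF fg] eq obtain h where h: "h \<in> flat_schwartz" "(\<lambda>x. f x - g x) = log_multiply h"
    by auto
  have "u (fourier (\<lambda>x. f x - g x)) = 0" using u(2) h by (simp add: log_harmonic_iff)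
  moreover have "fourier (\<lambda>x. f x - g x) = (\<lambda>x. fourier f x - fourier g x)"
    using fourier_linear[OF flat_schwartzD(1)[OF f] flat_schwartzD(1)[OF g], of 1 "- 1"] by simp
  ultimately show ?thesis
    using linear_onD(2)[OF lin fourier_flat_lizorkin[OF g] fourier_flat_lizorkin[OF f]] by simp
qed

text \<open>The functional on the sphere applies \<open>u\<close> to the transform of the extension of \<open>\<tau>\<close>. It is the right
  one because \<open>\<Lambda> \<phi>\<close> and the extension of the restriction of \<open>\<phi>\<close> agree on the sphere.\<close>

lemma cutoff_transform_single_layer:
  fixes T :: "('a \<Rightarrow> complex) \<Rightarrow> complex"
  assumes u: "u \<in> lizorkin_dual" "log_harmonic u"
    and T: "T \<in> distributions" "\<And>\<phi>. \<phi> \<in> test_functions \<Longrightarrow> T \<phi> = cutoff_transform u \<phi>"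
  shows "T \<in> single_layer \<Lambda>"
  unfolding single_layer_def
proof (intro CollectI conjI T(1) bexI[of _ "\<lambda>\<tau>. u (fourier (sphere_ext \<Lambda> \<tau>))"] ballI)
  have lin: "linear_on lizorkin u" and bd: "seminorm_bounded lizorkin schwartz_seminorm u"
    using u(1) by (simp_all add: lizorkin_dual_iff)
  have flat: "sphere_ext \<Lambda> \<tau> \<in> flat_schwartz" if \<tau>: "\<tau> \<in> sphere_test_functions \<Lambda>" for \<tau>
  proof -
    have "0 \<notin> supp (sphere_ext \<Lambda> \<tau>)" using supp_sphere_ext cutoff_supp(2) by blast
    then show ?thesis
      using test_functions_schwartz[OF sphere_ext_test[OF \<tau>]]
      by (simp add: flat_schwartz_def pderivs_outside_supp)
  qed
  have mem: "fourier (sphere_ext \<Lambda> \<tau>) \<in> lizorkin" if "\<tau> \<in> sphere_test_functions \<Lambda>" for \<tau>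
    by (rule fourier_flat_lizorkin[OF flat[OF that]])
  show "(\<lambda>\<tau>. u (fourier (sphere_ext \<Lambda> \<tau>))) \<in> sphere_distributions \<Lambda>"
    unfolding sphere_distributions_iff
  proof
    show "linear_on (sphere_test_functions \<Lambda>) (\<lambda>\<tau>. u (fourier (sphere_ext \<Lambda> \<tau>)))"
      by (rule linear_on_compose[OF lin mem])
        (simp_all add: sphere_ext_linear fourier_linear flat_schwartzD(1)[OF flat])
    note q = seminorms_onD(2)[OF seminorms_on_sphere]
    show "seminorm_bounded (sphere_test_functions \<Lambda>) (sphere_seminorm \<Lambda>) (\<lambda>\<tau>. u (fourier (sphere_ext \<Lambda> \<tau>)))"
      by (rule seminorm_bounded_family[OF bd q fourier_family[OF q sphere_ext_family] mem])
  qed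
  fix \<phi> :: "'a \<Rightarrow> complex" assume \<phi>: "\<phi> \<in> test_functions"
  note s = test_functions_schwartz[OF \<phi>]
  have "u (fourier (\<lambda>x. \<Lambda>\<^sub>c x * \<phi> x)) = u (fourier (sphere_ext \<Lambda> (sphere_restrict \<phi>)))"
  proof (rule harmonic_determined_on_sphere[OF u cutoff_mult_flat[OF s] sphere_ext_restrict_flat[OF s]])
    fix x :: 'a assume "norm x = 1"
    then show "\<Lambda>\<^sub>c x * \<phi> x = sphere_ext \<Lambda> (sphere_restrict \<phi>) x"
      by (auto simp: sphere_ext_def sphere_restrict_def cutoff_sphere)
  qed
  then show "T \<phi> = u (fourier (sphere_ext \<Lambda> (sphere_restrict \<phi>)))"
    using T(2)[OF \<phi>] by (simp add: cutoff_transform_def)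
qed

text \<open>Harmonicity enters once more: it makes the cutoff invisible on Lizorkin functions.\<close>

lemma harmonic_representative:
  assumes u: "u \<in> lizorkin_dual" "log_harmonic u"
  obtains U where "U \<in> tempered_distributions" "\<And>\<phi>. \<phi> \<in> lizorkin \<Longrightarrow> U \<phi> = u \<phi>"
    "\<And>\<phi>. \<phi> \<in> test_functions \<Longrightarrow> supp \<phi> \<subseteq> - supp \<Lambda> \<Longrightarrow> fourier_dist U \<phi> = 0"
    "fourier_dist U \<in> single_layer \<Lambda>"
proof
  let ?U = "\<lambda>\<psi>. cutoff_transform u (inverse_fourier \<psi>)"
  show U: "?U \<in> tempered_distributions"
    by (rule tempered_inverse_fourier[OF cutoff_transform_tempered[OF u(1)]])
  have FU: "fourier_dist ?U \<phi> = cutoff_transform u \<phi>" if "\<phi> \<in> test_functions" for \<phi>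
    by (rule fourier_dist_inverse_fourier[OF test_functions_schwartz[OF that]])
  show "?U \<phi> = u \<phi>" if "\<phi> \<in> lizorkin" for \<phi>
  proof -
    from that obtain h where h: "h \<in> flat_schwartz" "\<phi> = fourier h" by (rule lizorkin_fourier_flat)
    have "?U \<phi> = u (fourier (\<lambda>x. \<Lambda>\<^sub>c x * h x))"
      by (simp add: h(2) inverse_fourier_fourier flat_schwartzD(1)[OF h(1)] cutoff_transform_def)
    also have "\<dots> = u (fourier h)"
      by (rule harmonic_determined_on_sphere[OF u cutoff_mult_flat[OF flat_schwartzD(1)[OF h(1)]] h(1)])
        (simp add: cutoff_sphere)
    finally show ?thesis by (simp add: h(2))
  qed
  show "fourier_dist ?U \<phi> = 0" if \<phi>: "\<phi> \<in> test_functions" "supp \<phi> \<subseteq> - supp \<Lambda>" for \<phi>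
  proof -
    have "\<Lambda>\<^sub>c x * \<phi> x = 0" for x
      using \<phi>(2) zero_outside_supp[of x \<phi>] zero_outside_supp[of x \<Lambda>] by auto
    then have "cutoff_transform u \<phi> = u (fourier (\<lambda>x. 0))"
      unfolding cutoff_transform_def by (simp only:)
    then have "fourier_dist ?U \<phi> = u (fourier (\<lambda>x. 0))"
      by (simp only: FU[OF \<phi>(1)])
    also have "fourier (\<lambda>x. 0) = (\<lambda>x::'a. 0)" by (auto simp: fourier_def)
    also have "u (\<lambda>x. 0) = 0"
    proof (rule linear_onD(4)[OF _ lin_closedD(1)[OF lin_closed_lizorkin]])
      show "linear_on lizorkin u" using u(1) by (simp add: lizorkin_dual_iff)
    qed
    finally show ?thesis .
  qed
  have "fourier_dist ?U \<in> distributions"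
    using tempered_fourier_dist[OF U] tempered_distributions_subset by blast
  then show "fourier_dist ?U \<in> single_layer \<Lambda>"
    by (rule cutoff_transform_single_layer[OF u _ FU])
qed

lemma open_complement_cutoff: "open (- supp \<Lambda>)"
  by (simp add: supp_def open_Compl)

theorem liouville:
  assumes u: "u \<in> lizorkin_dual"
  shows "log_harmonic u \<longleftrightarrow> (\<exists>U. normalized_representative u U \<and> fourier_dist U \<in> single_layer \<Lambda>)"
proof
  assume "log_harmonic u"
  from harmonic_representative[OF u this] obtain U where
    U: "U \<in> tempered_distributions" "\<And>\<phi>. \<phi> \<in> lizorkin \<Longrightarrow> U \<phi> = u \<phi>"
    "\<And>\<phi>. \<phi> \<in> test_functions \<Longrightarrow> supp \<phi> \<subseteq> - supp \<Lambda> \<Longrightarrow> fourier_dist U \<phi> = 0"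
    "fourier_dist U \<in> single_layer \<Lambda>" by metis
  have "normalized_representative u U"
    unfolding normalized_representative_def
  proof (intro conjI ballI exI[of _ "- supp \<Lambda>"] exI[of _ "\<lambda>_. 0"] impI)
    show "locally_integrable_on (- supp \<Lambda>) (\<lambda>_. 0)"
      by (simp add: locally_integrable_on_def set_integrable_def)
    show "fourier_dist U \<phi> = (LINT \<xi>:- supp \<Lambda>|lborel. 0 * \<phi> \<xi>)"
      if "\<phi> \<in> test_functions" "supp \<phi> \<subseteq> - supp \<Lambda>" for \<phi>
      using U(3)[OF that] by (simp add: set_lebesgue_integral_def)
  qed (use U open_complement_cutoff cutoff_supp(2) in auto)
  with U(4) show "\<exists>U. normalized_representative u U \<and> fourier_dist U \<in> single_layer \<Lambda>" by blast
next
  assume "\<exists>U. normalized_representative u U \<and> fourier_dist U \<in> single_layer \<Lambda>"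
  then obtain U where U: "U \<in> tempered_distributions" "\<And>\<phi>. \<phi> \<in> lizorkin \<Longrightarrow> U \<phi> = u \<phi>"
    "fourier_dist U \<in> single_layer \<Lambda>"
    unfolding normalized_representative_def by blast
  show "log_harmonic u"
    unfolding log_harmonic_iff
  proof
    fix h :: "'a \<Rightarrow> complex" assume h: "h \<in> flat_schwartz"
    note Lh = flat_log_multiply[OF h]
    have "fourier_dist U (log_multiply h) = 0"
      by (rule single_layer_vanishes[OF U(3) tempered_fourier_dist[OF U(1)] flat_schwartzD(1)[OF Lh]])
        (simp add: log_multiply_def)
    then show "u (fourier (log_multiply h)) = 0"
      using U(2)[OF fourier_flat_lizorkin[OF Lh]] by (simp add: fourier_dist_def)
  qed
qed

text \<open>The inverse transform of \<open>E_log_hat\<close> is one fundamental solution, so \<open>E\<close> minus it is harmonic. Near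
  the origin the transform of the harmonic part vanishes, which leaves the locally integrable
  function \<open>1 / (2 ln |\<xi>|)\<close>.\<close>

theorem fundamental_solutions:
  assumes E: "E \<in> lizorkin_dual"
  shows "log_fundamental_solution E \<longleftrightarrow>
    (\<exists>U. normalized_representative E U \<and>
      (\<exists>v\<in>single_layer \<Lambda> \<inter> tempered_distributions.
        \<forall>\<phi>\<in>schwartz. fourier_dist U \<phi> = E_log_hat \<phi> + v \<phi>))"
proof
  assume sol: "log_fundamental_solution E"
  define E0 where "E0 \<psi> = E_log_hat (inverse_fourier \<psi>)" for \<psi> :: "'a \<Rightarrow> complex"
  have E0: "E0 \<in> tempered_distributions"
    unfolding E0_def[abs_def] by (rule tempered_inverse_fourier[OF E_log_hat_tempered])
  have FE0: "fourier_dist E0 \<phi> = E_log_hat \<phi>" if "\<phi> \<in> schwartz" for \<phi>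
    unfolding E0_def[abs_def] by (rule fourier_dist_inverse_fourier[OF that])
  define u where "u \<psi> = E \<psi> - E0 \<psi>" for \<psi>
  have u: "u \<in> lizorkin_dual"
    using add_tempered[OF lizorkin_schwartz, of E E0 "- 1"] E E0
    by (simp add: u_def[abs_def] lizorkin_dual_iff tempered_iff)
  have "log_harmonic u"
    unfolding log_harmonic_iff
  proof
    fix h :: "'a \<Rightarrow> complex" assume h: "h \<in> flat_schwartz"
    have "E0 (fourier (log_multiply h)) = E_log_hat (log_multiply h)"
      using FE0[OF flat_schwartzD(1)[OF flat_log_multiply[OF h]]] by (simp add: fourier_dist_def)
    then show "u (fourier (log_multiply h)) = 0"
      using sol h by (simp add: u_def log_fundamental_solution_iff E_log_hat_log_multiply)
  qed
  from harmonic_representative[OF u this] obtain U where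
    U: "U \<in> tempered_distributions" "\<And>\<phi>. \<phi> \<in> lizorkin \<Longrightarrow> U \<phi> = u \<phi>"
    "\<And>\<phi>. \<phi> \<in> test_functions \<Longrightarrow> supp \<phi> \<subseteq> - supp \<Lambda> \<Longrightarrow> fourier_dist U \<phi> = 0"
    "fourier_dist U \<in> single_layer \<Lambda>" by metis
  let ?W = "\<lambda>\<psi>. U \<psi> + 1 * E0 \<psi>"
  let ?V = "ball 0 (1/2) \<inter> - supp \<Lambda>"
  have FW: "fourier_dist ?W \<phi> = E_log_hat \<phi> + fourier_dist U \<phi>" if "\<phi> \<in> schwartz" for \<phi>
    using FE0[OF that] by (simp add: fourier_dist_def)
  have "normalized_representative E ?W"
    unfolding normalized_representative_def
  proof (intro conjI ballI exI[of _ ?V] exI[of _ "\<lambda>\<xi>. 1 / of_real (2 * ln (norm \<xi>))"] impI)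
    show "?W \<in> tempered_distributions"
      using add_tempered[OF order_refl, of U E0 1] U(1) E0 unfolding tempered_iff by blast
    show "?W \<phi> = E \<phi>" if "\<phi> \<in> lizorkin" for \<phi> using U(2)[OF that] by (simp add: u_def)
    show "open ?V" using open_complement_cutoff by auto
    show "0 \<in> ?V" using cutoff_supp(2) by simp
    show "locally_integrable_on ?V (\<lambda>\<xi>. 1 / of_real (2 * ln (norm \<xi>)))"
      by (rule inverse_log_locally_integrable) blast
    fix \<phi> :: "'a \<Rightarrow> complex" assume \<phi>: "\<phi> \<in> test_functions" "supp \<phi> \<subseteq> ?V"
    show "fourier_dist ?W \<phi> = (LINT \<xi>:?V|lborel. 1 / of_real (2 * ln (norm \<xi>)) * \<phi> \<xi>)"
      using FW[OF test_functions_schwartz[OF \<phi>(1)]] U(3)[OF \<phi>(1)] \<phi>(2) E_log_hat_near_origin[OF \<phi>(2)]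
      by auto
  qed
  with FW U(4) tempered_fourier_dist[OF U(1)]
  show "\<exists>U. normalized_representative E U \<and>
      (\<exists>v\<in>single_layer \<Lambda> \<inter> tempered_distributions. \<forall>\<phi>\<in>schwartz. fourier_dist U \<phi> = E_log_hat \<phi> + v \<phi>)"
    by blast
next
  assume "\<exists>U. normalized_representative E U \<and>
      (\<exists>v\<in>single_layer \<Lambda> \<inter> tempered_distributions. \<forall>\<phi>\<in>schwartz. fourier_dist U \<phi> = E_log_hat \<phi> + v \<phi>)"
  then obtain U v where U: "\<And>\<phi>. \<phi> \<in> lizorkin \<Longrightarrow> U \<phi> = E \<phi>"
    and v: "v \<in> single_layer \<Lambda>" "v \<in> tempered_distributions"
    and FU: "\<And>\<phi>. \<phi> \<in> schwartz \<Longrightarrow> fourier_dist U \<phi> = E_log_hat \<phi> + v \<phi>"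
    unfolding normalized_representative_def by blast
  show "log_fundamental_solution E"
    unfolding log_fundamental_solution_iff
  proof
    fix h :: "'a \<Rightarrow> complex" assume h: "h \<in> flat_schwartz"
    note Lh = flat_log_multiply[OF h]
    have "v (log_multiply h) = 0"
      by (rule single_layer_vanishes[OF v flat_schwartzD(1)[OF Lh]]) (simp add: log_multiply_def)
    then have "fourier_dist U (log_multiply h) = (\<integral>\<xi>. h \<xi> \<partial>lborel)"
      using FU[OF flat_schwartzD(1)[OF Lh]] by (simp add: E_log_hat_log_multiply[OF h])
    then show "E (fourier (log_multiply h)) = (\<integral>\<xi>. h \<xi> \<partial>lborel)"
      using U[OF fourier_flat_lizorkin[OF Lh]] by (simp add: fourier_dist_def)
  qed
qed

end

theorem theorem2:
  fixes \<Lambda> :: "'a::euclidean_space \<Rightarrow> real"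
  assumes "sphere_cutoff \<Lambda>"
  shows "(\<forall>u\<in>lizorkin_dual.
            log_harmonic u \<longleftrightarrow>
              (\<exists>U. normalized_representative u U \<and> fourier_dist U \<in> single_layer \<Lambda>)) \<and>
         (\<forall>E\<in>lizorkin_dual.
            log_fundamental_solution E \<longleftrightarrow>
              (\<exists>U. normalized_representative E U \<and>
                (\<exists>v\<in>single_layer \<Lambda> \<inter> tempered_distributions.
                   \<forall>\<phi>\<in>schwartz. fourier_dist U \<phi> = E_log_hat \<phi> + v \<phi>)))"
proof -
  interpret sphere_cutoff_function \<Lambda> by (rule sphere_cutoff_function.intro[OF assms])
  show ?thesis using liouville fundamental_solutions by blast
qed

end
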